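(* Let $D$ be good, with $r$ distinct prime factors, and assume $\operatorname{sign}(D) = -\epsilon_D$. Let $R_D(X)$ be the number of integers $q$ with $|q|\le X$, $Dq$ square-free, such that $\mathbb{Q}(\sqrt{Dq})$ is a real quadratic field over which there exists an elliptic curve with everywhere good reduction and rational $j$-invariant. Then $$R_D(X) \gg \frac{X}{(\log X)^{1-1/2^r}}.$$
   Context: Let $\mathcal{R}=\{A\in\mathbb{Z} : \text{if } 2\mid A \text{ then } 16\mid A \text{ or } 16\mid A-4;\ \text{if } 3\mid A \text{ then } 27\mid A-12\}$. A square-free integer $D$ is called good if there exist $A\in\mathcal{R}$ and $t\in\mathbb{Z}$ with $Dt^2 = A^3-1728$. For good $D$, set $\epsilon_D = 1$ if $D\equiv 1 \pmod 4$ and $\epsilon_D=-1$ otherwise. An elliptic curve $E/K$ has everywhere good reduction if it has good reduction at every prime of $\mathcal{O}_K$. *)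

theory Defs
  imports "HOL-Analysis.Analysis" "HOL-Computational_Algebra.Computational_Algebra"
begin

definition R_set :: "int set" where
  "R_set = {A. (2 dvd A \<longrightarrow> 16 dvd A \<or> 16 dvd (A - 4)) \<and> (3 dvd A \<longrightarrow> 27 dvd (A - 12))}"

definition good :: "int \<Rightarrow> bool" where
  "good D \<longleftrightarrow> squarefree D \<and> (\<exists>A\<in>R_set. \<exists>t::int. D * t^2 = A^3 - 1728)"

definition eps :: "int \<Rightarrow> int" where
  "eps D = (if D mod 4 = 1 then 1 else -1)"

text \<open>For m > 0, K = Q(sqrt m) realised as a subfield of the reals.\<close>
definition qfield :: "int \<Rightarrow> real set" where
  "qfield m = {x. \<exists>a b :: rat. x = of_rat a + of_rat b * sqrt (of_int m)}"

definition ring_of_integers :: "int \<Rightarrow> real set" where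
  "ring_of_integers m = {x \<in> qfield m. algebraic_int x}"

definition nonzero_prime_ideal :: "int \<Rightarrow> real set \<Rightarrow> bool" where
  "nonzero_prime_ideal m P \<longleftrightarrow>
     P \<subseteq> ring_of_integers m \<and> 0 \<in> P \<and>
     (\<forall>x\<in>P. \<forall>y\<in>P. x + y \<in> P) \<and>
     (\<forall>x\<in>P. \<forall>a\<in>ring_of_integers m. a * x \<in> P) \<and>
     P \<noteq> ring_of_integers m \<and> P \<noteq> {0} \<and>
     (\<forall>a\<in>ring_of_integers m. \<forall>b\<in>ring_of_integers m. a * b \<in> P \<longrightarrow> a \<in> P \<or> b \<in> P)"

definition local_ring :: "int \<Rightarrow> real set \<Rightarrow> real set" where
  "local_ring m P = {a / b | a b. a \<in> ring_of_integers m \<and> b \<in> ring_of_integers m - P}"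

definition local_unit :: "int \<Rightarrow> real set \<Rightarrow> real \<Rightarrow> bool" where
  "local_unit m P x \<longleftrightarrow> x \<noteq> 0 \<and> x \<in> local_ring m P \<and> inverse x \<in> local_ring m P"

text \<open>A Weierstrass equation y^2 + a1 xy + a3 y = x^3 + a2 x^2 + a4 x + a6,
  given by its coefficient tuple (a1, a2, a3, a4, a6).\<close>
type_synonym weq = "real \<times> real \<times> real \<times> real \<times> real"

fun b2 :: "weq \<Rightarrow> real" where "b2 (a1, a2, a3, a4, a6) = a1^2 + 4 * a2"
fun b4 :: "weq \<Rightarrow> real" where "b4 (a1, a2, a3, a4, a6) = 2 * a4 + a1 * a3"
fun b6 :: "weq \<Rightarrow> real" where "b6 (a1, a2, a3, a4, a6) = a3^2 + 4 * a6"
fun b8 :: "weq \<Rightarrow> real" where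
  "b8 (a1, a2, a3, a4, a6) = a1^2 * a6 + 4 * a2 * a6 - a1 * a3 * a4 + a2 * a3^2 - a4^2"

definition disc :: "weq \<Rightarrow> real" where
  "disc E = - ((b2 E)^2 * b8 E) - 8 * (b4 E)^3 - 27 * (b6 E)^2 + 9 * b2 E * b4 E * b6 E"

definition c4 :: "weq \<Rightarrow> real" where
  "c4 E = (b2 E)^2 - 24 * b4 E"

definition j_inv :: "weq \<Rightarrow> real" where
  "j_inv E = (c4 E)^3 / disc E"

fun coeffs_in :: "real set \<Rightarrow> weq \<Rightarrow> bool" where
  "coeffs_in S (a1, a2, a3, a4, a6) \<longleftrightarrow> a1 \<in> S \<and> a2 \<in> S \<and> a3 \<in> S \<and> a4 \<in> S \<and> a6 \<in> S"

definition elliptic_curve_over :: "int \<Rightarrow> weq \<Rightarrow> bool" where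
  "elliptic_curve_over m E \<longleftrightarrow> coeffs_in (qfield m) E \<and> disc E \<noteq> 0"

text \<open>Standard change of variables x = u^2 x' + r, y = u^3 y' + s u^2 x' + t.\<close>
fun wtrans :: "real \<Rightarrow> real \<Rightarrow> real \<Rightarrow> real \<Rightarrow> weq \<Rightarrow> weq" where
  "wtrans u r s t (a1, a2, a3, a4, a6) =
     ((a1 + 2 * s) / u,
      (a2 - s * a1 + 3 * r - s^2) / u^2,
      (a3 + r * a1 + 2 * t) / u^3,
      (a4 - s * a3 + 2 * r * a2 - (t + r * s) * a1 + 3 * r^2 - 2 * s * t) / u^4,
      (a6 + r * a4 + r^2 * a2 + r^3 - t * a3 - t^2 - r * t * a1) / u^6)"

definition good_reduction_at :: "int \<Rightarrow> real set \<Rightarrow> weq \<Rightarrow> bool" where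
  "good_reduction_at m P E \<longleftrightarrow>
     (\<exists>u r s t. u \<in> qfield m \<and> u \<noteq> 0 \<and> r \<in> qfield m \<and> s \<in> qfield m \<and> t \<in> qfield m \<and>
        coeffs_in (local_ring m P) (wtrans u r s t E) \<and>
        local_unit m P (disc (wtrans u r s t E)))"

definition everywhere_good_reduction :: "int \<Rightarrow> weq \<Rightarrow> bool" where
  "everywhere_good_reduction m E \<longleftrightarrow>
     (\<forall>P. nonzero_prime_ideal m P \<longrightarrow> good_reduction_at m P E)"

definition R_count :: "int \<Rightarrow> real \<Rightarrow> nat" where
  "R_count D X = card {q :: int. \<bar>real_of_int q\<bar> \<le> X \<and> squarefree (D * q) \<and> D * q > 1 \<and>
      (\<exists>E. elliptic_curve_over (D * q) E \<and> everywhere_good_reduction (D * q) E \<and> j_inv E \<in> \<rat>)}"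

end

theory Submission
  imports Defs "HOL-Number_Theory.Number_Theory" "HOL-Number_Theory.Prime_Powers"
    "HOL-Library.Discrete_Functions" "HOL-Real_Asymp.Real_Asymp"
begin

text \<open>
  Let \<open>D t\<^sup>2 = A\<^sup>3 - 1728\<close>. The curves with \<open>j = A\<^sup>3\<close> over \<open>K = \<rat>(\<surd>(D q))\<close> are the twists with
  \<open>c4 = A D w\<^sup>2\<close>, \<open>c6 = D\<^sup>2 t w\<^sup>3\<close>, \<open>\<Delta> = D\<^sup>3 w\<^sup>6\<close>. An integral point of the conic
  \<open>D x\<^sup>2 - q y\<^sup>2 = \<epsilon> z\<^sup>2\<close> gives \<open>w = D x + y \<surd>(D q)\<close>, of norm \<open>\<epsilon> D z\<^sup>2\<close>, whose ideal is a square
  away from the ramified primes dividing \<open>D\<close>. Hence \<open>\<Delta>\<close> is a twelfth power times a unit at every prime,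
  and the sign of \<open>t\<close> can be chosen to make the reduction good above 2 as well.

  With \<open>d = \<bar>D\<bar>\<close> and \<open>n = \<bar>q\<bar>\<close>, the sign hypothesis turns the conic into \<open>n y\<^sup>2 = z\<^sup>2 + d x\<^sup>2\<close>.
  By Legendre's theorem it is soluble if \<open>-d\<close> is a square modulo \<open>n\<close> and \<open>n\<close> is a square modulo \<open>d\<close>.
  By reciprocity this holds if every prime factor of \<open>n\<close> takes the value 1 under \<open>r\<close> independent real
  characters, which singles out a set of primes of density \<open>1 / 2\<^sup>r\<close>. Mertens' theorem for real characters
  and an elementary form of Wirsing's argument then give the lower bound. A remaining condition on \<open>n\<close>
  modulo 8 is met by multiplying \<open>n\<close> with one of finitely many constants.
\<close>

section \<open>Good reduction from a point on the conic\<close>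

text \<open>The exponent leaves no slack: the primes must be cut out by one character for each of
  the \<open>r\<close> primes dividing \<open>D\<close>. The sign hypothesis makes this possible:
  for odd \<open>D\<close> it gives -d the class 1 modulo 4, so that -d is a product of prime
  discriminants and no further character modulo 4 intervenes. For the same reason the condition
  modulo 8 is not imposed on the primes, which would cut their density further; a bounded multiplier
  costs only a constant.

  At 2 a point of the conic with \<open>z\<close> odd is required. For odd \<open>D\<close> the
  class chosen modulo 8 makes 2 inert in the real quadratic field, with a residue field that has
  three units; this is why cubing a point repairs an even \<open>z\<close>.

  Good reduction is verified at an arbitrary prime ideal by exhibiting integral equations, and the
  norm identity for \<open>w\<close> replaces the factorisation of ideals. On the analytic side the
  non-vanishing at 1 is proved by real methods, and a logarithmic sum is turned into a count by
  attaching one large prime to each small square-free number.\<close>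

lemma odd_square_mod_8:
  fixes x :: int
  assumes "odd x" obtains k where "x\<^sup>2 = 8 * k + 1"
proof -
  obtain j where j: "x = 2 * j + 1" using assms by (rule oddE)
  have "even (j * (j + 1))" by simp
  then obtain l where "j * (j + 1) = 2 * l" by blast
  then have "x\<^sup>2 = 8 * l + 1" unfolding j by (simp add: power2_eq_square algebra_simps)
  then show thesis using that by blast
qed

section \<open>Weierstrass equations with prescribed invariants\<close>

definition c6 :: "weq \<Rightarrow> real" where
  "c6 E = - ((b2 E)^3) + 36 * b2 E * b4 E - 216 * b6 E"

lemma disc_eq_c4_c6: "1728 * disc E = c4 E ^ 3 - c6 E ^ 2"
proof (cases E)
  case (fields a1 a2 a3 a4 a6)
  show ?thesis unfolding fields disc_def c4_def c6_def b2.simps b4.simps b6.simps b8.simps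
    by Groebner_Basis.algebra
qed

text \<open>Normalised so that the invariants are exactly \<open>C4\<close> and \<open>C6\<close>;
  the curves of the theorem are specified by their invariants in this way.\<close>

definition short_weq :: "real \<Rightarrow> real \<Rightarrow> weq" where
  "short_weq C4 C6 = (0, 0, 0, - C4 / 48, - C6 / 864)"

lemma c4_short [simp]: "c4 (short_weq C4 C6) = C4"
  and c6_short [simp]: "c6 (short_weq C4 C6) = C6"
  by (simp_all add: short_weq_def c4_def c6_def)

text \<open>The substitution undoes completing the square and the cube in \<open>E\<close>, rescaled
  by \<open>u\<close>. Hence a model of the short curve is recognised by comparing \<open>c4\<close>
  and \<open>c6\<close> alone.\<close>

lemma wtrans_short:
  assumes u: "u \<noteq> 0" and E: "E = (a1, a2, a3, a4, a6)"
    and C4: "C4 = c4 E * u ^ 4" and C6: "C6 = c6 E * u ^ 6"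
  shows "wtrans u (u^2 * b2 E / 12) (u * a1 / 2) (u^3 * a3 / 2) (short_weq C4 C6) = E"
proof -
  define v where "v = 1 / u"
  have v: "u * v = 1" using u by (simp add: v_def)
  have *: "x / u ^ k = x * v ^ k" for x k by (simp add: v_def power_one_over field_simps)
  have **: "x / u = x * v" for x using *[of x 1] by simp
  have uv: "u^2 * v^2 = 1" "u^3 * v^3 = 1" "u^4 * v^4 = 1" "u^6 * v^6 = 1"
    using v by (simp_all flip: power_mult_distrib)
  define r s t where "r = u\<^sup>2 * (a1\<^sup>2 + 4 * a2) / 12" and "s = u * a1 / 2" and "t = u^3*a3/2"
  note defs = r_def s_def t_def
  have 1: "2 * s = u * a1" "3 * r - s^2 = u^2 * a2" "2 * t = u^3 * a3"
    by (simp_all add: defs field_simps power2_eq_square)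
  have 2: "- C4 / 48 + 3 * r\<^sup>2 - 2 * s * t = u^4 * a4"
    by (simp add: C4 E c4_def defs field_simps power2_eq_square power4_eq_xxxx power3_eq_cube)
  have 3: "- C6 / 864 + r * (- C4 / 48) + r ^ 3 - t\<^sup>2 = u^6 * a6"
    by (simp add: C4 C6 E c4_def c6_def defs field_simps eval_nat_numeral)
  have "wtrans u r s t (short_weq C4 C6) =
      ((2 * s) * v, (3 * r - s^2) * v^2, (2 * t) * v^3, (- C4 / 48 + 3 * r\<^sup>2 - 2 * s * t) * v^4,
       (- C6 / 864 + r * (- C4 / 48) + r ^ 3 - t\<^sup>2) * v^6)"
    by (simp add: short_weq_def * **)
  also have "\<dots> = (u * v * a1, u^2 * v^2 * a2, u^3 * v^3 * a3, u^4 * v^4 * a4, u^6 * v^6 * a6)"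
    unfolding 2 3 unfolding 1 by (simp add: mult_ac)
  also have "\<dots> = E"
    unfolding uv v by (simp add: E)
  finally show ?thesis by (simp add: defs E)
qed

section \<open>Arithmetic of the real quadratic field\<close>

lemma qfield_of_int [simp, intro]: "of_int a \<in> qfield m"
  proof -
  have "of_int a = of_rat (of_int a) + of_rat 0 * sqrt (of_int m)" by simp
  then show ?thesis unfolding qfield_def by blast
qed

lemma qfield_numeral [simp, intro]: "numeral k \<in> qfield m"
  using qfield_of_int[of "numeral k" m] by simp

lemma qfield_add [intro]: "x \<in> qfield m \<Longrightarrow> y \<in> qfield m \<Longrightarrow> x + y \<in> qfield m"
proof -
  assume "x \<in> qfield m" "y \<in> qfield m"
  then obtain a b c d :: rat where "x = of_rat a + of_rat b * sqrt (of_int m)" "y = of_rat c + of_rat d * sqrt (of_int m)"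
    by (auto simp: qfield_def)
  then have "x + y = of_rat (a + c) + of_rat (b + d) * sqrt (of_int m)"
    by (simp add: of_rat_add algebra_simps)
  then show ?thesis by (auto simp: qfield_def)
qed

lemma qfield_mult [intro]:
  assumes "m \<ge> 0" "x \<in> qfield m" "y \<in> qfield m" shows "x * y \<in> qfield m"
proof -
  obtain a b c d :: rat where *: "x = of_rat a + of_rat b * sqrt (of_int m)" "y = of_rat c + of_rat d * sqrt (of_int m)"
    using assms by (auto simp: qfield_def)
  define w :: real where "w = sqrt (of_int m)"
  have ww: "w * w = of_rat (of_int m)" using assms(1) by (simp add: w_def)
  have "x * y = of_rat (a * c + b * d * of_int m) + of_rat (a * d + b * c) * w"
    unfolding *(1,2) w_def[symmetric] of_rat_add of_rat_mult ww[symmetric]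
    by (simp add: algebra_simps)
  then show ?thesis by (auto simp: qfield_def w_def)
qed

lemma qfield_sqrt [simp, intro]: "sqrt (of_int m) \<in> qfield m"
  proof -
  have "sqrt (of_int m) = of_rat 0 + of_rat 1 * sqrt (of_int m)" by simp
  then show ?thesis unfolding qfield_def by blast
qed

lemma qfield_minus [intro]: "x \<in> qfield m \<Longrightarrow> - x \<in> qfield m"
proof -
  assume "x \<in> qfield m"
  then obtain a b :: rat where "x = of_rat a + of_rat b * sqrt (of_int m)"
    by (auto simp: qfield_def)
  then have "- x = of_rat (- a) + of_rat (- b) * sqrt (of_int m)"
    by (simp add: of_rat_minus)
  then show ?thesis by (auto simp: qfield_def)
qed

lemma qfield_inverse:
  assumes m: "m \<ge> 0" and x: "x \<in> qfield m" shows "inverse x \<in> qfield m"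
proof -
  obtain a b :: rat where *: "x = of_rat a + of_rat b * sqrt (of_int m)"
    using x by (auto simp: qfield_def)
  define w :: real where "w = sqrt (of_int m)"
  have ww: "w * w = of_rat (of_int m)" using m by (simp add: w_def)
  define N where "N = a^2 - of_int m * b^2"
  have xN: "x * (of_rat a - of_rat b * w) = of_rat N"
    unfolding * w_def[symmetric] N_def of_rat_diff of_rat_mult of_rat_power ww[symmetric]
    by (simp add: algebra_simps power2_eq_square)
  show ?thesis
  proof (cases "N = 0")
    case False
    then have "inverse x = of_rat (a / N) + of_rat (- b / N) * w"
    proof -
      have "x * (of_rat (a / N) + of_rat (- b / N) * w) = (x * (of_rat a - of_rat b * w)) / of_rat N"
        using False by (simp add: of_rat_divide of_rat_minus field_simps)
      also have "\<dots> = 1" using xN False by simp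
      finally show ?thesis by (metis inverse_unique)
    qed
    then show ?thesis by (auto simp: qfield_def w_def)
  next
    \<comment> \<open>The norm can vanish for a nonzero \<open>x\<close> when \<open>m\<close> is a
      perfect square; then the conjugate is 0 and \<open>x\<close> is rational.\<close>
    case True
    show ?thesis
    proof (cases "x = 0")
      case True
      then show ?thesis using qfield_of_int[of 0 m] by simp
    next
      case False
      then have "of_rat a - of_rat b * w = 0" using xN True by simp
      then have "x = of_rat (2 * a)" unfolding * w_def[symmetric] by (simp add: of_rat_mult)
      then have "inverse x = of_rat (inverse (2 * a)) + of_rat 0 * sqrt (of_int m)"
        unfolding of_rat_inverse by simp
      then show ?thesis unfolding qfield_def by blast
    qed
  qed
qed

lemma qfield_divide [intro]:
  "m \<ge> 0 \<Longrightarrow> x \<in> qfield m \<Longrightarrow> y \<in> qfield m \<Longrightarrow> x / y \<in> qfield m"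
  using qfield_mult qfield_inverse by (simp add: divide_inverse)

lemma qfield_power [intro]: "m \<ge> 0 \<Longrightarrow> x \<in> qfield m \<Longrightarrow> x ^ k \<in> qfield m"
  using qfield_of_int[of 1 m] by (induction k) auto

lemma local_ring_subset_qfield:
  assumes "m \<ge> 0" "x \<in> local_ring m P" shows "x \<in> qfield m"
  using assms by (auto simp: local_ring_def ring_of_integers_def)

text \<open>Reduces good reduction at \<open>P\<close> to exhibiting one \<open>P\<close>-integral
  equation with unit discriminant whose invariants are \<open>C4 / u ^ 4\<close> and
  \<open>C6 / u ^ 6\<close>.\<close>

lemma good_reduction_short:
  assumes m: "m \<ge> 0" and u: "u \<in> qfield m" "u \<noteq> 0"
    and E: "coeffs_in (local_ring m P) E" "local_unit m P (disc E)"
    and C4: "C4 = c4 E * u ^ 4" and C6: "C6 = c6 E * u ^ 6"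
  shows "good_reduction_at m P (short_weq C4 C6)"
proof (cases E)
  case (fields a1 a2 a3 a4 a6)
  have K: "a1 \<in> qfield m" "a2 \<in> qfield m" "a3 \<in> qfield m"
    using E(1) local_ring_subset_qfield[OF m] by (auto simp: fields)
  have "b2 E \<in> qfield m" using m K by (auto simp: fields)
  then have rst: "u^2 * b2 E / 12 \<in> qfield m" "u * a1 / 2 \<in> qfield m" "u^3 * a3 / 2 \<in> qfield m"
    using m K u by auto
  show ?thesis
    unfolding good_reduction_at_def
    by (rule exI[of _ u], rule exI[of _ "u^2 * b2 E / 12"], rule exI[of _ "u * a1 / 2"], rule exI[of _ "u^3 * a3 / 2"])
      (use wtrans_short[OF u(2) fields C4 C6] E u rst in simp)
qed

section \<open>Localisation of a quadratic order at a prime ideal\<close>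

locale integral_place =
  fixes m :: int and P :: "real set" and \<omega> :: real and r s :: int
  assumes m_pos: "m > 0"
    and prime_P: "nonzero_prime_ideal m P"
    and omega_sq: "\<omega>\<^sup>2 = of_int r * \<omega> + of_int s"
    and omega_qfield: "\<omega> \<in> qfield m"
begin

text \<open>The order \<open>\<int>[\<omega>]\<close> suffices in place of the full ring of integers: \<open>L\<close> is its localisation at
  \<open>P\<close>, contained in \<open>local_ring m P\<close>, and \<open>U\<close> is the unit group of \<open>L\<close>.\<close>

definition B :: "real set" where
  "B = {of_int a + of_int b * \<omega> | a b. True}"

definition L :: "real set" where
  "L = {a / b | a b. a \<in> B \<and> b \<in> B - P}"

definition U :: "real set" where
  "U = {a / b | a b. a \<in> B - P \<and> b \<in> B - P}"

lemma B_add: "x \<in> B \<Longrightarrow> y \<in> B \<Longrightarrow> x + y \<in> B"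
proof -
  assume "x \<in> B" "y \<in> B"
  then obtain a b c d :: int where "x = of_int a + of_int b * \<omega>" "y = of_int c + of_int d * \<omega>"
    by (auto simp: B_def)
  then have "x + y = of_int (a + c) + of_int (b + d) * \<omega>" by (simp add: algebra_simps)
  then show ?thesis unfolding B_def by blast
qed

lemma B_mult: "x \<in> B \<Longrightarrow> y \<in> B \<Longrightarrow> x * y \<in> B"
proof -
  assume "x \<in> B" "y \<in> B"
  then obtain a b c d :: int where *: "x = of_int a + of_int b * \<omega>" "y = of_int c + of_int d * \<omega>"
    by (auto simp: B_def)
  have "x * y = of_int a * of_int c + (of_int a * of_int d + of_int b * of_int c) * \<omega> + of_int b * of_int d * \<omega>\<^sup>2"
    unfolding * by (simp add: algebra_simps power2_eq_square)
  also have "\<dots> = of_int (a * c + b * d * s) + of_int (a * d + b * c + b * d * r) * \<omega>"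
    unfolding omega_sq by (simp add: algebra_simps)
  finally show ?thesis unfolding B_def by blast
qed

lemma B_of_int: "of_int a \<in> B"
proof -
  have "of_int a = of_int a + of_int 0 * \<omega>" by simp
  then show ?thesis unfolding B_def by blast
qed

lemma B_omega: "\<omega> \<in> B"
proof -
  have "\<omega> = of_int 0 + of_int 1 * \<omega>" by simp
  then show ?thesis unfolding B_def by blast
qed

lemma B_numeral: "numeral k \<in> B" and B_one: "1 \<in> B" and B_zero: "0 \<in> B"
  using B_of_int[of "numeral k"] B_of_int[of 1] B_of_int[of 0] by simp_all

lemma B_minus: "x \<in> B \<Longrightarrow> - x \<in> B"
  using B_mult[of "of_int (-1)" x] B_of_int[of "-1"] by simp

lemma B_diff: "x \<in> B \<Longrightarrow> y \<in> B \<Longrightarrow> x - y \<in> B"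
  using B_add[of x "- y"] B_minus by simp

lemma B_power: "x \<in> B \<Longrightarrow> x ^ k \<in> B"
  by (induction k) (auto intro: B_mult B_one)

lemmas B_intros = B_add B_mult B_of_int B_omega B_numeral B_one B_zero B_minus B_diff B_power

lemma B_subset_ring_of_integers: "B \<subseteq> ring_of_integers m"
proof
  fix x assume "x \<in> B"
  then obtain a b :: int where x: "x = of_int a + of_int b * \<omega>" by (auto simp: B_def)
  define p :: "real poly" where
    "p = [:of_int (a\<^sup>2 + a * b * r - b\<^sup>2 * s), of_int (- (2 * a + b * r)), 1:]"
  have "algebraic_int x"
  proof (rule algebraic_int.intros)
    show "lead_coeff p = 1" by (simp add: p_def)
    show "\<forall>i. Polynomial.coeff p i \<in> \<int>"
      by (auto simp: p_def coeff_pCons split: nat.split)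
    have "poly p x = of_int b ^ 2 * (\<omega>\<^sup>2 - of_int r * \<omega> - of_int s)"
      by (simp add: p_def x algebra_simps power2_eq_square)
    then show "poly p x = 0" by (simp add: omega_sq)
  qed
  moreover have "x \<in> qfield m" unfolding x using omega_qfield m_pos by (intro qfield_add qfield_mult) auto
  ultimately show "x \<in> ring_of_integers m" by (simp add: ring_of_integers_def)
qed

lemma P_add: "x \<in> P \<Longrightarrow> y \<in> P \<Longrightarrow> x + y \<in> P"
  and P_mult: "x \<in> P \<Longrightarrow> a \<in> B \<Longrightarrow> a * x \<in> P"
  and P_prime: "a \<in> B \<Longrightarrow> b \<in> B \<Longrightarrow> a * b \<in> P \<Longrightarrow> a \<in> P \<or> b \<in> P"
  and P_zero: "0 \<in> P"
  using prime_P B_subset_ring_of_integers unfolding nonzero_prime_ideal_def by blast+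

lemma one_notin_P: "1 \<notin> P"
proof
  assume 1: "1 \<in> P"
  have "x \<in> P" if "x \<in> ring_of_integers m" for x
    using prime_P 1 that unfolding nonzero_prime_ideal_def by (metis mult.right_neutral)
  then show False using prime_P unfolding nonzero_prime_ideal_def by blast
qed

lemma coprime_notin_P:
  assumes "coprime a b" "of_int a \<in> P" shows "of_int b \<notin> P"
proof
  assume b: "of_int b \<in> P"
  obtain u v where "u * a + v * b = 1"
    using assms(1) by (metis bezout_int coprime_iff_gcd_eq_1)
  then have "1 = of_int u * of_int a + of_int v * (of_int b :: real)"
    by (metis of_int_1 of_int_add of_int_mult)
  moreover have "\<dots> \<in> P" using assms b by (intro P_add P_mult B_of_int)
  ultimately show False using one_notin_P by simp
qed

lemma L_I: "x \<in> B \<Longrightarrow> x \<in> L"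
  unfolding L_def using one_notin_P B_one by (metis (mono_tags, lifting) DiffI div_by_1 mem_Collect_eq)

lemma U_I: "x \<in> B \<Longrightarrow> x \<notin> P \<Longrightarrow> x \<in> U"
  unfolding U_def using one_notin_P B_one by (metis (mono_tags, lifting) DiffI div_by_1 mem_Collect_eq)

lemma U_subset_L: "x \<in> U \<Longrightarrow> x \<in> L"
  unfolding U_def L_def by blast

lemma U_nonzero: "x \<in> U \<Longrightarrow> x \<noteq> 0"
  unfolding U_def using P_zero by auto

lemma notin_P_mult: "a \<in> B - P \<Longrightarrow> b \<in> B - P \<Longrightarrow> a * b \<in> B - P"
  using P_prime B_mult by blast

lemma L_add: "x \<in> L \<Longrightarrow> y \<in> L \<Longrightarrow> x + y \<in> L"
proof -
  assume "x \<in> L" "y \<in> L"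
  then obtain a b c d where *: "x = a / b" "y = c / d" "a \<in> B" "c \<in> B" "b \<in> B - P" "d \<in> B - P"
    by (auto simp: L_def)
  then have "b \<noteq> 0" "d \<noteq> 0" using P_zero by auto
  then have "x + y = (a * d + c * b) / (b * d)" by (simp add: * field_simps)
  moreover have "a * d + c * b \<in> B" using * by (auto intro!: B_intros)
  moreover have "b * d \<in> B - P" using * notin_P_mult by blast
  ultimately show ?thesis unfolding L_def by blast
qed

lemma L_mult: "x \<in> L \<Longrightarrow> y \<in> L \<Longrightarrow> x * y \<in> L"
proof -
  assume "x \<in> L" "y \<in> L"
  then obtain a b c d where *: "x = a / b" "y = c / d" "a \<in> B" "c \<in> B" "b \<in> B - P" "d \<in> B - P"
    by (auto simp: L_def)
  then have "x * y = (a * c) / (b * d)" by simp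
  moreover have "b * d \<in> B - P" using * notin_P_mult by blast
  ultimately show ?thesis using * B_mult unfolding L_def by blast
qed

lemma U_mult: "x \<in> U \<Longrightarrow> y \<in> U \<Longrightarrow> x * y \<in> U"
proof -
  assume "x \<in> U" "y \<in> U"
  then obtain a b c d where *: "x = a / b" "y = c / d" "a \<in> B - P" "c \<in> B - P" "b \<in> B - P" "d \<in> B - P"
    by (auto simp: U_def)
  then have "x * y = (a * c) / (b * d)" by simp
  moreover have "a * c \<in> B - P" "b * d \<in> B - P" using * notin_P_mult by blast+
  ultimately show ?thesis unfolding U_def by blast
qed

lemma U_inverse: "x \<in> U \<Longrightarrow> inverse x \<in> U"
proof -
  assume "x \<in> U"
  then obtain a b where "x = a / b" "a \<in> B - P" "b \<in> B - P" by (auto simp: U_def)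
  moreover from this have "inverse x = b / a" by simp
  ultimately show ?thesis unfolding U_def by blast
qed

lemma U_one: "1 \<in> U" using U_I B_one one_notin_P by blast

lemma U_power: "x \<in> U \<Longrightarrow> x ^ k \<in> U"
  by (induction k) (auto intro: U_mult U_one)

lemma U_divide: "x \<in> U \<Longrightarrow> y \<in> U \<Longrightarrow> x / y \<in> U"
  using U_mult U_inverse by (simp add: divide_inverse)

lemma U_minus: "x \<in> U \<Longrightarrow> - x \<in> U"
proof -
  have "- 1 \<in> U"
  proof (rule U_I)
    show "- 1 \<in> B" using B_of_int[of "-1"] by simp
    show "- 1 \<notin> P" using P_mult[of "- 1" "- 1"] \<open>- 1 \<in> B\<close> one_notin_P by auto
  qed
  then show "x \<in> U \<Longrightarrow> - x \<in> U" using U_mult[of "- 1" x] by simp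
qed

lemma L_minus: "x \<in> L \<Longrightarrow> - x \<in> L"
  using L_mult[of "- 1" x] L_I[of "- 1"] B_of_int[of "-1"] by simp

lemma L_diff: "x \<in> L \<Longrightarrow> y \<in> L \<Longrightarrow> x - y \<in> L"
  using L_add[of x "- y"] L_minus by simp

lemma L_power: "x \<in> L \<Longrightarrow> x ^ k \<in> L"
  by (induction k) (auto intro: L_mult L_I B_one)

lemma L_divide: "x \<in> L \<Longrightarrow> y \<in> U \<Longrightarrow> x / y \<in> L"
  using L_mult U_inverse U_subset_L by (simp add: divide_inverse)

lemma L_of_int: "of_int a \<in> L" and L_numeral: "numeral k \<in> L" and L_one: "1 \<in> L" and L_zero: "0 \<in> L"
  and L_omega: "\<omega> \<in> L"
  using B_intros by (auto intro: L_I)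

lemmas L_intros = L_add L_mult L_minus L_diff L_power L_divide L_of_int L_numeral L_one L_zero L_omega

lemmas U_intros = U_mult U_minus U_power U_divide U_one

text \<open>If the product of two local integers is a unit, neither numerator can lie in
  \<open>P\<close>. Used on a product of conjugates, where only the norm is known.\<close>

lemma U_cancel:
  assumes "x * y \<in> U" "x \<in> L" "y \<in> L" shows "x \<in> U"
proof -
  obtain a b c d where *: "x = a / b" "y = c / d" "a \<in> B" "c \<in> B" "b \<in> B - P" "d \<in> B - P"
    using assms by (auto simp: L_def)
  obtain e f where ef: "x * y = e / f" "e \<in> B - P" "f \<in> B - P" using assms by (auto simp: U_def)
  have nz: "b \<noteq> 0" "d \<noteq> 0" "f \<noteq> 0" using * ef P_zero by auto
  have "a * (c * f) = (b * d) * e" using ef(1) nz by (simp add: * field_simps)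
  moreover have "(b * d) * e \<notin> P" using notin_P_mult * ef by blast
  ultimately have "(c * f) * a \<notin> P" by (simp add: mult.commute)
  then have "a \<notin> P" using P_mult[of a "c * f"] B_mult * ef by blast
  then show ?thesis using * unfolding U_def by blast
qed

lemma L_subset_local_ring: "x \<in> L \<Longrightarrow> x \<in> local_ring m P"
  unfolding L_def local_ring_def using B_subset_ring_of_integers by blast

lemma U_local_unit: "x \<in> U \<Longrightarrow> local_unit m P x"
  unfolding local_unit_def using U_nonzero U_inverse U_subset_L L_subset_local_ring by blast

text \<open>The relation 1728 \<Delta> = c4^3 - c6^2 holds in the reals and determines \<Delta>, so
  an integral equation with the right invariants needs no separate computation of its discriminant,
  even above 2 and 3.\<close>

lemma good_reduction_model:
  assumes u: "u \<in> qfield m" "u \<noteq> 0"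
    and E: "E = (a1, a2, a3, a4, a6)" "a1 \<in> L" "a2 \<in> L" "a3 \<in> L" "a4 \<in> L" "a6 \<in> L"
    and c: "c4 E = c4'" "c6 E = c6'" and D: "1728 * \<Delta> = c4' ^ 3 - c6' ^ 2" "\<Delta> \<in> U"
    and C: "C4 = c4' * u ^ 4" "C6 = c6' * u ^ 6"
  shows "good_reduction_at m P (short_weq C4 C6)"
proof (rule good_reduction_short[of m u _ E])
  have "disc E = \<Delta>" using disc_eq_c4_c6[of E] c D by simp
  then show "local_unit m P (disc E)" using D U_local_unit by simp
  show "coeffs_in (local_ring m P) E" using E L_subset_local_ring by simp
qed (use m_pos u c C in auto)

text \<open>The model is the family y^2 + x y = x^3 - 36/(j - 1728) x - 1/(j - 1728), twisted so
  that \<open>b2\<close> becomes \<open>- c6' / c4'\<close>. With \<open>c4'\<close> a unit,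
  integrality only asks that this quotient be a square modulo 4, which matters above 2
  alone.\<close>

lemma good_reduction_ordinary:
  assumes u: "u \<in> qfield m" "u \<noteq> 0"
    and a: "a1 \<in> L" "a2 \<in> L" "- c6' / c4' = a1\<^sup>2 + 4 * a2"
    and "c4' \<in> U" "c6' \<in> L"
    and D: "1728 * \<Delta> = c4' ^ 3 - c6' ^ 2" "\<Delta> \<in> U"
    and C: "C4 = c4' * u ^ 4" "C6 = c6' * u ^ 6"
  shows "good_reduction_at m P (short_weq C4 C6)"
proof -
  define \<beta> where "\<beta> = - c6' / c4'"
  define E where "E = (a1, a2, 0::real, - 36 * \<Delta> / c4'^2, - \<beta> * \<Delta> / c4'^2)"
  have nz: "c4' \<noteq> 0" using assms U_nonzero by auto
  have c6': "c6' = - \<beta> * c4'" using nz by (simp add: \<beta>_def)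
  have D': "1728 * \<Delta> = c4' ^ 2 * (c4' - \<beta>\<^sup>2)" unfolding D c6' by (simp add: algebra_simps eval_nat_numeral)
  then have D'': "1728 * \<Delta> / c4' ^ 2 = c4' - \<beta>\<^sup>2" using nz by simp
  have b2: "b2 E = \<beta>" using a(3) by (simp add: E_def \<beta>_def)
  have b4: "b4 E = - 72 * \<Delta> / c4'^2" and b6: "b6 E = - 4 * \<beta> * \<Delta> / c4'^2" by (simp_all add: E_def)
  show ?thesis
  proof (rule good_reduction_model[OF u E_def a(1,2) L_zero _ _ _ _ D C])
    have "\<beta> \<in> L" unfolding \<beta>_def using assms by (intro L_divide L_minus)
    then show "- 36 * \<Delta> / c4'^2 \<in> L" "- \<beta> * \<Delta> / c4'^2 \<in> L"
      using assms U_subset_L by (auto intro!: L_intros U_power)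
    show "c4 E = c4'" using D'' by (simp add: c4_def b2 b4)
    have "c6 E = - (\<beta> ^ 3) - (3/2) * (1728 * \<Delta> / c4' ^ 2) * \<beta> + (1728 * \<Delta> / c4' ^ 2) * \<beta> / 2"
      by (simp add: c6_def b2 b4 b6 field_simps)
    then show "c6 E = c6'" unfolding D'' c6' by (simp add: field_simps eval_nat_numeral)
  qed
qed

text \<open>The model is y^2 + y = x^3 + a4 x + a6, the supersingular form in characteristic
  2.\<close>

lemma good_reduction_supersingular_2:
  assumes u: "u \<in> qfield m" "u \<noteq> 0"
    and a: "a4 \<in> L" "a6 \<in> L" "c4' = - 48 * a4" "c6' = - 216 * (1 + 4 * a6)"
    and D: "1728 * \<Delta> = c4' ^ 3 - c6' ^ 2" "\<Delta> \<in> U"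
    and C: "C4 = c4' * u ^ 4" "C6 = c6' * u ^ 6"
  shows "good_reduction_at m P (short_weq C4 C6)"
  using a by (intro good_reduction_model[OF u refl L_zero L_zero L_one _ _ _ _ D C, of a4 a6])
    (simp_all add: c4_def c6_def)

lemma good_reduction_short_model:
  assumes u: "u \<in> qfield m" "u \<noteq> 0"
    and two: "2 \<in> U" and "c4' / 3 \<in> L" "c6' / 27 \<in> L"
    and D: "1728 * \<Delta> = c4' ^ 3 - c6' ^ 2" "\<Delta> \<in> U"
    and C: "C4 = c4' * u ^ 4" "C6 = c6' * u ^ 6"
  shows "good_reduction_at m P (short_weq C4 C6)"
proof (rule good_reduction_model[OF u short_weq_def _ _ _ _ _ c4_short c6_short D C])
  have "16 \<in> U" using U_power[OF two, of 4] by simp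
  then have "- (c4' / 3) / 16 \<in> L" using assms by (intro L_divide[OF L_minus])
  then show "- c4' / 48 \<in> L" by simp
  have "32 \<in> U" using U_power[OF two, of 5] by simp
  then have "- (c6' / 27) / 32 \<in> L" using assms by (intro L_divide[OF L_minus])
  then show "- c6' / 864 \<in> L" by simp
qed (rule L_zero)+

text \<open>If 3 divides \<open>A\<close>, divisibility of \<open>t\<close> by 27 makes the short
  equation integral away from 2. If not, \<open>c4\<close> is a unit above 3, and at the remaining
  places 6 is a unit.\<close>

lemma good_reduction_away_from_2:
  assumes u: "u \<in> qfield m" "u \<noteq> 0"
    and two: "2 \<notin> P" and U: "\<rho> \<in> U" and L: "\<sigma> \<in> L"
    and D: "1728 * \<Delta> = (of_int A * \<rho>) ^ 3 - (of_int t * \<sigma>) ^ 2" "\<Delta> \<in> U"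
    and C: "C4 = of_int A * \<rho> * u ^ 4" "C6 = of_int t * \<sigma> * u ^ 6"
    and At: "3 dvd A \<Longrightarrow> 27 dvd t"
  shows "good_reduction_at m P (short_weq C4 C6)"
proof -
  have two': "2 \<in> U" using two by (intro U_I B_intros)
  have A: "of_int A * \<rho> \<in> L" and t: "of_int t * \<sigma> \<in> L"
    using U L U_subset_L by (auto intro!: L_intros)
  show ?thesis
  proof (cases "3 dvd A")
    case True
    then obtain a b where ab: "A = 3 * a" "t = 27 * b" using At by (auto elim!: dvdE)
    have "of_int A * \<rho> / 3 = of_int a * \<rho>" "of_int t * \<sigma> / 27 = of_int b * \<sigma>" by (simp_all add: ab)
    moreover have "of_int a * \<rho> \<in> L" "of_int b * \<sigma> \<in> L" using U L U_subset_L by (auto intro!: L_intros)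
    ultimately show ?thesis
      by (intro good_reduction_short_model[OF u two' _ _ D C]) auto
  next
    case False
    show ?thesis
    proof (cases "3 \<in> P")
      case True
      have "coprime 3 A" using False by (simp add: prime_imp_coprime)
      then have "of_int A \<notin> P" using True coprime_notin_P[of 3 A] by simp
      then have "of_int A * \<rho> \<in> U" using U by (intro U_mult U_I[of "of_int A"] B_of_int)
      moreover from this have "- (of_int t * \<sigma>) / (of_int A * \<rho>) / 4 \<in> L"
        using t U_power[OF two', of 2] by (intro L_divide L_minus) auto
      ultimately show ?thesis
        by (intro good_reduction_ordinary[OF u L_zero _ _ _ t D C]) auto
    next
      case False
      then have 3: "3 \<in> U" by (intro U_I B_intros)
      then have "27 \<in> U" using U_power[of 3 3] by simp
      then show ?thesis using A t 3
        by (intro good_reduction_short_model[OF u two' _ _ D C] L_divide) auto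
    qed
  qed
qed

end

section \<open>The twist attached to a point of the conic\<close>

locale conic_place = integral_place +
  fixes D q \<epsilon> x y z A t :: int
  assumes m_eq: "m = D * q"
    and sqrt_B: "sqrt (of_int m) \<in> B"
    and conic: "D * x\<^sup>2 - q * y\<^sup>2 = \<epsilon> * z\<^sup>2"
    and eps: "\<epsilon> = 1 \<or> \<epsilon> = -1"
    and xz: "coprime x z" and Dz: "coprime D z" and odd_z: "odd z"
    and At: "D * t\<^sup>2 = A ^ 3 - 1728"
begin

abbreviation "\<delta> \<equiv> sqrt (of_int m)"

definition w :: real where "w = of_int D * of_int x + of_int y * \<delta>"
definition w' :: real where "w' = of_int D * of_int x - of_int y * \<delta>"
text \<open>Equal to \<open>w\<^sup>2 / D\<close>, written out so that its integrality is visible.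
  Its norm is \<open>z ^ 4\<close>, so it is a unit wherever \<open>z\<close> is, including primes
  that divide \<open>D\<close>.\<close>

definition \<theta> :: real where
  "\<theta> = of_int D * of_int x ^ 2 + of_int q * of_int y ^ 2 + 2 * of_int x * of_int y * \<delta>"
definition \<theta>' :: real where
  "\<theta>' = of_int D * of_int x ^ 2 + of_int q * of_int y ^ 2 - 2 * of_int x * of_int y * \<delta>"

lemma delta_sq: "\<delta> * \<delta> = of_int D * of_int q"
  using m_pos m_eq by (metis abs_of_nonneg of_int_0_le_iff of_int_mult order_less_imp_le real_sqrt_mult_self)

lemma D_nonzero: "D \<noteq> 0" using m_pos m_eq by auto

lemma conic_real: "of_int D * of_int x ^ 2 - of_int q * of_int y ^ 2 = (of_int \<epsilon> * of_int z ^ 2 :: real)"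
  using conic by (metis of_int_diff of_int_mult of_int_power)

lemma At_real: "of_int D * of_int t ^ 2 = (of_int A ^ 3 - 1728 :: real)"
  using arg_cong[OF At, of "of_int :: int \<Rightarrow> real"] by simp

lemma eps_sq: "of_int \<epsilon> ^ 2 = (1 :: real)" using eps by auto

lemma w_sq: "w ^ 2 = of_int D * \<theta>"
proof -
  have "w ^ 2 = of_int D ^ 2 * of_int x ^ 2 + 2 * of_int D * of_int x * of_int y * \<delta> + of_int y ^ 2 * (\<delta> * \<delta>)"
    by (simp add: w_def power2_eq_square algebra_simps)
  also have "\<dots> = of_int D * \<theta>" unfolding delta_sq \<theta>_def by (simp add: power2_eq_square algebra_simps)
  finally show ?thesis .
qed

lemma w_w': "w * w' = of_int \<epsilon> * of_int D * of_int z ^ 2"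
proof -
  have "w * w' = of_int D * of_int D * of_int x ^ 2 - of_int y ^ 2 * (\<delta> * \<delta>)"
    by (simp add: w_def w'_def power2_eq_square algebra_simps)
  also have "\<dots> = of_int D * (of_int D * of_int x ^ 2 - of_int q * of_int y ^ 2)"
    unfolding delta_sq by (simp add: algebra_simps)
  finally show ?thesis unfolding conic_real by simp
qed

lemma theta_theta': "\<theta> * \<theta>' = of_int z ^ 4"
proof -
  let ?u = "of_int D * of_int x ^ 2 :: real" and ?v = "of_int q * of_int y ^ 2 :: real"
  have "\<theta> * \<theta>' = (?u + ?v) ^ 2 - 4 * of_int x ^ 2 * of_int y ^ 2 * (\<delta> * \<delta>)"
    by (simp add: \<theta>_def \<theta>'_def power2_eq_square algebra_simps)
  also have "\<dots> = (?u - ?v) ^ 2" unfolding delta_sq by (simp add: power2_eq_square algebra_simps)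
  also have "\<dots> = of_int \<epsilon> ^ 2 * of_int z ^ 4" unfolding conic_real by (simp add: power_mult_distrib)
  finally show ?thesis using eps_sq by simp
qed

lemma w_B: "w \<in> B" and w'_B: "w' \<in> B" and theta_B: "\<theta> \<in> B" and theta'_B: "\<theta>' \<in> B"
  unfolding w_def w'_def \<theta>_def \<theta>'_def using sqrt_B by (auto intro!: B_intros)

lemma z_nonzero: "z \<noteq> 0" using odd_z by auto

lemma w_nonzero: "w \<noteq> 0" using w_w' eps D_nonzero z_nonzero by auto

lemma theta_nonzero: "\<theta> \<noteq> 0" using theta_theta' z_nonzero by auto

lemma w_qfield: "w \<in> qfield m"
  using w_B B_subset_ring_of_integers by (auto simp: ring_of_integers_def)

lemma theta_U:
  assumes "of_int z \<notin> P" shows "\<theta> \<in> U"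
proof (rule U_I[OF theta_B])
  have "of_int z ^ k \<notin> P" for k
    using assms one_notin_P P_prime[of "of_int z"] by (induction k) (auto intro: B_intros)
  then show "\<theta> \<notin> P" using P_mult[OF _ theta'_B, of \<theta>] theta_theta' by (metis mult.commute)
qed

lemma disc_eq: "(1728 * of_int D ^ 3 :: real) = (of_int A * of_int D) ^ 3 - (of_int D ^ 2 * of_int t) ^ 2"
  (is "_ = ?r")
proof -
  have "?r = of_int D ^ 3 * (of_int A ^ 3 - of_int D * of_int t ^ 2)"
    by (simp add: algebra_simps eval_nat_numeral)
  then show ?thesis unfolding At_real by simp
qed

text \<open>Dividing the invariants by powers of \<open>w\<close> trades the factor
  \<open>D\<close>, which is not a unit at the ramified primes, for \<theta>, because
  \<open>w\<^sup>2 = D * \<theta>\<close>. The scaled discriminant is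
  \<open>1 / \<theta> ^ 3\<close>.\<close>

lemma scaled_by_w:
  "1728 * (1 / \<theta>) ^ 3 = (of_int A * (1 / \<theta>)) ^ 3 - (of_int t * (w / \<theta> ^ 2)) ^ 2"
  "of_int A * of_int D * w ^ 2 = of_int A * (1 / \<theta>) * w ^ 4"
  "of_int D ^ 2 * of_int t * w ^ 3 = of_int t * (w / \<theta> ^ 2) * w ^ 6"
proof -
  have w4: "w ^ 4 = w ^ 2 * (of_int D * \<theta>)" and w6: "w ^ 6 = w ^ 2 * (of_int D * \<theta>) ^ 2"
    unfolding w_sq[symmetric] by (simp_all flip: power_add power_mult)
  show "of_int A * of_int D * w ^ 2 = of_int A * (1 / \<theta>) * w ^ 4"
    using theta_nonzero unfolding w4 by simp
  show "of_int D ^ 2 * of_int t * w ^ 3 = of_int t * (w / \<theta> ^ 2) * w ^ 6"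
    using theta_nonzero unfolding w6 by (simp add: power2_eq_square power3_eq_cube)
  have "(of_int A * (1 / \<theta>)) ^ 3 - (of_int t * (w / \<theta> ^ 2)) ^ 2 =
      of_int A ^ 3 / \<theta> ^ 3 - of_int t ^ 2 * w ^ 2 / \<theta> ^ 4"
    by (simp add: power_mult_distrib power_divide)
  also have "\<dots> = (of_int A ^ 3 - of_int D * of_int t ^ 2) / \<theta> ^ 3"
    unfolding w_sq using theta_nonzero by (simp add: field_simps eval_nat_numeral)
  finally show "1728 * (1 / \<theta>) ^ 3 = (of_int A * (1 / \<theta>)) ^ 3 - (of_int t * (w / \<theta> ^ 2)) ^ 2"
    unfolding At_real by (simp add: power_divide)
qed

lemma good_reduction_odd_place:
  assumes two: "2 \<notin> P" and t27: "3 dvd A \<Longrightarrow> 27 dvd t"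
  shows "good_reduction_at m P (short_weq (of_int A * of_int D * w ^ 2) (of_int D ^ 2 * of_int t * w ^ 3))"
proof (cases "of_int z \<in> P")
  case False
  note th = theta_U[OF False]
  have "1 / \<theta> \<in> U" "w / \<theta> ^ 2 \<in> L" "(1 / \<theta>) ^ 3 \<in> U"
    using th L_divide[OF L_I[OF w_B] U_power[OF th]] by (auto intro!: U_intros)
  then show ?thesis
    using good_reduction_away_from_2[OF w_qfield w_nonzero two _ _ scaled_by_w(1) _ scaled_by_w(2,3) t27] by blast
next
  case True
  have D: "of_int D \<notin> P" using coprime_notin_P[of z D] Dz True by (simp add: coprime_commute)
  have eps_P: "of_int \<epsilon> \<notin> P"
    using coprime_notin_P[of z \<epsilon>] eps True by auto
  have D_U: "of_int D \<in> U" and eps_U: "of_int \<epsilon> \<in> U" using D eps_P by (auto intro!: U_I B_intros)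
  \<comment> \<open>Where \<open>z\<close> is not a unit, \<open>D\<close> is one, so it suffices
    that \<open>w\<close> is a unit times a square.\<close>
  have general: ?thesis if v: "v \<in> U" and u: "u \<in> qfield m" "u \<noteq> 0" and wv: "w = v * u ^ 2" for v u
  proof (rule good_reduction_away_from_2[OF u two _ _ _ _ _ _ t27])
    show "of_int D * v ^ 2 \<in> U" using D_U v by (intro U_intros)
    show "of_int D ^ 2 * v ^ 3 \<in> L" using D_U v by (intro U_subset_L U_intros)
    show "of_int D ^ 3 * v ^ 6 \<in> U" using D_U v by (intro U_intros)
    have "1728 * (of_int D ^ 3 * v ^ 6) = ((of_int A * of_int D) ^ 3 - (of_int D ^ 2 * of_int t) ^ 2) * v ^ 6"
      unfolding disc_eq[symmetric] by simp
    then show "1728 * (of_int D ^ 3 * v ^ 6) = (of_int A * (of_int D * v ^ 2)) ^ 3 - (of_int t * (of_int D ^ 2 * v ^ 3)) ^ 2"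
      by (simp add: power_mult_distrib algebra_simps flip: power_mult)
  qed (simp_all add: wv power_mult_distrib flip: power_mult)
  show ?thesis
  proof (cases "w \<in> P")
    case False
    then show ?thesis using general[of w 1] w_B U_I qfield_of_int[of 1 m] by simp
  next
    case w: True
    \<comment> \<open>Otherwise the trace \<open>2 * D * x\<close> of \<open>w\<close> would lie in
      \<open>P\<close> together with \<open>z\<close>, to which it is coprime. So the square
      \<open>z\<^sup>2\<close> in the norm of \<open>w\<close> is carried by \<open>w\<close>
      alone.\<close>
    have "w' \<notin> P"
    proof
      assume "w' \<in> P"
      then have "w + w' \<in> P" using w P_add by blast
      then have *: "of_int (2 * D * x) \<in> P" by (simp add: w_def w'_def mult.assoc)
      have "coprime (2 * D * x) z" using xz Dz odd_z by simp
      then show False using coprime_notin_P[OF _ *] True by blast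
    qed
    then have w'_U: "w' \<in> U" using w'_B U_I by blast
    show ?thesis
    proof (rule general)
      show "of_int \<epsilon> * of_int D / w' \<in> U" using eps_U D_U w'_U by (intro U_intros)
      show "of_int z \<in> qfield m" "of_int z \<noteq> (0 :: real)" using z_nonzero by auto
      show "w = of_int \<epsilon> * of_int D / w' * of_int z ^ 2"
        using w_w' U_nonzero[OF w'_U] by (simp add: field_simps)
    qed
  qed
qed

lemma odd_notin_P: "2 \<in> P \<Longrightarrow> odd k \<Longrightarrow> of_int k \<notin> P"
  using coprime_notin_P[of 2 k] by simp

lemma odd_U: "2 \<in> P \<Longrightarrow> odd k \<Longrightarrow> of_int k \<in> U"
  using odd_notin_P by (intro U_I B_of_int)

end

section \<open>Places above 2\<close>

context conic_place
begin

lemma disc_unscaled: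
  "1728 * (of_int D ^ 3 * w ^ 6) = (of_int A * of_int D * w ^ 2) ^ 3 - (of_int D ^ 2 * of_int t * w ^ 3) ^ 2"
proof -
  have "1728 * (of_int D ^ 3 * w ^ 6) = ((of_int A * of_int D) ^ 3 - (of_int D ^ 2 * of_int t) ^ 2) * w ^ 6"
    unfolding disc_eq[symmetric] by simp
  then show ?thesis by (simp add: power_mult_distrib algebra_simps flip: power_mult)
qed

lemma w_U_2: "2 \<in> P \<Longrightarrow> odd D \<Longrightarrow> w \<in> U"
proof -
  assume "2 \<in> P" "odd D"
  then have "w * w' \<in> U"
    unfolding w_w' using odd_z eps by (intro U_intros odd_U) auto
  then show ?thesis using U_cancel L_I w_B w'_B by blast
qed

text \<open>With \<open>A\<close> and \<open>D\<close> odd, \<open>c4\<close> is a unit, and the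
  ordinary model with \<open>a1 = 1\<close> needs - D t w / A to be 1 modulo 4. As \<open>w\<close>
  is congruent to the rational integer \<open>k\<close>, this becomes a congruence between integers,
  to be met by the sign of \<open>t\<close>.\<close>

lemma good_reduction_at_2_odd_odd:
  assumes two: "2 \<in> P" and D: "odd D" and A: "odd A"
    and w: "w = of_int k + 4 * g" "g \<in> L" and sgn_t: "4 dvd A + D * t * k"
  shows "good_reduction_at m P (short_weq (of_int A * of_int D * w ^ 2) (of_int D ^ 2 * of_int t * w ^ 3))"
proof -
  note U = odd_U[OF two D] odd_U[OF two A] w_U_2[OF two D]
  obtain h where "A + D * t * k = 4 * h" using sgn_t by blast
  then have h: "- of_int D * of_int t * of_int k = of_int A - 4 * (of_int h :: real)"
    by (metis (no_types) add_diff_cancel_left' diff_diff_eq2 minus_mult_left of_int_add of_int_mult of_int_numeral uminus_add_conv_diff diff_add_cancel)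
  define a2 where "a2 = (- of_int h - of_int D * of_int t * g) / of_int A"
  show ?thesis
  proof (rule good_reduction_ordinary[OF _ _ L_one _ _ _ _ disc_unscaled])
    show "a2 \<in> L" unfolding a2_def using U w by (intro L_intros) auto
    have nz: "of_int D \<noteq> (0 :: real)" "of_int A \<noteq> (0 :: real)" "w \<noteq> 0"
      using U[THEN U_nonzero] by auto
    then have "- (of_int D ^ 2 * of_int t * w ^ 3) / (of_int A * of_int D * w ^ 2) = - of_int D * of_int t * w / of_int A"
      by (simp add: field_simps eval_nat_numeral)
    also have "- of_int D * of_int t * w = of_int A * (1 + 4 * a2)"
    proof -
      have "of_int A * a2 = - of_int h - of_int D * of_int t * g" using nz by (simp add: a2_def)
      then show ?thesis using h unfolding w(1) by (simp add: algebra_simps)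
    qed
    finally show "- (of_int D ^ 2 * of_int t * w ^ 3) / (of_int A * of_int D * w ^ 2) = 1\<^sup>2 + 4 * a2"
      using nz by simp
    show "of_int A * of_int D * w ^ 2 \<in> U" "of_int D ^ 3 * w ^ 6 \<in> U"
      using U by (intro U_intros; simp)+
    show "of_int D ^ 2 * of_int t * w ^ 3 \<in> L" using w_B by (intro L_intros L_I)
    show "1 \<in> qfield m" using qfield_of_int[of 1 m] by simp
  qed auto
qed

text \<open>Now 16 divides \<open>c4\<close> and 8 divides \<open>c6\<close>, the shape of y^2 + y =
  x^3 + a4 x + a6; 3 is a unit, and what remains is that \<open>- (D\<^sup>2 * t' * w ^ 3)\<close>
  be 27 modulo 4.\<close>

lemma good_reduction_at_2_odd_even:
  assumes two: "2 \<in> P" and D: "odd D" and A: "A = 16 * a" and t: "t = 8 * t'"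
    and w: "w = of_int k + 4 * g" "g \<in> L" and sgn_t: "4 dvd 27 + D\<^sup>2 * t' * k ^ 3"
  shows "good_reduction_at m P (short_weq (of_int A * of_int D * w ^ 2) (of_int D ^ 2 * of_int t * w ^ 3))"
proof -
  note U = odd_U[OF two D] w_U_2[OF two D]
  have "of_int 3 \<in> U" using two by (intro odd_U) auto
  then have three: "3 \<in> U" by simp
  then have t27: "27 \<in> U" using U_power[of 3 3] by simp
  obtain h where "27 + D\<^sup>2 * t' * k ^ 3 = 4 * h" using sgn_t by blast
  then have h: "27 + of_int D ^ 2 * of_int t' * of_int k ^ 3 = 4 * (of_int h :: real)"
    by (metis of_int_add of_int_mult of_int_numeral of_int_power)
  define g' where "g' = 3 * of_int k ^ 2 * g + 12 * of_int k * g ^ 2 + 16 * g ^ 3"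
  have w3: "w ^ 3 = of_int k ^ 3 + 4 * g'"
    unfolding w g'_def by (simp add: eval_nat_numeral algebra_simps)
  define a4 where "a4 = - of_int a * of_int D * w ^ 2 / 3"
  define a6 where "a6 = (- of_int h - of_int D ^ 2 * of_int t' * g') / 27"
  show ?thesis
  proof (rule good_reduction_supersingular_2[OF _ _ _ _ _ _ disc_unscaled])
    show "a4 \<in> L" unfolding a4_def using w_B three by (intro L_divide L_intros L_I)
    have "g' \<in> L" unfolding g'_def using w by (intro L_intros)
    then show "a6 \<in> L" unfolding a6_def using t27 by (intro L_intros)
    show "of_int A * of_int D * w ^ 2 = - 48 * a4" unfolding a4_def A by simp
    have "27 * (1 + 4 * a6) = - (of_int D ^ 2 * of_int t' * w ^ 3)"
    proof -
      have "27 * a6 = - of_int h - of_int D ^ 2 * of_int t' * g'" by (simp add: a6_def)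
      then show ?thesis using h unfolding w3 by (simp add: algebra_simps)
    qed
    then show "of_int D ^ 2 * of_int t * w ^ 3 = - 216 * (1 + 4 * a6)"
      unfolding t by simp
    show "of_int D ^ 3 * w ^ 6 \<in> U" using U by (intro U_intros; simp)+
    show "1 \<in> qfield m" using qfield_of_int[of 1 m] by simp
  qed auto
qed

text \<open>Here 2 ramifies and \<open>w\<close> is not a unit, but \<theta> is one since
  \<open>z\<close> is odd, so the equation is scaled by \<open>w\<close>. The model sought has a1 =
  \<delta>, a2 = 0 and a3 = 1 + h \<delta>, which makes b2 twice the odd number
  \<open>D' * q\<close>. Then a4 and a6 are solved from c4 and c6, and the powers of 2 in the
  denominators must cancel.\<close>

lemma good_reduction_at_2_even:
  assumes two: "2 \<in> P" and D: "D = 2 * D'" and A: "A = 4 * (1 + 4 * a)" and t: "t = 8 * t'"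
    and odds: "odd D'" "odd q" "odd x" "odd y" "odd t'" and e1: "\<epsilon> = - 1"
    and sgn_t: "4 dvd D' * q * (- 7 - 30 * a) - t' * D * x + (3 * (D' * q) * (1 + 4 * a) * (x * y) - t' * y) - 3"
  shows "good_reduction_at m P (short_weq (of_int A * of_int D * w ^ 2) (of_int D ^ 2 * of_int t * w ^ 3))"
proof -
  have "of_int 3 \<in> U" using two by (intro odd_U) auto
  then have three: "3 \<in> U" by simp
  then have U27: "27 \<in> U" using U_power[of 3 3] by simp
  have zP: "of_int z \<notin> P" using odd_notin_P two odd_z by blast
  define \<psi> where "\<psi> = 1 / \<theta>"
  have psi_U: "\<psi> \<in> U" unfolding \<psi>_def using theta_U[OF zP] by (intro U_intros)
  \<comment> \<open>Up to multiples of 4, \<open>c\<close> and \<open>f\<close> are the rational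
    part and the \<delta>-coefficient of 27 b6; \<open>sgn_t\<close> says that c + f is 3 modulo
    4.\<close>
  define n e \<alpha> c f where "n = D' * q" and "e = x * y" and "\<alpha> = 1 + 4 * a"
    and "c = n * (- 7 - 30 * a) - t' * D * x" and "f = 3 * n * \<alpha> * e - t' * y"
  note defs = n_def e_def \<alpha>_def c_def f_def
  have odd: "odd n" "odd e" "odd \<alpha>" "even f" using odds by (auto simp: defs)
  obtain i1 where i1: "n\<^sup>2 = 1 + 8 * i1" using odd_square_mod_8[OF odd(1)] by (metis add.commute)
  obtain i2 where i2: "z\<^sup>2 = 1 + 8 * i2" using odd_square_mod_8[OF odd_z] by (metis add.commute)
  obtain i3 where i3: "x\<^sup>2 = 1 + 8 * i3" using odd_square_mod_8[OF odds(3)] by (metis add.commute)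
  obtain i4 where i4: "D' = 2 * i4 + 1" using odds by (elim oddE)
  have "z\<^sup>2 + 2 * D * x\<^sup>2 = 5 + 8 * (i2 + i4 + 8 * i4 * i3 + 4 * i3)"
    unfolding D i2 i3 i4 by (simp add: algebra_simps)
  then obtain i where "z\<^sup>2 + 2 * D * x\<^sup>2 = 5 + 8 * i" by blast
  moreover have "D * x\<^sup>2 + q * y\<^sup>2 = z\<^sup>2 + 2 * D * x\<^sup>2" using conic e1 by simp
  ultimately have "D * x\<^sup>2 + q * y\<^sup>2 = 5 + 8 * i" by simp
  then have "of_int D * of_int x ^ 2 + of_int q * of_int y ^ 2 = (5 + 8 * of_int i :: real)"
    by (metis of_int_add of_int_mult of_int_numeral of_int_power)
  then have theta: "\<theta> = 5 + 8 * of_int i + 2 * of_int e * \<delta>" by (simp add: \<theta>_def e_def)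
  have delta: "\<delta> * \<delta> = 2 * of_int n" unfolding delta_sq D n_def by simp
  \<comment> \<open>5 - 2 e \<delta> inverts \<theta> modulo 8, because 4 \<delta>^2 is divisible by
    8; \<kappa> collects the error.\<close>
  define \<kappa> where "\<kappa> = 3 - of_int e ^ 2 * of_int n + of_int i * (5 - 2 * of_int e * \<delta>)"
  define l where "l = - \<psi> * \<kappa>"
  have "\<delta> \<in> L" using L_I[OF sqrt_B] .
  note L = L_intros this U_subset_L[OF psi_U] L_I[OF w_B]
  have l_L: "l \<in> L" unfolding l_def \<kappa>_def by (intro L)
  have "\<theta> * (5 - 2 * of_int e * \<delta>) = 25 - 4 * of_int e ^ 2 * (\<delta> * \<delta>) + 8 * of_int i * (5 - 2 * of_int e * \<delta>)"
    unfolding theta by (simp add: algebra_simps power2_eq_square)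
  also have "\<dots> = 1 + 8 * \<kappa>" unfolding delta \<kappa>_def by (simp add: algebra_simps)
  finally have *: "\<theta> * (5 - 2 * of_int e * \<delta>) = 1 + 8 * \<kappa>" .
  have "\<psi> * (\<theta> * (5 - 2 * of_int e * \<delta>)) = 5 - 2 * of_int e * \<delta>"
    using theta_nonzero by (simp add: \<psi>_def)
  then have psi: "\<psi> = 5 - 2 * of_int e * \<delta> + 8 * l"
    unfolding * l_def by (simp add: algebra_simps)
  define \<mu> where "\<mu> = 6 - 5 * of_int e * \<delta> + 2 * of_int e ^ 2 * of_int n + 4 * l * (5 - 2 * of_int e * \<delta>) + 16 * l ^ 2"
  have "\<psi> ^ 2 = 25 - 20 * of_int e * \<delta> + 4 * of_int e ^ 2 * (\<delta> * \<delta>) + 16 * l * (5 - 2 * of_int e * \<delta>) + 64 * l ^ 2"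
    unfolding psi by (simp add: algebra_simps power2_eq_square)
  then have psi2: "\<psi> ^ 2 = 1 + 4 * \<mu>" unfolding delta \<mu>_def by (simp add: algebra_simps)
  have mu_L: "\<mu> \<in> L" unfolding \<mu>_def using l_L by (intro L)
  have "even (\<alpha> * e - 3)" using odd by simp
  then obtain g where "\<alpha> * e - 3 = 2 * g" by blast
  then have g: "\<alpha> * e = 3 + 2 * g" by simp
  \<comment> \<open>Comparison with 27 a3^2 requires \<open>f\<close> to be 54 h and
    \<open>c\<close> to be 27 + 54 n h modulo 4. The first congruence fixes the bit
    \<open>h\<close>, the second then follows from \<open>sgn_t\<close>. As h^2 = h, the square of
    a3 is linear in \<open>h\<close>.\<close>
  define h where "h = f div 2 mod 2"
  have h: "h * h = h" unfolding h_def by (cases "even (f div 2)") (auto simp: odd_iff_mod_2_eq_one)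
  have f4: "4 dvd f - 54 * h" using odd(4) unfolding h_def by presburger
  have "4 dvd c + f - 3" using sgn_t unfolding defs by simp
  moreover obtain n' where "n = 2 * n' + 1" using odd(1) by (elim oddE)
  moreover have "54 * n * h = 4 * (27 * n' * h + 13 * h) + 2 * h" unfolding \<open>n = 2 * n' + 1\<close> by (simp add: algebra_simps)
  ultimately have c4: "4 dvd c - 27 - 54 * n * h" using odd(4) f4 by presburger
  obtain c1 where c1: "c = 27 + 54 * n * h + 4 * c1" using c4 by (auto elim!: dvdE simp: algebra_simps)
  obtain f1 where f1: "f = 54 * h + 4 * f1" using f4 by (auto elim!: dvdE simp: algebra_simps)
  define N I1 \<alpha>' e' h' a' g' c' f' t1 C1 F1 :: real where
    "N = of_int n" and "I1 = of_int i1" and "\<alpha>' = of_int \<alpha>" and "e' = of_int e" and "h' = of_int h"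
    and "a' = of_int a" and "g' = of_int g" and "c' = of_int c" and "f' = of_int f" and "t1 = of_int t'"
    and "C1 = of_int c1" and "F1 = of_int f1"
  note rdefs = N_def I1_def \<alpha>'_def e'_def h'_def a'_def g'_def c'_def f'_def t1_def C1_def F1_def
  note to_real = arg_cong[where f = "of_int :: int \<Rightarrow> real"]
  have r: "N * N = 1 + 8 * I1" "\<alpha>' * e' = 3 + 2 * g'" "h' * h' = h'" "\<alpha>' = 1 + 4 * a'"
    "c' = 27 + 54 * N * h' + 4 * C1" "f' = 54 * h' + 4 * F1" "f' = 3 * N * (\<alpha>' * e') - t1 * of_int y"
    "c' = N * (- 7 - 30 * a') - t1 * of_int D * of_int x"
    subgoal using to_real[OF i1] by (simp add: rdefs power2_eq_square)
    subgoal using to_real[OF g] by (simp add: rdefs)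
    subgoal using to_real[OF h] by (simp add: rdefs)
    subgoal using to_real[OF \<alpha>_def] by (simp add: rdefs)
    subgoal using to_real[OF c1] by (simp add: rdefs)
    subgoal using to_real[OF f1] by (simp add: rdefs)
    subgoal using to_real[OF f_def] by (simp add: rdefs mult.assoc)
    subgoal using to_real[OF c_def] by (simp add: rdefs)
    done
  have psi': "\<psi> = 5 - 2 * e' * \<delta> + 8 * l" using psi by (simp add: rdefs)
  have delta': "\<delta> * \<delta> = 2 * N" using delta by (simp add: rdefs)
  define a3 where "a3 = 1 + h' * \<delta>"
  \<comment> \<open>n^2 - \<alpha> \<psi> - 6 \<delta> a3 equals 12 a4 and is divisible by 4 for
    either value of \<open>h\<close>, so only the denominator 3 remains.\<close>
  define a4 where "a4 = (- 1 + 2 * I1 - 5 * a' + g' * \<delta> - 2 * \<alpha>' * l - 3 * N * h') / 3"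
  define a6 where "a6 = (C1 + F1 * \<delta> + N * I1 - 3 * N * \<alpha>' * l - t1 * \<mu> * w) / 27"
  have "\<alpha>' * \<psi> = 5 * \<alpha>' - 2 * (\<alpha>' * e') * \<delta> + 8 * \<alpha>' * l" unfolding psi' by (simp add: algebra_simps)
  then have al_psi: "\<alpha>' * \<psi> = 5 + 20 * a' - 6 * \<delta> - 4 * g' * \<delta> + 8 * \<alpha>' * l"
    unfolding r(2) by (simp add: r(4) algebra_simps)
  have d3: "\<delta> * a3 = \<delta> + 2 * N * h'" unfolding a3_def using delta' by (simp add: algebra_simps)
  have a33: "a3\<^sup>2 = 1 + 2 * h' * \<delta> + 2 * N * h'"
  proof -
    have "a3\<^sup>2 = 1 + 2 * h' * \<delta> + (h' * h') * (\<delta> * \<delta>)" by (simp add: a3_def power2_eq_square algebra_simps)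
    then show ?thesis unfolding r(3) delta' by simp
  qed
  have b4: "6 * (2 * a4 + \<delta> * a3) = N * N - \<alpha>' * \<psi>"
  proof -
    have "3 * a4 = - 1 + 2 * I1 - 5 * a' + g' * \<delta> - 2 * \<alpha>' * l - 3 * N * h'" by (simp add: a4_def)
    then show ?thesis unfolding d3 al_psi r(1) by (simp add: algebra_simps)
  qed
  have NN: "N * (N * N - 3 * (\<alpha>' * \<psi>)) = 2 * (N * (- 7 + 4 * I1 - 30 * a' + 3 * (\<alpha>' * e') * \<delta> - 12 * \<alpha>' * l))"
    unfolding r(1) al_psi r(2) by (simp add: algebra_simps)
  have w: "w = of_int D * of_int x + of_int y * \<delta>" by (simp add: w_def)
  have b6: "54 * (a3\<^sup>2 + 4 * a6) = N * (N * N - 3 * (\<alpha>' * \<psi>)) - 2 * t1 * \<psi> ^ 2 * w"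
  proof -
    have 1: "54 * (a3\<^sup>2 + 4 * a6) = 2 * ((27 + 54 * N * h' + 4 * C1) + (54 * h' + 4 * F1) * \<delta>
        + 4 * (N * I1 - 3 * N * \<alpha>' * l - t1 * \<mu> * w))"
    proof -
      have "27 * a6 = C1 + F1 * \<delta> + N * I1 - 3 * N * \<alpha>' * l - t1 * \<mu> * w" by (simp add: a6_def)
      then show ?thesis unfolding a33 by (simp add: algebra_simps)
    qed
    have 2: "c' + f' * \<delta> = N * (- 7 - 30 * a' + 3 * (\<alpha>' * e') * \<delta>) - t1 * w"
      unfolding r(8) r(7) w by (simp add: algebra_simps)
    show ?thesis unfolding 1 r(5)[symmetric] r(6)[symmetric] 2 NN psi2 by (simp add: algebra_simps)
  qed
  let ?E = "(\<delta>, 0 :: real, a3, a4, a6)"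
  have b2E: "b2 ?E = 2 * N" using delta' by (simp add: power2_eq_square)
  have b4E: "6 * b4 ?E = N * N - \<alpha>' * \<psi>" using b4 by simp
  have b6E: "54 * b6 ?E = N * (N * N - 3 * (\<alpha>' * \<psi>)) - 2 * t1 * \<psi> ^ 2 * w" using b6 by simp
  have c4': "of_int A * (1 / \<theta>) = 4 * \<alpha>' * \<psi>" by (simp add: A \<psi>_def \<alpha>'_def \<alpha>_def)
  have c6': "of_int t * (w / \<theta> ^ 2) = 8 * t1 * w * \<psi> ^ 2" by (simp add: t \<psi>_def t1_def power_one_over)
  show ?thesis
  proof (rule good_reduction_model[OF w_qfield w_nonzero refl _ _ _ _ _ _ _ scaled_by_w(1) _ scaled_by_w(2,3)])
    show "\<delta> \<in> L" "0 \<in> L" by fact (rule L)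
    show "a3 \<in> L" unfolding a3_def rdefs by (intro L)
    show "a4 \<in> L" unfolding a4_def rdefs using l_L three by (intro L)
    show "a6 \<in> L" unfolding a6_def rdefs using l_L U27 mu_L by (intro L)
    show "c4 ?E = of_int A * (1 / \<theta>)"
    proof -
      have "c4 ?E = 4 * N * N - 4 * (6 * b4 ?E)" unfolding c4_def b2E by (simp add: power2_eq_square)
      then show ?thesis unfolding c4' b4E by simp
    qed
    show "c6 ?E = of_int t * (w / \<theta> ^ 2)"
    proof -
      have "c6 ?E = - 8 * (N * N * N) + 12 * N * (6 * b4 ?E) - 4 * (54 * b6 ?E)"
        unfolding c6_def b2E by (simp add: eval_nat_numeral)
      then show ?thesis unfolding c6' b4E b6E by (simp add: algebra_simps)
    qed
    show "(1 / \<theta>) ^ 3 \<in> U" using psi_U U_power unfolding \<psi>_def by blast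
  qed
qed

end

section \<open>The conditions on A and t at 2 and 3\<close>

lemma square_dvd_mult_square:
  fixes D t c :: int
  assumes "c\<^sup>2 dvd D * t\<^sup>2" "coprime c D" shows "c dvd t"
proof -
  have "coprime (c\<^sup>2) D" using assms(2) by simp
  then have "c\<^sup>2 dvd t\<^sup>2" using assms(1) coprime_dvd_mult_right_iff by blast
  then show ?thesis by (simp add: pow_divides_pow_iff)
qed

text \<open>If \<open>A\<close> is 12 modulo 27, then 3^6 divides \<open>A ^ 3 - 1728\<close>, and
  the square-free \<open>D\<close> absorbs at most one factor 3. The remaining 3^5 forces 3^3 to
  divide \<open>t\<close>, since t^2 has even valuation.\<close>

lemma dvd_27_of_dvd_3:
  fixes D t A :: int
  assumes "squarefree D" "A \<in> R_set" "D * t\<^sup>2 = A ^ 3 - 1728" "3 dvd A"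
  shows "27 dvd t"
proof -
  have "27 dvd A - 12" using assms unfolding R_set_def by blast
  then obtain a where a: "A - 12 = 27 * a" by (elim dvdE)
  have "D * t\<^sup>2 = 729 * (a * (16 + 36 * a + 27 * a\<^sup>2))"
  proof -
    have A: "A = 12 + 27 * a" using a by simp
    show ?thesis unfolding assms(3) A by (simp add: algebra_simps eval_nat_numeral)
  qed
  then obtain b where b: "D * t\<^sup>2 = 729 * b" by blast
  have c: "\<exists>D1. coprime 3 D1 \<and> 243 dvd D1 * t\<^sup>2"
  proof (cases "3 dvd D")
    case True
    then obtain D1 where D1: "D = 3 * D1" by (elim dvdE)
    have "\<not> 3 dvd D1"
    proof
      assume "3 dvd D1"
      then have "3\<^sup>2 dvd D" unfolding D1 by (auto simp: power2_eq_square elim!: dvdE)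
      from squarefreeD[OF assms(1) this] show False by simp
    qed
    then have "coprime 3 D1" by (simp add: prime_imp_coprime)
    moreover have "D1 * t\<^sup>2 = 243 * b" using b unfolding D1 by simp
    ultimately show ?thesis by (metis dvd_triv_left)
  next
    case False
    then have "coprime 3 D" by (simp add: prime_imp_coprime)
    moreover have "D * t\<^sup>2 = 243 * (3 * b)" using b by simp
    ultimately show ?thesis by (metis dvd_triv_left)
  qed
  then obtain D1 where D1: "coprime 3 D1" "243 dvd D1 * t\<^sup>2" by blast
  have "coprime (3 ^ 2) D1" using D1(1) by (metis coprime_power_left_iff)
  moreover have "(3 ^ 2)\<^sup>2 dvd D1 * t\<^sup>2" using D1(2) by (elim dvdE) simp
  ultimately have "3 ^ 2 dvd t" using square_dvd_mult_square by blast
  then obtain s where s: "t = 9 * s" by (auto elim!: dvdE)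
  obtain e where "D1 * t\<^sup>2 = 243 * e" using D1(2) by (elim dvdE)
  then have "D1 * s\<^sup>2 = 3 * e" unfolding s by simp
  then have "3 dvd D1 * s\<^sup>2" by simp
  then have "3 dvd s\<^sup>2" using D1(1) coprime_dvd_mult_right_iff by blast
  then have "3 dvd s" by (simp add: prime_dvd_power_iff)
  then show ?thesis unfolding s by (auto elim!: dvdE)
qed

lemma dvd_8_of_eq:
  fixes D t :: int
  assumes "odd D" "D * t\<^sup>2 = 64 * b"
  obtains t' where "t = 8 * t'" "D * t'\<^sup>2 = b"
proof -
  have "coprime (2 ^ 3) D" using assms(1) by (simp only: coprime_power_left_iff coprime_left_2_iff_odd simp_thms)
  moreover have "(2 ^ 3)\<^sup>2 dvd D * t\<^sup>2" using assms(2) by simp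
  ultimately have "2 ^ 3 dvd t" using square_dvd_mult_square by blast
  then obtain t' where "t = 8 * t'" by (auto elim!: dvdE)
  moreover from this have "D * t'\<^sup>2 = b" using assms(2) by simp
  ultimately show thesis using that by blast
qed

text \<open>The valuation of \<open>A ^ 3 - 1728\<close> at 2 is 0, 6 or 7 according to the class of \<open>A\<close> at 2.\<close>

lemma good_odd_cases:
  fixes D t A :: int
  assumes "odd D" "A \<in> R_set" "D * t\<^sup>2 = A ^ 3 - 1728"
  obtains "odd A" "odd t" | a t' where "A = 16 * a" "t = 8 * t'" "odd t'"
proof (cases "odd A")
  case True
  then have "odd (D * t\<^sup>2)" unfolding assms(3) by simp
  then show thesis using True that(1) by simp
next
  case False
  then have "16 dvd A \<or> 16 dvd A - 4" using assms(2) unfolding R_set_def by blast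
  then show thesis
  proof
    assume "16 dvd A"
    then obtain a where a: "A = 16 * a" by (elim dvdE)
    have "D * t\<^sup>2 = 64 * (64 * a ^ 3 - 27)" unfolding assms(3) a by (simp add: algebra_simps eval_nat_numeral)
    then obtain t' where t': "t = 8 * t'" "D * t'\<^sup>2 = 64 * a ^ 3 - 27" using dvd_8_of_eq assms(1) by blast
    then have "odd (D * t'\<^sup>2)" by simp
    then have "odd t'" by simp
    then show thesis using that(2) a t' by blast
  next
    assume "16 dvd A - 4"
    then obtain a where a: "A - 4 = 16 * a" by (elim dvdE)
    then have A: "A = 4 * (1 + 4 * a)" by simp
    have "D * t\<^sup>2 = 64 * (2 * (2 * (16 * a ^ 3 + 12 * a\<^sup>2 + 3 * a - 7) + 1))"
      unfolding assms(3) A by (simp add: algebra_simps eval_nat_numeral)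
    then obtain t' where t': "D * t'\<^sup>2 = 2 * (2 * (16 * a ^ 3 + 12 * a\<^sup>2 + 3 * a - 7) + 1)"
      using dvd_8_of_eq assms(1) by blast
    then have "even (D * t'\<^sup>2)" by simp
    then obtain s where "t' = 2 * s" using assms(1) by (auto elim!: evenE)
    then have "2 * (D * s\<^sup>2) = 2 * (16 * a ^ 3 + 12 * a\<^sup>2 + 3 * a - 7) + 1" using t' by simp
    then show thesis by presburger
  qed
qed

text \<open>An even square-free \<open>D\<close> makes the valuation of \<open>A ^ 3 - 1728\<close>
  at 2 odd, so it is 7 and \<open>A\<close> is 4 modulo 16.\<close>

lemma good_even_cases:
  fixes D t A :: int
  assumes D: "D = 2 * D'" "odd D'" and "A \<in> R_set" and At: "D * t\<^sup>2 = A ^ 3 - 1728"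
  obtains a t' where "A = 4 * (1 + 4 * a)" "t = 8 * t'" "odd t'"
proof -
  have "even (A ^ 3 - 1728)" unfolding At[symmetric] D by simp
  then have "even A" by simp
  then have "16 dvd A \<or> 16 dvd A - 4" using assms(3) unfolding R_set_def by blast
  then show thesis
  proof
    assume "16 dvd A"
    then obtain a where a: "A = 16 * a" by (elim dvdE)
    have "D' * t\<^sup>2 = 32 * (64 * a ^ 3 - 27)" using At unfolding D a by (simp add: algebra_simps eval_nat_numeral)
    moreover have "coprime (2 ^ 2) D'" using D(2) by (simp only: coprime_power_left_iff coprime_left_2_iff_odd simp_thms)
    moreover have "(2\<^sup>2)\<^sup>2 dvd 32 * (64 * a ^ 3 - 27)" by (simp add: dvd_mult2)
    ultimately have "2\<^sup>2 dvd t" using square_dvd_mult_square by metis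
    then obtain s where "t = 4 * s" by (auto elim!: dvdE)
    then have *: "D' * s\<^sup>2 = 2 * (64 * a ^ 3 - 27)" using \<open>D' * t\<^sup>2 = _\<close> by simp
    then have "even (D' * s\<^sup>2)" by simp
    then obtain u where "s = 2 * u" using D by (auto elim!: evenE)
    then have "2 * (D' * u\<^sup>2) = 64 * a ^ 3 - 27" using * by simp
    then show thesis by presburger
  next
    assume "16 dvd A - 4"
    then obtain a where a: "A - 4 = 16 * a" by (elim dvdE)
    then have A: "A = 4 * (1 + 4 * a)" by simp
    have "D' * t\<^sup>2 = 64 * (2 * (16 * a ^ 3 + 12 * a\<^sup>2 + 3 * a - 7) + 1)"
      using At unfolding D A by (simp add: algebra_simps eval_nat_numeral)
    then obtain t' where t': "t = 8 * t'" "D' * t'\<^sup>2 = 2 * (16 * a ^ 3 + 12 * a\<^sup>2 + 3 * a - 7) + 1"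
      using dvd_8_of_eq D(2) by blast
    then have "odd (D' * t'\<^sup>2)" by simp
    then have "odd t'" by simp
    then show thesis using that A t' by blast
  qed
qed

lemma exists_sign_mod_4:
  fixes a b :: int
  assumes "odd a" "odd b"
  obtains \<sigma> where "\<sigma> = 1 \<or> \<sigma> = -1" "4 dvd a + \<sigma> * b"
proof -
  have "4 dvd a + b \<or> 4 dvd a + (-1) * b" using assms by presburger
  then show thesis using that[of 1] that[of "-1"] by auto
qed

text \<open>The hypotheses also give \<open>q\<close> the class of \<epsilon> modulo 4; cancelling
  \<epsilon> leaves x^2 - y^2 = 1 modulo 4.\<close>

lemma conic_parity_odd:
  fixes D q \<epsilon> x y z :: int
  assumes "D * x\<^sup>2 - q * y\<^sup>2 = \<epsilon> * z\<^sup>2" "\<epsilon> = 1 \<or> \<epsilon> = -1" "odd z" "odd D"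
    and "D mod 4 = \<epsilon> mod 4" "(D * q) mod 4 = 1"
  shows "odd x" "even y"
proof -
  have sq: "b\<^sup>2 mod 4 = b mod 2" for b :: int
  proof (cases "even b")
    case False
    then obtain c where "b = 2 * c + 1" by (elim oddE)
    then have "b\<^sup>2 = 4 * (c\<^sup>2 + c) + 1" by (simp add: power2_eq_square algebra_simps)
    then have "b\<^sup>2 mod 4 = 1" by presburger
    then show ?thesis using False by (simp add: odd_iff_mod_2_eq_one)
  qed (auto elim!: evenE)
  have q: "q mod 4 = \<epsilon> mod 4"
  proof -
    have "(D * q) mod 4 = (D mod 4) * (q mod 4) mod 4" by (rule mod_mult_eq[symmetric])
    moreover have "q mod 4 = 0 \<or> q mod 4 = 1 \<or> q mod 4 = 2 \<or> q mod 4 = 3" by presburger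
    ultimately show ?thesis using assms(2,5,6) by auto
  qed
  have "(D * x\<^sup>2 - q * y\<^sup>2) mod 4 = ((D mod 4) * (x\<^sup>2 mod 4) - (q mod 4) * (y\<^sup>2 mod 4)) mod 4"
    by (intro mod_diff_cong) (rule mod_mult_eq[symmetric])+
  also have "\<dots> = ((\<epsilon> mod 4) * (x mod 2) - (\<epsilon> mod 4) * (y mod 2)) mod 4" unfolding sq q assms(5) ..
  finally have *: "(\<epsilon> * z\<^sup>2) mod 4 = ((\<epsilon> mod 4) * (x mod 2) - (\<epsilon> mod 4) * (y mod 2)) mod 4"
    unfolding assms(1) .
  have "(\<epsilon> * z\<^sup>2) mod 4 = (\<epsilon> mod 4) * (z mod 2) mod 4" unfolding sq[symmetric] by (rule mod_mult_eq[symmetric])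
  moreover have "z mod 2 = 1" using assms(3) by presburger
  ultimately have "(\<epsilon> * z\<^sup>2) mod 4 = \<epsilon> mod 4" by simp
  then have **: "\<epsilon> mod 4 = ((\<epsilon> mod 4) * (x mod 2) - (\<epsilon> mod 4) * (y mod 2)) mod 4"
    using * by simp
  have "x mod 2 = 0 \<or> x mod 2 = 1" "y mod 2 = 0 \<or> y mod 2 = 1" by presburger+
  then have "x mod 2 = 1 \<and> y mod 2 = 0" using ** assms(2) by auto
  then show "odd x" "even y" by presburger+
qed

text \<open>An even \<open>x\<close> would make \<open>D * x\<^sup>2\<close> divisible by 8 and
  hence \<open>q\<close> congruent to 1 modulo 8, against its prescribed class.\<close>

lemma conic_parity_even:
  fixes D q x y z :: int
  assumes "D * x\<^sup>2 - q * y\<^sup>2 = - (z\<^sup>2)" "odd z" "D = 2 * D'" "odd D'" "q mod 8 = (D + 1) mod 8"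
  shows "odd q" "odd x" "odd y"
proof -
  show q: "odd q" using assms(3,5) by presburger
  have eq: "q * y\<^sup>2 = z\<^sup>2 + D * x\<^sup>2" using assms(1) by simp
  have "odd (z\<^sup>2 + D * x\<^sup>2)" using assms by simp
  then have "odd (q * y\<^sup>2)" unfolding eq .
  then show y: "odd y" by simp
  show "odd x"
  proof
    assume "even x"
    then obtain x' where x': "x = 2 * x'" by blast
    obtain y'' where y'': "y\<^sup>2 = 8 * y'' + 1" using odd_square_mod_8[OF y] .
    obtain z'' where z'': "z\<^sup>2 = 8 * z'' + 1" using odd_square_mod_8[OF assms(2)] .
    have "q + 8 * (q * y'') = 1 + 8 * (z'' + D' * x'\<^sup>2)"
      using eq unfolding y'' z'' by (simp add: assms(3) x' algebra_simps)
    then show False using assms(3,4,5) by presburger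
  qed
qed

lemma half_integer_omega_square:
  fixes m :: int
  assumes "m > 0" "m mod 4 = 1"
  shows "((1 + sqrt (of_int m)) / 2)\<^sup>2 = of_int 1 * ((1 + sqrt (of_int m)) / 2) + of_int ((m - 1) div 4)"
proof -
  have "m - 1 = 4 * ((m - 1) div 4)" using assms by presburger
  then have *: "of_int m = 1 + 4 * (of_int ((m - 1) div 4) :: real)"
    by (metis add_diff_cancel_left' diff_add_cancel of_int_1 of_int_add of_int_mult of_int_numeral add.commute)
  have "(sqrt (of_int m))\<^sup>2 = of_int m" using assms by simp
  then show ?thesis using * by (simp add: power2_eq_square field_simps)
qed

text \<open>The condition on the sign of \<open>t\<close> is a congruence between rational integers,
  the same for all places above 2; so one sign serves them all, and the other places accept either
  sign.\<close>

lemma exists_everywhere_good_reduction: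
  fixes D q \<epsilon> x y z :: int
  assumes "good D" and Dq: "D * q > 1"
    and conic: "D * x\<^sup>2 - q * y\<^sup>2 = \<epsilon> * z\<^sup>2" and eps: "\<epsilon> = 1 \<or> \<epsilon> = -1"
    and z: "coprime x z" "coprime D z" "odd z"
    and two: "odd D \<and> D mod 4 = \<epsilon> mod 4 \<and> (D * q) mod 4 = 1 \<or> even D \<and> \<epsilon> = -1 \<and> q mod 8 = (D + 1) mod 8"
  shows "\<exists>E. elliptic_curve_over (D * q) E \<and> everywhere_good_reduction (D * q) E \<and> j_inv E \<in> \<rat>"
proof -
  define m where "m = D * q"
  have m: "m > 0" using Dq by (simp add: m_def)
  define W where "W = of_int D * of_int x + of_int y * sqrt (of_int m)"
  obtain A t0 where A: "A \<in> R_set" and t0: "D * t0\<^sup>2 = A ^ 3 - 1728" and sf: "squarefree D"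
    using assms(1) unfolding good_def by blast
  define C where "C t = short_weq (of_int A * of_int D * W ^ 2) (of_int D ^ 2 * of_int t * W ^ 3)" for t :: int
  \<comment> \<open>For odd \<open>D\<close> the element (1 + sqrt m) / 2 is adjoined so that
    \<open>W\<close>, in which \<open>y\<close> is even, becomes congruent to a rational integer
    modulo 4.\<close>
  define \<omega> where "\<omega> = (if odd D then (1 + sqrt (of_int m)) / 2 else sqrt (of_int m))"
  define r s where "r = (if odd D then 1 else 0 :: int)" and "s = (if odd D then (m - 1) div 4 else m)"
  have place: "integral_place m P \<omega> r s" if "nonzero_prime_ideal m P" for P
  proof
    show "\<omega>\<^sup>2 = of_int r * \<omega> + of_int s"
      using half_integer_omega_square[of m] m two unfolding \<omega>_def r_def s_def by (auto simp flip: m_def)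
    show "\<omega> \<in> qfield m"
      unfolding \<omega>_def using m qfield_of_int[of 1 m] by (auto intro!: qfield_divide)
  qed (use m that in auto)
  have delta: "sqrt (of_int m) = of_int (if odd D then -1 else 0) + of_int (if odd D then 2 else 1) * \<omega>"
    by (simp add: \<omega>_def field_simps)
  have cplace: "conic_place m P \<omega> r s D q \<epsilon> x y z A t"
    if P: "nonzero_prime_ideal m P" and t: "t\<^sup>2 = t0\<^sup>2" for P t
  proof -
    interpret integral_place m P \<omega> r s using place P by blast
    show ?thesis
    proof
      show "sqrt (of_int m) \<in> B" unfolding B_def using delta by blast
      show "D * t\<^sup>2 = A ^ 3 - 1728" using t t0 by simp
    qed (use z conic eps in \<open>auto simp: m_def\<close>)
  qed
  have t27: "3 dvd A \<Longrightarrow> 27 dvd t" if "t\<^sup>2 = t0\<^sup>2" for t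
    using dvd_27_of_dvd_3[OF sf A, of t] that t0 by simp
  have W: "conic_place.w m D x y = W" if "nonzero_prime_ideal m P" for P
    using conic_place.w_def[OF cplace[OF that, of t0]] by (simp add: W_def)
  have odd_places: "good_reduction_at m P (C t)"
    if P: "nonzero_prime_ideal m P" and t: "t\<^sup>2 = t0\<^sup>2" and "2 \<notin> P" for P t
    using conic_place.good_reduction_odd_place[OF cplace[OF P t] \<open>2 \<notin> P\<close> t27[OF t]]
    unfolding W[OF P] C_def .
  have "\<exists>t. t\<^sup>2 = t0\<^sup>2 \<and> (\<forall>P. nonzero_prime_ideal m P \<longrightarrow> 2 \<in> P \<longrightarrow> good_reduction_at m P (C t))"
  proof (cases "odd D")
    case True
    then have D: "D mod 4 = \<epsilon> mod 4" "(D * q) mod 4 = 1" using two by auto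
    note xy = conic_parity_odd[OF conic eps z(3) True D]
    define k where "k = D * x - y"
    have k: "odd k" using xy True by (simp add: k_def)
    obtain y' where y': "y = 2 * y'" using xy by blast
    have Wk: "W = of_int k + 4 * (of_int y' * \<omega>)"
      unfolding W_def delta k_def y' using True by (simp add: algebra_simps)
    have g: "of_int y' * \<omega> \<in> integral_place.L P \<omega>" if "nonzero_prime_ideal m P" for P
    proof -
      interpret integral_place m P \<omega> r s using place that by blast
      show ?thesis by (intro L_intros)
    qed
    from good_odd_cases[OF True A t0] show ?thesis
    proof cases
      case 1
      then have "odd (D * t0 * k)" using True k by simp
      then obtain \<sigma> where \<sigma>: "\<sigma> = 1 \<or> \<sigma> = -1" "4 dvd A + \<sigma> * (D * t0 * k)"
        using exists_sign_mod_4 1 by blast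
      have t: "(\<sigma> * t0)\<^sup>2 = t0\<^sup>2" "4 dvd A + D * (\<sigma> * t0) * k" using \<sigma> by (auto simp: mult_ac)
      have "good_reduction_at m P (C (\<sigma> * t0))" if P: "nonzero_prime_ideal m P" "2 \<in> P" for P
        using conic_place.good_reduction_at_2_odd_odd[OF cplace[OF P(1) t(1)] P(2) True 1(1) _ g[OF P(1)] t(2)]
        unfolding W[OF P(1)] C_def using Wk .
      then show ?thesis using t by blast
    next
      case (2 a t')
      then have "odd (D\<^sup>2 * t' * k ^ 3)" using True k by simp
      then obtain \<sigma> where \<sigma>: "\<sigma> = 1 \<or> \<sigma> = -1" "4 dvd 27 + \<sigma> * (D\<^sup>2 * t' * k ^ 3)"
        by (rule exists_sign_mod_4[of 27, rotated]) simp_all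
      have "D\<^sup>2 * (\<sigma> * t') * k ^ 3 = \<sigma> * (D\<^sup>2 * t' * k ^ 3)" by (simp add: mult_ac)
      then have t: "4 dvd 27 + D\<^sup>2 * (\<sigma> * t') * k ^ 3" "(\<sigma> * t0)\<^sup>2 = t0\<^sup>2" "\<sigma> * t0 = 8 * (\<sigma> * t')"
        using \<sigma> 2 by auto
      have "good_reduction_at m P (C (\<sigma> * t0))" if P: "nonzero_prime_ideal m P" "2 \<in> P" for P
        using conic_place.good_reduction_at_2_odd_even[OF cplace[OF P(1) t(2)] P(2) True 2(1) t(3) _ g[OF P(1)] t(1)]
        unfolding W[OF P(1)] C_def using Wk .
      then show ?thesis using t by blast
    qed
  next
    case False
    then obtain D' where D': "D = 2 * D'" by blast
    have odd_D': "odd D'"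
    proof
      assume "even D'"
      then have "2\<^sup>2 dvd D" unfolding D' by (auto elim!: evenE)
      from squarefreeD[OF sf this] show False by simp
    qed
    have e1: "\<epsilon> = -1" and q: "q mod 8 = (D + 1) mod 8" using two False by auto
    have "D * x\<^sup>2 - q * y\<^sup>2 = - (z\<^sup>2)" using conic e1 by simp
    note xy = conic_parity_even[OF this z(3) D' odd_D' q]
    obtain a t' where at: "A = 4 * (1 + 4 * a)" "t0 = 8 * t'" "odd t'"
      using good_even_cases[OF D' odd_D' A t0] .
    \<comment> \<open>The part of the congruence that is free of \<open>t'\<close>. The other part
      enters with a minus sign, hence \<tau> = - \<sigma>.\<close>
    define F where "F = D' * q * (- 7 - 30 * a) + 3 * (D' * q) * (1 + 4 * a) * (x * y) - 3"
    have "odd F" unfolding F_def using odd_D' xy by simp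
    moreover have "odd (t' * (D * x + y))" using D' xy at by simp
    ultimately obtain \<sigma> where \<sigma>: "\<sigma> = 1 \<or> \<sigma> = -1" "4 dvd F + \<sigma> * (t' * (D * x + y))"
      using exists_sign_mod_4 by blast
    define \<tau> where "\<tau> = - \<sigma>"
    have "F + \<sigma> * (t' * (D * x + y)) =
        D' * q * (- 7 - 30 * a) - (\<tau> * t') * D * x + (3 * (D' * q) * (1 + 4 * a) * (x * y) - (\<tau> * t') * y) - 3"
      unfolding F_def \<tau>_def by (simp add: algebra_simps)
    then have sgn_t: "4 dvd D' * q * (- 7 - 30 * a) - (\<tau> * t') * D * x + (3 * (D' * q) * (1 + 4 * a) * (x * y) - (\<tau> * t') * y) - 3"
      using \<sigma>(2) by simp
    have t: "(\<tau> * t0)\<^sup>2 = t0\<^sup>2" "\<tau> * t0 = 8 * (\<tau> * t')" "odd (\<tau> * t')" using \<sigma> at by (auto simp: \<tau>_def)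
    have "good_reduction_at m P (C (\<tau> * t0))" if P: "nonzero_prime_ideal m P" "2 \<in> P" for P
      using conic_place.good_reduction_at_2_even[OF cplace[OF P(1) t(1)] P(2) D' at(1) t(2) odd_D' xy t(3) e1 sgn_t]
      unfolding W[OF P(1)] C_def .
    then show ?thesis using t by blast
  qed
  then obtain t where t: "t\<^sup>2 = t0\<^sup>2"
    and even_places: "\<And>P. nonzero_prime_ideal m P \<Longrightarrow> 2 \<in> P \<Longrightarrow> good_reduction_at m P (C t)" by blast
  have "everywhere_good_reduction m (C t)"
    unfolding everywhere_good_reduction_def using odd_places even_places t by blast
  have W_nz: "W \<noteq> 0"
  proof
    assume "W = 0"
    have "sqrt (of_int m) * sqrt (of_int m) = of_int D * of_int q" using m by (simp add: m_def flip: of_int_mult)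
    then have "W * (of_int D * of_int x - of_int y * sqrt (of_int m)) = of_int D * (of_int D * of_int x ^ 2 - of_int q * of_int y ^ 2)"
      unfolding W_def by (simp add: algebra_simps power2_eq_square)
    also have "of_int D * of_int x ^ 2 - of_int q * of_int y ^ 2 = (of_int (\<epsilon> * z\<^sup>2) :: real)"
      unfolding conic[symmetric] by simp
    finally have "D * (\<epsilon> * z\<^sup>2) = 0" using \<open>W = 0\<close> by (metis mult_zero_left of_int_eq_0_iff of_int_mult)
    then show False using m z eps by (auto simp: m_def)
  qed
  have D_nz: "D \<noteq> 0" using m by (auto simp: m_def)
  have "1728 * disc (C t) = (of_int A * of_int D * W ^ 2) ^ 3 - (of_int D ^ 2 * of_int t * W ^ 3) ^ 2"
    unfolding disc_eq_c4_c6 C_def by simp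
  also have "\<dots> = of_int D ^ 3 * W ^ 6 * of_int (A ^ 3 - D * t\<^sup>2)"
    by (simp add: algebra_simps eval_nat_numeral)
  finally have disc: "disc (C t) = of_int D ^ 3 * W ^ 6" using t t0 by simp
  have "j_inv (C t) = (of_int A * of_int D * W ^ 2) ^ 3 / (of_int D ^ 3 * W ^ 6)"
    unfolding j_inv_def disc by (simp add: C_def)
  also have "\<dots> = of_int (A ^ 3)"
    using W_nz D_nz by (simp add: power_mult_distrib flip: power_mult)
  finally have "j_inv (C t) \<in> \<rat>" by simp
  moreover have "W \<in> qfield m" unfolding W_def using m by (intro qfield_add qfield_mult) auto
  then have "elliptic_curve_over m (C t)"
    unfolding elliptic_curve_over_def disc using W_nz D_nz m qfield_of_int[of 0 m]
    by (auto simp: C_def short_weq_def intro!: qfield_divide qfield_minus qfield_mult qfield_power)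
  ultimately show ?thesis using \<open>everywhere_good_reduction m (C t)\<close> unfolding m_def by blast
qed

section \<open>Solubility of the conic\<close>

text \<open>Strictness is the point: in Legendre's argument it confines the value of the form to 0
  or n d, where weak bounds would admit further multiples.\<close>

lemma squarefree_square_less:
  fixes n x a :: int
  assumes "squarefree n" "n > 1" "\<bar>x\<bar> \<le> a" "a\<^sup>2 \<le> n"
  shows "x\<^sup>2 < n"
proof -
  have "x\<^sup>2 \<le> a\<^sup>2" using assms(3) by (metis abs_le_square_iff abs_ge_self order_trans abs_ge_zero abs_of_nonneg)
  moreover have "a\<^sup>2 \<noteq> n"
  proof
    assume *: "a\<^sup>2 = n"
    then have "a dvd 1" using squarefreeD[OF assms(1), of a] by simp
    then have "\<bar>a\<bar> = 1" by simp
    then show False using * assms(2) by (metis one_power2 power2_abs less_irrefl)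
  qed
  ultimately show ?thesis using assms(4) by simp
qed

lemma floor_sqrt_int:
  fixes n :: int
  assumes "n \<ge> 0"
  obtains a where "a \<ge> 0" "a\<^sup>2 \<le> n" "n < (a + 1)\<^sup>2"
proof
  let ?a = "floor_sqrt (nat n)"
  show "int ?a \<ge> 0" by simp
  have "?a\<^sup>2 \<le> nat n" by simp
  then have "int (?a\<^sup>2) \<le> n" using assms by linarith
  then show "(int ?a)\<^sup>2 \<le> n" by simp
  have "nat n < (Suc ?a)\<^sup>2" using Suc_floor_sqrt_power2_gt by blast
  then have "n < int ((Suc ?a)\<^sup>2)" using assms by linarith
  then show "n < (int ?a + 1)\<^sup>2" by (simp add: add.commute)
qed

text \<open>Pigeonhole: a box with sides about sqrt n, sqrt d and sqrt (n d) has more than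
  \<open>n * d\<close> points, and the two congruences define only \<open>n * d\<close>
  classes.\<close>

lemma small_congruence_solution:
  fixes d n r s :: int
  assumes n: "n > 0" and d: "d > 0"
    and a: "a \<ge> 0" "n < (a + 1)\<^sup>2" and b: "b \<ge> 0" "d < (b + 1)\<^sup>2" and c: "c \<ge> 0" "n * d < (c + 1)\<^sup>2"
  obtains x y z where "(x, y, z) \<noteq> (0, 0, 0)" "\<bar>x\<bar> \<le> a" "\<bar>y\<bar> \<le> b" "\<bar>z\<bar> \<le> c"
    "n dvd z - r * x" "d dvd z - s * y"
proof -
  define S where "S = {0..a} \<times> {0..b} \<times> {0..c}"
  define f where "f = (\<lambda>(x, y, z). ((z - r * x) mod n, (z - s * y) mod d))"
  have "f ` S \<subseteq> {0..<n} \<times> {0..<d}" using n d by (auto simp: f_def)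
  then have "card (f ` S) \<le> card ({0..<n} \<times> {0..<d})" by (intro card_mono) auto
  also have "\<dots> = nat (n * d)" using n d by (simp add: card_cartesian_product nat_mult_distrib)
  also have "\<dots> < nat ((a + 1) * (b + 1) * (c + 1))"
  proof -
    have "(n * d) * (n * d) < ((a + 1)\<^sup>2 * (b + 1)\<^sup>2) * (c + 1)\<^sup>2"
      using a b c n d by (intro mult_strict_mono) auto
    also have "\<dots> = ((a + 1) * (b + 1) * (c + 1))\<^sup>2" by (simp add: power_mult_distrib)
    finally have "(n * d)\<^sup>2 < ((a + 1) * (b + 1) * (c + 1))\<^sup>2" by (simp add: power2_eq_square)
    then have "n * d < (a + 1) * (b + 1) * (c + 1)"
      using a b c by (rule_tac power2_less_imp_less) auto
    moreover have "n * d > 0" using n d by simp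
    ultimately show ?thesis by linarith
  qed
  also have "\<dots> = card S"
    using a b c by (simp add: S_def card_cartesian_product nat_mult_distrib ab_semigroup_mult_class.mult_ac(1))
  finally have "\<not> inj_on f S" using pigeonhole by blast
  then obtain u v where uv: "u \<in> S" "v \<in> S" "u \<noteq> v" "f u = f v" unfolding inj_on_def by blast
  obtain x1 y1 z1 x2 y2 z2 where u: "u = (x1, y1, z1)" and v: "v = (x2, y2, z2)"
    by (cases u, cases v) blast
  show thesis
  proof (rule that[of "x1 - x2" "y1 - y2" "z1 - z2"])
    show "(x1 - x2, y1 - y2, z1 - z2) \<noteq> (0, 0, 0)" using uv u v by auto
    show "\<bar>x1 - x2\<bar> \<le> a" "\<bar>y1 - y2\<bar> \<le> b" "\<bar>z1 - z2\<bar> \<le> c" using uv u v by (auto simp: S_def)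
    have "(z1 - r * x1) mod n = (z2 - r * x2) mod n" "(z1 - s * y1) mod d = (z2 - s * y2) mod d"
      using uv u v by (auto simp: f_def)
    then have "n dvd (z1 - r * x1) - (z2 - r * x2)" "d dvd (z1 - s * y1) - (z2 - s * y2)"
      by (simp_all only: mod_eq_dvd_iff)
    then show "n dvd z1 - z2 - r * (x1 - x2)" "d dvd z1 - z2 - s * (y1 - y2)"
      by (simp_all add: algebra_simps)
  qed
qed

text \<open>Legendre's theorem for \<open>n y\<^sup>2 = z\<^sup>2 + d x\<^sup>2\<close>: on a lattice of index \<open>n d\<close> the form
  \<open>z\<^sup>2 + d x\<^sup>2 - n y\<^sup>2\<close> is divisible by \<open>n d\<close>, and a short vector takes the value 0 or \<open>n d\<close>; the
  latter case is repaired by multiplying with the norm \<open>y\<^sup>2 + d\<close>.\<close>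

lemma conic_solvable:
  fixes d n :: int
  assumes sf: "squarefree d" "squarefree n" and gt: "d > 1" "n > 1" and cop: "coprime d n"
    and r: "n dvd r\<^sup>2 + d" and s: "d dvd s\<^sup>2 - n"
  obtains x y z where "(x, y, z) \<noteq> (0, 0, 0)" "n * y\<^sup>2 = z\<^sup>2 + d * x\<^sup>2"
proof -
  have sf_nd: "squarefree (n * d)" using sf cop by (simp add: squarefree_mult_coprime coprime_commute)
  have nd: "n * d > 1" using gt by (metis less_1_mult)
  obtain a where a: "a \<ge> 0" "a\<^sup>2 \<le> n" "n < (a + 1)\<^sup>2"
    by (rule floor_sqrt_int[of n]) (use gt in simp_all)
  obtain b where b: "b \<ge> 0" "b\<^sup>2 \<le> d" "d < (b + 1)\<^sup>2"
    by (rule floor_sqrt_int[of d]) (use gt in simp_all)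
  obtain c where c: "c \<ge> 0" "c\<^sup>2 \<le> n * d" "n * d < (c + 1)\<^sup>2"
    by (rule floor_sqrt_int[of "n * d"]) (use nd in simp_all)
  obtain x y z where nz: "(x, y, z) \<noteq> (0, 0, 0)" and le: "\<bar>x\<bar> \<le> a" "\<bar>y\<bar> \<le> b" "\<bar>z\<bar> \<le> c"
    and dvd: "n dvd z - r * x" "d dvd z - s * y"
    using small_congruence_solution[of n d a b c r s] a b c gt by auto
  define V where "V = z\<^sup>2 + d * x\<^sup>2 - n * y\<^sup>2"
  have x: "x\<^sup>2 < n" and y: "y\<^sup>2 < d" and z: "z\<^sup>2 < n * d"
    using squarefree_square_less sf sf_nd gt nd a b c le by blast+
  have "V = (z - r * x) * (z + r * x) + (r\<^sup>2 + d) * x\<^sup>2 + n * (- (y\<^sup>2))"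
    by (simp add: V_def algebra_simps power2_eq_square)
  then have "n dvd V" using dvd r by simp
  moreover have "V = (z - s * y) * (z + s * y) + (s\<^sup>2 - n) * y\<^sup>2 + d * x\<^sup>2"
    by (simp add: V_def algebra_simps power2_eq_square)
  then have "d dvd V" using dvd s by simp
  ultimately have "n * d dvd V" using cop by (simp add: divides_mult coprime_commute)
  then obtain k where k: "V = n * d * k" by (elim dvdE)
  have "d * x\<^sup>2 < n * d" "n * y\<^sup>2 < n * d" using x y gt by simp_all
  moreover have "z\<^sup>2 \<ge> 0" "d * x\<^sup>2 \<ge> 0" "n * y\<^sup>2 \<ge> 0" using gt by simp_all
  ultimately have V: "V < (n * d) * 2" "(n * d) * (-1) < V" unfolding V_def using z by linarith+
  have k2: "k < 2" using V(1) nd unfolding k by (metis less_trans mult_less_cancel_left_pos zero_less_one)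
  have "-1 < k" using V(2) nd unfolding k by (metis less_trans mult_less_cancel_left_pos zero_less_one)
  then consider "k = 0" | "k = 1" using k2 by linarith
  then show thesis
  proof cases
    case 1
    then show thesis using that[OF nz] k by (simp add: V_def)
  next
    case 2
    then have V: "n * (y\<^sup>2 + d) = z\<^sup>2 + d * x\<^sup>2" using k by (simp add: V_def algebra_simps)
    have "n * (y\<^sup>2 + d)\<^sup>2 = (n * (y\<^sup>2 + d)) * (y\<^sup>2 + d)" by (simp add: power2_eq_square)
    also have "\<dots> = (z * y - d * x)\<^sup>2 + d * (z + x * y)\<^sup>2" unfolding V by (simp add: power2_eq_square algebra_simps)
    finally have eq: "n * (y\<^sup>2 + d)\<^sup>2 = (z * y - d * x)\<^sup>2 + d * (z + x * y)\<^sup>2" .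
    have "y\<^sup>2 + d > 0" using gt by (simp add: add_nonneg_pos)
    then show thesis using that[OF _ eq] by auto
  qed
qed

lemma squarefree_prime_dvd:
  fixes n p y :: int
  assumes "squarefree n" "prime p" "p\<^sup>2 dvd n * y\<^sup>2"
  shows "p dvd y"
proof (rule ccontr)
  assume "\<not> p dvd y"
  then have "coprime (p\<^sup>2) (y\<^sup>2)" using assms(2) by (simp add: prime_imp_coprime)
  then have "p\<^sup>2 dvd n" using assms(3) coprime_dvd_mult_left_iff by blast
  then have "p dvd 1" using assms(1) squarefreeD by blast
  then show False using assms(2) not_prime_unit by blast
qed

text \<open>After division by the gcd, square-freeness does the rest: a prime common to
  \<open>x\<close> and \<open>z\<close>, or to \<open>d\<close> and \<open>z\<close>, would be
  forced into all three coordinates.\<close>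

lemma conic_primitive:
  fixes d n x y z :: int
  assumes sf: "squarefree d" "squarefree n" and cop: "coprime d n"
    and nz: "(x, y, z) \<noteq> (0, 0, 0)" and eq: "n * y\<^sup>2 = z\<^sup>2 + d * x\<^sup>2"
  obtains g x' y' z' where "x = g * x'" "y = g * y'" "z = g * z'" "n * y'\<^sup>2 = z'\<^sup>2 + d * x'\<^sup>2"
    "coprime x' z'" "coprime d z'"
proof -
  define g where "g = gcd x (gcd y z)"
  have g: "g \<noteq> 0" using nz by (auto simp: g_def)
  obtain x' y' z' where xyz: "x = g * x'" "y = g * y'" "z = g * z'"
    unfolding g_def by (metis dvd_def gcd_dvd1 gcd_dvd2 dvd_trans)
  have "g\<^sup>2 * (n * y'\<^sup>2) = g\<^sup>2 * (z'\<^sup>2 + d * x'\<^sup>2)"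
    using eq unfolding xyz by (simp add: power_mult_distrib algebra_simps)
  then have eq': "n * y'\<^sup>2 = z'\<^sup>2 + d * x'\<^sup>2" using g by simp
  have no_common: "\<not> (p dvd x' \<and> p dvd y' \<and> p dvd z')" if "prime p" for p
  proof
    assume "p dvd x' \<and> p dvd y' \<and> p dvd z'"
    then have "g * p dvd x" "g * p dvd y" "g * p dvd z" unfolding xyz by (auto intro: mult_dvd_mono)
    then have "g * p dvd gcd x (gcd y z)" by simp
    then have "g * p dvd g" by (simp add: g_def)
    then have "p dvd 1" using g by (metis dvd_mult_cancel_left mult.right_neutral)
    then show False using that not_prime_unit by blast
  qed
  have coprimeI: "coprime a b" if "\<And>p. prime p \<Longrightarrow> p dvd a \<Longrightarrow> p dvd b \<Longrightarrow> False" for a b :: int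
  proof (rule ccontr)
    assume "\<not> coprime a b"
    then have "gcd a b \<noteq> 1" by (simp add: coprime_iff_gcd_eq_1)
    then have "\<not> is_unit (gcd a b)" by simp
    then have "\<exists>p. prime p \<and> p dvd gcd a b"
      using prime_divisor_exists[of "gcd a b"] by (cases "gcd a b = 0") (auto intro: exI[of _ 2])
    then show False using that by auto
  qed
  have xz: "coprime x' z'"
  proof (rule coprimeI)
    fix p :: int assume p: "prime p" "p dvd x'" "p dvd z'"
    then have "p\<^sup>2 dvd z'\<^sup>2 + d * x'\<^sup>2" by (simp add: dvd_power_same)
    then have "p dvd y'" using squarefree_prime_dvd[OF sf(2) p(1), of y'] eq' by simp
    then show False using no_common p by blast
  qed
  have "coprime d z'"
  proof (rule coprimeI)
    fix p :: int assume p: "prime p" "p dvd d" "p dvd z'"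
    then have "p dvd n * y'\<^sup>2" unfolding eq' by (simp add: power2_eq_square)
    moreover have "\<not> p dvd n" using p cop by (meson coprime_common_divisor not_prime_unit)
    ultimately have "p dvd y'" using p(1) by (meson prime_dvd_mult_iff prime_dvd_power)
    then have "p\<^sup>2 dvd n * y'\<^sup>2 - z'\<^sup>2" using p by (simp add: dvd_power_same)
    then have "p\<^sup>2 dvd d * x'\<^sup>2" using eq' by simp
    then have "p dvd x'" using squarefree_prime_dvd[OF sf(1) p(1)] by blast
    then show False using no_common p \<open>p dvd y'\<close> by blast
  qed
  with xz show thesis using that xyz eq' by blast
qed

text \<open>If \<open>z\<close> is even, then \<open>(x \<surd>d + y \<surd>n)\<^sup>3 / 8\<close> is integral and has odd norm.\<close>

theorem conic_solvable_odd:
  fixes d n :: int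
  assumes sf: "squarefree d" "squarefree n" and gt: "d > 1" "n > 1" and cop: "coprime d n"
    and r: "n dvd r\<^sup>2 + d" and s: "d dvd s\<^sup>2 - n"
    and two: "even d \<or> (d * n) mod 8 = 5"
  obtains x y z where "n * y\<^sup>2 = z\<^sup>2 + d * x\<^sup>2" "coprime x z" "coprime d z" "odd z"
proof -
  obtain x0 y0 z0 where "(x0, y0, z0) \<noteq> (0, 0, 0)" "n * y0\<^sup>2 = z0\<^sup>2 + d * x0\<^sup>2"
    using conic_solvable[OF sf gt cop r s] .
  then obtain x y z where xyz: "n * y\<^sup>2 = z\<^sup>2 + d * x\<^sup>2" "coprime x z" "coprime d z"
    using conic_primitive[OF sf cop] by metis
  show thesis
  proof (cases "odd z")
    case True
    then show thesis using that xyz by blast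
  next
    case False
    then have "odd x" "odd d" using xyz by (auto dest: coprime_common_divisor)
    then have "odd (n * y\<^sup>2)" unfolding xyz using False by simp
    then have "odd y" "odd n" by auto
    have dn: "(d * n) mod 8 = 5" using two \<open>odd d\<close> by blast
    obtain kx where kx: "x\<^sup>2 = 8 * kx + 1" using odd_square_mod_8[OF \<open>odd x\<close>] .
    obtain ky where ky: "y\<^sup>2 = 8 * ky + 1" using odd_square_mod_8[OF \<open>odd y\<close>] .
    obtain kd where kd: "d\<^sup>2 = 8 * kd + 1" using odd_square_mod_8[OF \<open>odd d\<close>] .
    have "\<exists>l. d * n = 8 * l + 5" using dn by (metis mult_div_mod_eq)
    then obtain l where l: "d * n = 8 * l + 5" ..
    \<comment> \<open>Since d^2 is 1 modulo 8, \<open>d * n\<close> being 5 means that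
      \<open>n\<close> is 5 d modulo 8.\<close>
    have "n + 8 * (kd * n) = d\<^sup>2 * n" unfolding kd by (simp add: algebra_simps)
    also have "\<dots> = d * (d * n)" by (simp add: power2_eq_square)
    also have "\<dots> = 5 * d + 8 * (d * l)" unfolding l by (simp add: algebra_simps)
    finally have n: "n = 5 * d + 8 * (d * l - kd * n)" by (simp add: algebra_simps)
    define u v where "u = d * x\<^sup>2" and "v = n * y\<^sup>2"
    have u: "u = d + 8 * (d * kx)" unfolding u_def kx by (simp add: algebra_simps)
    have v: "v = 5 * d + 8 * (d * l - kd * n + n * ky)" unfolding v_def ky using n by (simp add: algebra_simps)
    have vu: "v - u = z\<^sup>2" using xyz(1) by (simp add: u_def v_def)
    obtain z1 where z1: "z = 2 * z1" using False by blast
    have "4 * z1\<^sup>2 = 4 * d + 8 * (d * l - kd * n + n * ky - d * kx)"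
      using vu unfolding u v z1 by (simp add: algebra_simps)
    then have "z1\<^sup>2 = d + 2 * (d * l - kd * n + n * ky - d * kx)" by simp
    then have "odd (z1\<^sup>2)" using \<open>odd d\<close> by simp
    then have odd_z1: "odd (z1 ^ 3)" by simp
    \<comment> \<open>(x sqrt d + y sqrt n)^3 = (u + 3 v) x sqrt d + (3 u + v) y sqrt n, and both
      coefficients are divisible by 8 because \<open>v\<close> is 5 u modulo 8. The cube has norm
      z^6 up to sign, and z / 2 is odd.\<close>
    have "u + 3 * v = 8 * (2 * d + d * kx + 3 * (d * l - kd * n + n * ky))" unfolding u v by (simp add: algebra_simps)
    then obtain e where e: "u + 3 * v = 8 * e" by blast
    have "3 * u + v = 8 * (d + 3 * (d * kx) + (d * l - kd * n + n * ky))" unfolding u v by (simp add: algebra_simps)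
    then obtain f where f: "3 * u + v = 8 * f" by blast
    have "v * (3 * u + v)\<^sup>2 - u * (u + 3 * v)\<^sup>2 = (v - u) ^ 3"
      by (simp add: power2_eq_square power3_eq_cube algebra_simps)
    then have "64 * (v * f\<^sup>2 - u * e\<^sup>2) = 64 * (z1 ^ 3)\<^sup>2"
      unfolding e f vu z1 by (simp add: power_mult_distrib algebra_simps flip: power_mult)
    then have "v * f\<^sup>2 = (z1 ^ 3)\<^sup>2 + u * e\<^sup>2" by simp
    then have eq: "n * (y * f)\<^sup>2 = (z1 ^ 3)\<^sup>2 + d * (x * e)\<^sup>2"
      by (simp add: u_def v_def power_mult_distrib algebra_simps)
    moreover have "(x * e, y * f, z1 ^ 3) \<noteq> (0, 0, 0)" using odd_z1 by auto
    ultimately obtain g x' y' z' where "n * y'\<^sup>2 = z'\<^sup>2 + d * x'\<^sup>2" "coprime x' z'" "coprime d z'" "z1 ^ 3 = g * z'"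
      using conic_primitive[OF sf cop] by metis
    moreover from this have "odd z'" using odd_z1 by simp
    ultimately show thesis using that by blast
  qed
qed

section \<open>Mertens' theorem for real characters\<close>

lemma sum_over_divisors:
  fixes g :: "nat \<Rightarrow> nat \<Rightarrow> real"
  shows "(\<Sum>n\<in>{1..N}. \<Sum>d | d dvd n. g d (n div d)) = (\<Sum>d\<in>{1..N}. \<Sum>m\<in>{1..N div d}. g d m)"
proof -
  have "(\<Sum>n\<in>{1..N}. \<Sum>d | d dvd n. g d (n div d)) = (\<Sum>(n, d)\<in>(SIGMA n:{1..N}. {d. d dvd n}). g d (n div d))"
    by (intro sum.Sigma) auto
  also have "\<dots> = (\<Sum>(d, m)\<in>(SIGMA d:{1..N}. {1..N div d}). g d m)"
  proof (rule sum.reindex_bij_witness[of _ "\<lambda>(d, m). (d * m, d)" "\<lambda>(n, d). (d, n div d)"], goal_cases)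
    case (2 a)
    then obtain n d where a: "a = (n, d)" "n \<in> {1..N}" "d dvd n" by auto
    then obtain m where "n = d * m" by blast
    moreover from this have "d > 0" "m > 0" "d * m \<le> N" using a by (auto intro: Nat.gr0I)
    moreover from this have "d \<le> N" by (metis le_trans mult.right_neutral mult_le_mono2 Suc_leI One_nat_def)
    ultimately show ?case using a dvd_imp_le[of d n]
      by (auto simp: Suc_le_eq less_eq_div_iff_mult_less_eq mult.commute)
  next
    case (4 b)
    then obtain d m where b: "b = (d, m)" "d \<in> {1..N}" "m \<in> {1..N div d}" by auto
    then have "d * m \<le> d * (N div d)" by simp
    also have "\<dots> \<le> N" by simp
    finally show ?case using b by (auto simp: Suc_le_eq)
  qed auto
  also have "\<dots> = (\<Sum>d\<in>{1..N}. \<Sum>m\<in>{1..N div d}. g d m)"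
    by (intro sum.Sigma[symmetric]) auto
  finally show ?thesis .
qed

definition chebyshev_psi :: "nat \<Rightarrow> real" where
  "chebyshev_psi n = (\<Sum>d\<in>{1..n}. mangoldt d)"

lemma ln_fact_mangoldt: "ln (fact n) = (\<Sum>d\<in>{1..n}. mangoldt d * real (n div d))"
proof -
  have "ln (fact n :: real) = (\<Sum>k\<in>{1..n}. ln (real k))"
    by (subst ln_prod[symmetric]) (auto simp: fact_prod)
  also have "\<dots> = (\<Sum>k\<in>{1..n}. \<Sum>d | d dvd k. mangoldt d)"
    by (intro sum.cong) (auto simp: mangoldt_sum)
  also have "\<dots> = (\<Sum>d\<in>{1..n}. \<Sum>m\<in>{1..n div d}. mangoldt d)"
    by (rule sum_over_divisors[of "\<lambda>d m. mangoldt d"])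
  finally show ?thesis by (simp add: mult.commute)
qed

lemma ln_fact_mangoldt':
  assumes "n \<le> N" shows "ln (fact n) = (\<Sum>d\<in>{1..N}. mangoldt d * real (n div d))"
  unfolding ln_fact_mangoldt using assms by (intro sum.mono_neutral_left) auto

text \<open>The logarithm of the middle binomial coefficient is at most n ln 2. Written with
  \<open>mangoldt\<close>, it has nonnegative coefficients, which are at least 1 for
  \<open>d\<close> in the upper half of the range.\<close>

lemma chebyshev_psi_half: "chebyshev_psi n \<le> chebyshev_psi (n - n div 2) + real n * ln 2"
proof -
  define k where "k = n div 2"
  have k: "k \<le> n" "k \<le> n - k" "n - k \<le> n" by (auto simp: k_def)
  have "(n choose k) \<le> 2 ^ n" using binomial_le_pow2 by blast
  then have "real (n choose k) \<le> 2 ^ n" by (metis of_nat_le_iff of_nat_numeral of_nat_power)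
  moreover have pos: "n choose k > 0" using k by simp
  ultimately have "ln (real (n choose k)) \<le> ln (2 ^ n)" by (subst ln_le_cancel_iff) auto
  then have 1: "ln (real (n choose k)) \<le> real n * ln 2" by (simp add: ln_realpow)
  have "real (n choose k) = fact n / (fact k * fact (n - k))" using k by (simp add: binomial_fact)
  then have "ln (real (n choose k)) = ln (fact n) - ln (fact k) - ln (fact (n - k))"
    by (simp add: ln_div ln_mult)
  also have "\<dots> = (\<Sum>d\<in>{1..n}. mangoldt d * (real (n div d) - real (k div d) - real ((n - k) div d)))"
    unfolding ln_fact_mangoldt'[OF le_refl, of n] ln_fact_mangoldt'[OF k(1)] ln_fact_mangoldt'[OF k(3)]
    by (simp add: sum_subtractf sum.distrib algebra_simps)
  also have "\<dots> \<ge> (\<Sum>d\<in>{n - k<..n}. mangoldt d * (real (n div d) - real (k div d) - real ((n - k) div d)))"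
  proof (intro sum_mono2 mult_nonneg_nonneg mangoldt_nonneg)
    fix d
    have "k div d + (n - k) div d \<le> n div d"
      using k by (metis div_add1_eq le_add1 le_add_diff_inverse)
    then show "0 \<le> real (n div d) - real (k div d) - real ((n - k) div d)" by linarith
  qed auto
  also have "(\<Sum>d\<in>{n - k<..n}. mangoldt d * (real (n div d) - real (k div d) - real ((n - k) div d))) \<ge> (\<Sum>d\<in>{n - k<..n}. mangoldt d)"
  proof (intro sum_mono)
    fix d assume d: "d \<in> {n - k<..n}"
    then have "n div d \<ge> 1" "k div d = 0" "(n - k) div d = 0"
      using k by (auto simp: Suc_le_eq div_greater_zero_iff)
    then show "(mangoldt d :: real) \<le> mangoldt d * (real (n div d) - real (k div d) - real ((n - k) div d))"
      using mangoldt_nonneg[of d] by (simp add: mult_le_cancel_left1)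
  qed
  finally have "(\<Sum>d\<in>{n - k<..n}. mangoldt d) \<le> real n * ln 2" using 1 by simp
  moreover have "chebyshev_psi n = chebyshev_psi (n - k) + (\<Sum>d\<in>{n - k<..n}. mangoldt d)"
  proof -
    have "{1..n} = {1..n - k} \<union> {n - k<..n}" by auto
    then show ?thesis unfolding chebyshev_psi_def by (simp only:) (intro sum.union_disjoint, auto)
  qed
  ultimately show ?thesis unfolding k_def by simp
qed

lemma chebyshev_psi_le: "chebyshev_psi n \<le> 4 * real n"
proof (induction n rule: less_induct)
  case (less n)
  show ?case
  proof (cases "n \<le> 1")
    case True
    then have "n = 0 \<or> n = 1" by auto
    then show ?thesis by (auto simp: chebyshev_psi_def)
  next
    case False
    then have "n - n div 2 < n" by auto
    then have "chebyshev_psi (n - n div 2) \<le> 4 * real (n - n div 2)" using less by blast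
    moreover have "2 * (n - n div 2) \<le> n + 1" by presburger
    then have "real (2 * (n - n div 2)) \<le> real (n + 1)" by (rule of_nat_mono)
    then have "real (n - n div 2) \<le> (real n + 1) / 2" by simp
    \<comment> \<open>The constant 4 comes from here: 2 (n + 1) + 3 n / 4 is at most 4 n from n = 2
      on.\<close>
    moreover have "real n * ln 2 \<le> real n * (3/4)" using ln2_le_25_over_36 by (intro mult_left_mono) auto
    ultimately have "chebyshev_psi n \<le> 2 * (real n + 1) + real n * (3/4)"
      using chebyshev_psi_half[of n] by linarith
    then show ?thesis using False by simp
  qed
qed

lemma ln_fact_bounds:
  assumes "n \<ge> 1"
  shows "real n * ln (real n) - real n \<le> ln (fact n) \<and> ln (fact n) \<le> real n * ln (real n)"
  using assms
proof (induction n rule: dec_induct)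
  case (step n)
  have n: "real n > 0" using step by simp
  define a b where "a = ln (real n)" and "b = ln (real (Suc n))"
  have eq: "ln (fact (Suc n) :: real) = b + ln (fact n)" unfolding fact_Suc b_def by (subst ln_mult) auto
  have "b - a = ln (1 + 1 / real n)"
    unfolding a_def b_def using n ln_div[of "real (Suc n)" "real n"] by (simp add: add_divide_distrib add.commute)
  also have "\<dots> \<le> 1 / real n" by (intro ln_add_one_self_le_self) auto
  finally have "real n * (b - a) \<le> real n * (1 / real n)" by (intro mult_left_mono) auto
  then have *: "real n * b \<le> real n * a + 1" using n by (simp add: right_diff_distrib)
  have "a \<le> b" unfolding a_def b_def using n by simp
  then have **: "real n * a \<le> real n * b" by (intro mult_left_mono) auto
  have "real (Suc n) * b = real n * b + b" by (simp add: distrib_right)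
  moreover have "real n * a - real n \<le> ln (fact n)" "ln (fact n) \<le> real n * a"
    using step(3) unfolding a_def by blast+
  ultimately show ?case unfolding eq b_def[symmetric] using * ** by simp
qed auto

lemma real_nat_div_bounds: "real (n div d) \<le> real n / real d" "real n / real d - 1 \<le> real (n div d)"
proof -
  have "real (n div d) = of_int \<lfloor>real n / real d\<rfloor>" by (simp add: floor_divide_of_nat_eq)
  then show "real (n div d) \<le> real n / real d" "real n / real d - 1 \<le> real (n div d)" by linarith+
qed

text \<open>Dropping the integer parts in the formula for ln (n!) changes it by at most
  \<open>chebyshev_psi n\<close>, which is at most 4 n; division by \<open>n\<close> gives a bounded
  error.\<close>

lemma mertens_mangoldt:
  assumes "n \<ge> 1"
  shows "\<bar>(\<Sum>d\<in>{1..n}. mangoldt d / real d) - ln (real n)\<bar> \<le> 4"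
proof -
  let ?M = "\<Sum>d\<in>{1..n}. mangoldt d / real d"
  have "ln (fact n) \<le> (\<Sum>d\<in>{1..n}. mangoldt d * (real n / real d))"
    unfolding ln_fact_mangoldt
    by (intro sum_mono mult_left_mono mangoldt_nonneg) (rule real_nat_div_bounds)
  also have "\<dots> = real n * ?M" by (simp add: sum_distrib_left mult_ac)
  finally have "real n * (ln (real n) - 1) \<le> real n * ?M" using ln_fact_bounds[OF assms] by (simp add: algebra_simps)
  then have 1: "ln (real n) - 1 \<le> ?M" using assms by simp
  have "real n * ?M - chebyshev_psi n = (\<Sum>d\<in>{1..n}. mangoldt d * (real n / real d - 1))"
    by (simp add: sum_distrib_left chebyshev_psi_def sum_subtractf algebra_simps)
  also have "\<dots> \<le> ln (fact n)" unfolding ln_fact_mangoldt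
  proof (intro sum_mono mult_left_mono mangoldt_nonneg)
    fix d assume "d \<in> {1..n}"
    show "real n / real d - 1 \<le> real (n div d)" by (rule real_nat_div_bounds)
  qed
  finally have "real n * ?M \<le> real n * (ln (real n) + 4)"
    using ln_fact_bounds[OF assms] chebyshev_psi_le[of n] by (simp add: algebra_simps)
  then have "?M \<le> ln (real n) + 4" using assms by simp
  with 1 show ?thesis by linarith
qed

lemma summable_ln_over_square: "summable (\<lambda>n. ln (real n) / (real n * (real n - 1)))"
proof (rule summable_comparison_test_bigo)
  show "summable (\<lambda>n. norm (real n powr (-3/2)))" by (simp add: summable_real_powr_iff)
  show "(\<lambda>n. ln (real n) / (real n * (real n - 1))) \<in> O(\<lambda>n. real n powr (-3/2))" by real_asymp
qed

text \<open>Dominates the sum of ln p / p^k over all primes and all k of at least 2. The terms at 0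
  and 1 vanish, as division by zero yields 0.\<close>

definition prime_tail :: real where
  "prime_tail = (\<Sum>n. ln (real n) / (real n * (real n - 1)))"

lemma sum_ln_over_square_le:
  assumes "finite A" "\<And>n. n \<in> A \<Longrightarrow> n \<ge> 1"
  shows "(\<Sum>n\<in>A. ln (real n) / (real n * (real n - 1))) \<le> prime_tail"
  unfolding prime_tail_def
proof (rule sum_le_suminf[OF summable_ln_over_square assms(1)])
  fix n :: nat
  show "0 \<le> ln (real n) / (real n * (real n - 1))"
    by (cases "n = 0") auto
qed

lemma sum_inverse_powers_le:
  fixes p :: real
  assumes "p > 1" shows "(\<Sum>k\<in>{2..n}. 1 / p ^ k) \<le> 1 / (p * (p - 1))"
proof -
  have "(\<Sum>k\<in>{2..n}. 1 / p ^ k) = 1 / (p * (p - 1)) - 1 / (p ^ n * (p - 1))" if "n \<ge> 1"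
    using that
  proof (induction n rule: dec_induct)
    case (step n)
    have "(\<Sum>k\<in>{2..Suc n}. 1 / p ^ k) = (\<Sum>k\<in>{2..n}. 1 / p ^ k) + 1 / p ^ Suc n"
      using step by (simp add: sum.nat_ivl_Suc')
    moreover have "1 / (p ^ n * (p - 1)) = 1 / p ^ Suc n + 1 / (p ^ Suc n * (p - 1))"
    proof -
      have "p ^ n > 0" using assms by simp
      then show ?thesis using assms by (simp add: divide_simps)
    qed
    ultimately show ?case using step by simp
  qed auto
  then show ?thesis using assms by (cases "n \<ge> 1") (auto simp: divide_nonneg_nonneg)
qed

lemma sum_higher_prime_powers_le:
  "(\<Sum>d | d \<in> {1..n} \<and> \<not> prime d. mangoldt d / real d) \<le> prime_tail"
proof -
  let ?P = "{p. p \<in> {2..n} \<and> prime p}"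
  have "(\<Sum>d | d \<in> {1..n} \<and> \<not> prime d. mangoldt d / real d) = (\<Sum>d | d \<in> {1..n} \<and> primepow d \<and> \<not> prime d. mangoldt d / real d)"
    by (intro sum.mono_neutral_right) (auto simp: mangoldt_def)
  also have "\<dots> \<le> (\<Sum>(p, k)\<in>?P \<times> {2..n}. ln (real p) * (1 / real p ^ k))"
  proof (rule sum_le_included[where i = "\<lambda>(p, k). p ^ k"])
    show "\<forall>y\<in>?P \<times> {2..n}. 0 \<le> (case y of (p, k) \<Rightarrow> ln (real p) * (1 / real p ^ k))" by auto
    show "\<forall>x\<in>{d \<in> {1..n}. primepow d \<and> \<not> prime d}. \<exists>y\<in>?P \<times> {2..n}. (case y of (p, k) \<Rightarrow> p ^ k) = x \<and>
        mangoldt x / real x \<le> (case y of (p, k) \<Rightarrow> ln (real p) * (1 / real p ^ k))"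
    proof
      fix d assume d: "d \<in> {d \<in> {1..n}. primepow d \<and> \<not> prime d}"
      then obtain p k where pk: "prime p" "k > 0" "d = p ^ k" by (auto simp: primepow_def)
      then have "k \<noteq> 1" using d by auto
      then have k: "k \<ge> 2" using pk by linarith
      have p: "p \<ge> 2" using pk prime_ge_2_nat by blast
      have "k < 2 ^ k" by (rule less_exp)
      also have "(2::nat) ^ k \<le> p ^ k" using p by (intro power_mono) auto
      finally have kn: "k \<le> n" using d pk by auto
      have "p ^ 1 \<le> p ^ k" using p pk by (intro power_increasing) auto
      then have "p \<le> n" using d pk by auto
      then show "\<exists>y\<in>?P \<times> {2..n}. (case y of (p, k) \<Rightarrow> p ^ k) = d \<and>
        mangoldt d / real d \<le> (case y of (p, k) \<Rightarrow> ln (real p) * (1 / real p ^ k))"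
        using pk k kn p by (intro bexI[of _ "(p, k)"]) auto
    qed
  qed auto
  also have "\<dots> = (\<Sum>p\<in>?P. ln (real p) * (\<Sum>k\<in>{2..n}. 1 / real p ^ k))"
    by (simp add: sum.cartesian_product sum_distrib_left)
  also have "\<dots> \<le> (\<Sum>p\<in>?P. ln (real p) * (1 / (real p * (real p - 1))))"
    by (intro sum_mono mult_left_mono sum_inverse_powers_le) auto
  also have "\<dots> \<le> prime_tail"
    using sum_ln_over_square_le[of ?P] by simp
  finally show ?thesis .
qed

lemma sum_primes_vs_mangoldt:
  fixes chi :: "nat \<Rightarrow> real"
  assumes "\<And>n. \<bar>chi n\<bar> \<le> 1"
  shows "\<bar>(\<Sum>p | p \<in> {1..n} \<and> prime p. chi p * ln (real p) / real p) - (\<Sum>d\<in>{1..n}. chi d * mangoldt d / real d)\<bar> \<le> prime_tail"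
proof -
  have "(\<Sum>d\<in>{1..n}. chi d * mangoldt d / real d) =
      (\<Sum>d | d \<in> {1..n} \<and> prime d. chi d * mangoldt d / real d) + (\<Sum>d | d \<in> {1..n} \<and> \<not> prime d. chi d * mangoldt d / real d)"
    by (subst sum.union_disjoint[symmetric]) (auto intro!: sum.cong)
  moreover have "(\<Sum>d | d \<in> {1..n} \<and> prime d. chi d * mangoldt d / real d) = (\<Sum>p | p \<in> {1..n} \<and> prime p. chi p * ln (real p) / real p)"
    by (intro sum.cong) auto
  moreover have "\<bar>\<Sum>d | d \<in> {1..n} \<and> \<not> prime d. chi d * mangoldt d / real d\<bar> \<le> (\<Sum>d | d \<in> {1..n} \<and> \<not> prime d. mangoldt d / real d)"
  proof (rule order_trans[OF sum_abs], rule sum_mono)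
    fix d
    have "\<bar>chi d\<bar> * (mangoldt d / real d) \<le> 1 * (mangoldt d / real d)"
      using assms mangoldt_nonneg[of d] by (intro mult_right_mono) auto
    then show "\<bar>chi d * mangoldt d / real d\<bar> \<le> mangoldt d / real d"
      by (simp add: abs_mult)
  qed
  ultimately show ?thesis using sum_higher_prime_powers_le[of n] by linarith
qed

section \<open>Partial summation and real characters\<close>

lemma summation_by_parts:
  fixes f g :: "nat \<Rightarrow> real"
  shows "(\<Sum>n=a..a+k. f n * g n) = (\<Sum>i=a..a+k. f i) * g (a + k) + (\<Sum>n=a..<a+k. (\<Sum>i=a..n. f i) * (g n - g (Suc n)))"
  by (induction k) (simp_all add: algebra_simps)

lemma abel_bound:
  fixes f g :: "nat \<Rightarrow> real"
  assumes F: "\<And>n. n \<ge> a \<Longrightarrow> \<bar>\<Sum>i=a..n. f i\<bar> \<le> K"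
    and g: "\<And>n. n \<ge> a \<Longrightarrow> g n \<ge> 0" "\<And>n. n \<ge> a \<Longrightarrow> g (Suc n) \<le> g n"
  shows "\<bar>\<Sum>n=a..b. f n * g n\<bar> \<le> K * g a"
proof (cases "a \<le> b")
  case True
  then obtain k where b: "b = a + k" using le_Suc_ex by blast
  have K: "K \<ge> 0" using F[of a] by simp
  have "\<bar>\<Sum>n=a..b. f n * g n\<bar> \<le> \<bar>\<Sum>i=a..a+k. f i\<bar> * g (a + k) + (\<Sum>n=a..<a+k. \<bar>\<Sum>i=a..n. f i\<bar> * (g n - g (Suc n)))"
  proof -
    have "\<bar>(\<Sum>i=a..a+k. f i) * g (a + k)\<bar> = \<bar>\<Sum>i=a..a+k. f i\<bar> * g (a + k)"
      using g(1)[of "a + k"] by (simp add: abs_mult)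
    moreover have "\<bar>\<Sum>n=a..<a+k. (\<Sum>i=a..n. f i) * (g n - g (Suc n))\<bar> \<le> (\<Sum>n=a..<a+k. \<bar>(\<Sum>i=a..n. f i) * (g n - g (Suc n))\<bar>)"
      by (rule sum_abs)
    moreover have "\<dots> = (\<Sum>n=a..<a+k. \<bar>\<Sum>i=a..n. f i\<bar> * (g n - g (Suc n)))"
      using g(2) by (intro sum.cong) (simp_all add: abs_mult)
    ultimately show ?thesis unfolding b summation_by_parts by linarith
  qed
  also have "\<dots> \<le> K * g (a + k) + (\<Sum>n=a..<a+k. K * (g n - g (Suc n)))"
    using F g by (intro add_mono sum_mono mult_right_mono) auto
  also have "\<dots> = K * (g (a + k) + (\<Sum>n=a..<a+k. g n - g (Suc n)))"
    by (simp add: algebra_simps sum_distrib_left)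
  also have "(\<Sum>n=a..<a+k. g n - g (Suc n)) = g a - g (a + k)"
    by (induction k) auto
  finally show ?thesis by simp
next
  case False
  then show ?thesis using F[of a] g by simp
qed

text \<open>A real Dirichlet character in a weak form that does not prescribe its zeros, so that the
  empty product of characters, the constant 1, is an instance.\<close>

locale real_character =
  fixes N :: nat and chi :: "nat \<Rightarrow> real"
  assumes N_pos: "N > 0"
    and one: "chi 1 = 1"
    and mult: "chi (m * n) = chi m * chi n"
    and periodic: "chi (n + N) = chi n"
    and chi_values: "chi n = -1 \<or> chi n = 0 \<or> chi n = 1"
begin

lemma abs_le_1: "\<bar>chi n\<bar> \<le> 1"
  using chi_values[of n] by auto

lemma periodic_mult: "chi (n + k * N) = chi n"
proof (induction k)
  case (Suc k)
  have "chi (n + Suc k * N) = chi ((n + k * N) + N)" by (simp add: algebra_simps)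
  then show ?case using periodic Suc by simp
qed simp

lemma mod_N: "chi (n mod N) = chi n"
  using periodic_mult[of "n mod N" "n div N"] by simp

lemma pow: "chi (m ^ k) = chi m ^ k"
  by (induction k) (use one in \<open>auto simp: mult\<close>)

end

locale nonprincipal_character = real_character +
  fixes a :: nat
  assumes a: "coprime a N" "chi a = -1"
begin

text \<open>Multiplication by \<open>a\<close> permutes the residues modulo \<open>N\<close> and
  changes the sign of the sum.\<close>

lemma sum_period: "(\<Sum>n<N. chi n) = 0"
proof -
  have inj: "inj_on (\<lambda>n. (a * n) mod N) {..<N}"
  proof (rule inj_onI)
    fix x y assume xy: "x \<in> {..<N}" "y \<in> {..<N}" "(a * x) mod N = (a * y) mod N"
    then have "[a * x = a * y] (mod N)" by (simp add: cong_def)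
    then have "[x = y] (mod N)" using a(1) cong_mult_lcancel_nat by blast
    then show "x = y" using xy by (simp add: cong_def)
  qed
  have "(\<lambda>n. (a * n) mod N) ` {..<N} = {..<N}"
    by (rule card_subset_eq) (use N_pos card_image[OF inj] in auto)
  then have "(\<Sum>n<N. chi n) = (\<Sum>n<N. chi ((a * n) mod N))"
    using sum.reindex[OF inj, of chi] by simp
  also have "\<dots> = - (\<Sum>n<N. chi n)" by (simp add: mod_N mult a sum_negf)
  finally show ?thesis by simp
qed

lemma sum_lessThan_bound: "\<bar>\<Sum>n<x. chi n\<bar> \<le> real N"
proof -
  have *: "(\<Sum>n<k * N. chi n) = 0" for k
  proof (induction k)
    case (Suc k)
    have "(\<Sum>n<Suc k * N. chi n) = (\<Sum>n<k * N. chi n) + (\<Sum>n=k * N..<k * N + N. chi n)"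
      by (simp add: add.commute sum.atLeastLessThan_concat flip: atLeast0LessThan)
    also have "(\<Sum>n=k * N..<k * N + N. chi n) = (\<Sum>n<N. chi (n + k * N))"
      using sum.shift_bounds_nat_ivl[of chi 0 "k * N" N] by (simp add: add.commute atLeast0LessThan)
    finally show ?case using Suc sum_period periodic_mult by simp
  qed simp
  define r where "r = x mod N"
  have x: "x = (x div N) * N + r" by (simp add: r_def)
  have "(\<Sum>n<x. chi n) = (\<Sum>n<(x div N) * N. chi n) + (\<Sum>n=(x div N) * N..<(x div N) * N + r. chi n)"
    by (subst x) (simp add: sum.atLeastLessThan_concat flip: atLeast0LessThan)
  also have "(\<Sum>n=(x div N) * N..<(x div N) * N + r. chi n) = (\<Sum>n<r. chi (n + (x div N) * N))"
    using sum.shift_bounds_nat_ivl[of chi 0 "(x div N) * N" r] by (simp add: add.commute atLeast0LessThan)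
  also have "\<dots> = (\<Sum>n<r. chi n)" by (simp only: periodic_mult)
  finally have "\<bar>\<Sum>n<x. chi n\<bar> = \<bar>\<Sum>n<r. chi n\<bar>" using * by simp
  also have "\<dots> \<le> (\<Sum>n<r. \<bar>chi n\<bar>)" by (rule sum_abs)
  also have "\<dots> \<le> (\<Sum>n<r. 1)" by (intro sum_mono abs_le_1)
  also have "\<dots> \<le> real N" using N_pos by (simp add: r_def less_imp_le)
  finally show ?thesis .
qed

lemma sum_bound: "\<bar>\<Sum>n=u..v. chi n\<bar> \<le> 2 * real N"
proof (cases "u \<le> v")
  case True
  then have "(\<Sum>n<u. chi n) + (\<Sum>n=u..v. chi n) = (\<Sum>n<Suc v. chi n)"
    by (simp add: sum.atLeastLessThan_concat flip: atLeast0LessThan atLeastLessThanSuc_atLeastAtMost)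
  then show ?thesis using sum_lessThan_bound[of u] sum_lessThan_bound[of "Suc v"] by linarith
qed auto

lemma sum_over_n_bound:
  assumes "u \<ge> 1" shows "\<bar>\<Sum>n=u..v. chi n / real n\<bar> \<le> 2 * real N / real u"
proof -
  have "\<bar>\<Sum>n=u..v. chi n * (1 / real n)\<bar> \<le> 2 * real N * (1 / real u)"
    using assms by (intro abel_bound sum_bound) (auto simp: frac_le)
  then show ?thesis by simp
qed

definition L1 :: real where "L1 = lim (\<lambda>n. \<Sum>k=1..n. chi k / real k)"

lemma L1_partial: "\<bar>(\<Sum>k=1..n. chi k / real k) - L1\<bar> \<le> 2 * real N / real (Suc n)"
proof -
  define S where "S n = (\<Sum>k=1..n. chi k / real k)" for n
  have diff: "\<bar>S n - S m\<bar> \<le> 2 * real N / real (Suc m)" if "m \<le> n" for m n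
  proof -
    have "S n - S m = (\<Sum>k=Suc m..n. chi k / real k)"
      unfolding S_def using that sum.ub_add_nat[of 1 m "\<lambda>k. chi k / real k" "n - m"] by simp
    then show ?thesis using sum_over_n_bound[of "Suc m" n] by simp
  qed
  have "Cauchy S"
  proof (rule metric_CauchyI)
    fix e :: real assume e: "e > 0"
    obtain M where M: "real M > 4 * real N / e" using reals_Archimedean2 by blast
    have M': "2 * (2 * real N / real (Suc M)) < e"
    proof -
      have "4 * real N < e * real M" using M e by (simp add: field_simps)
      also have "\<dots> \<le> e * real (Suc M)" using e by simp
      finally show ?thesis by (simp add: field_simps)
    qed
    show "\<exists>M. \<forall>m\<ge>M. \<forall>n\<ge>M. dist (S m) (S n) < e"
    proof (intro exI allI impI)
      fix m n assume "m \<ge> M" "n \<ge> M"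
      then show "dist (S m) (S n) < e" using diff[of M m] diff[of M n] M' by (simp add: dist_real_def)
    qed
  qed
  then have "S \<longlonglongrightarrow> L1"
    unfolding L1_def S_def[symmetric] by (simp add: Cauchy_convergent_iff convergent_LIMSEQ_iff)
  then have "(\<lambda>m. \<bar>S m - S n\<bar>) \<longlonglongrightarrow> \<bar>L1 - S n\<bar>" by (intro tendsto_intros)
  moreover have "\<forall>\<^sub>F m in sequentially. \<bar>S m - S n\<bar> \<le> 2 * real N / real (Suc n)"
    using eventually_ge_at_top[of n] by eventually_elim (rule diff)
  ultimately have "\<bar>L1 - S n\<bar> \<le> 2 * real N / real (Suc n)"
    by (intro tendsto_upperbound) auto
  then show ?thesis by (simp add: S_def abs_minus_commute)
qed

end

section \<open>Non-vanishing of the L-value at 1\<close>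

context real_character
begin

definition divisor_sum :: "nat \<Rightarrow> real" where
  "divisor_sum n = (\<Sum>d | d dvd n. chi d)"

lemma divisor_sum_coprime_mult:
  assumes "coprime m n" "m > 0" "n > 0"
  shows "divisor_sum (m * n) = divisor_sum m * divisor_sum n"
proof -
  have "divisor_sum m * divisor_sum n = (\<Sum>(x, y)\<in>{d. d dvd m} \<times> {d. d dvd n}. chi (x * y))"
    by (simp add: divisor_sum_def sum_product sum.cartesian_product mult)
  also have "\<dots> = (\<Sum>d | d dvd m * n. chi d)"
  proof (rule sum.reindex_cong[symmetric, of "\<lambda>(x, y). x * y"])
    have gcd_eq: "gcd (x * y) k = x" if "x dvd k" "coprime y k" for x y k :: nat
    proof -
      from \<open>x dvd k\<close> obtain k' where k': "k = x * k'" by blast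
      then have "coprime y k'" using \<open>coprime y k\<close> by simp
      then show ?thesis unfolding k' gcd_mult_distrib_nat[symmetric] by simp
    qed
    have cop: "coprime y m" "coprime x n" if "x dvd m" "y dvd n" for x y
      using coprime_divisors[OF dvd_refl that(2) assms(1)] coprime_divisors[OF that(1) dvd_refl assms(1)]
      by (simp_all add: coprime_commute)
    have "x = x' \<and> y = y'" if "x dvd m" "y dvd n" "x' dvd m" "y' dvd n" "x * y = x' * y'" for x y x' y'
    proof
      have "gcd (x * y) m = x" "gcd (x' * y') m = x'"
        by (rule gcd_eq; use cop that in blast)+
      then show "x = x'" using that by simp
      have "gcd (y * x) n = y" "gcd (y' * x') n = y'"
        by (rule gcd_eq; use cop that in blast)+
      then show "y = y'" using that by (simp add: mult.commute)
    qed
    note unique = this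
    show "inj_on (\<lambda>(x, y). x * y) ({d. d dvd m} \<times> {d. d dvd n})"
    proof (rule inj_onI)
      fix p p' assume *: "p \<in> {d. d dvd m} \<times> {d. d dvd n}" "p' \<in> {d. d dvd m} \<times> {d. d dvd n}"
        "(case p of (x, y) \<Rightarrow> x * y) = (case p' of (x, y) \<Rightarrow> x * y)"
      obtain x y x' y' where "p = (x, y)" "p' = (x', y')" by (cases p, cases p') blast
      then show "p = p'" using * unique[of x y x' y'] by simp
    qed
    show "{d. d dvd m * n} = (\<lambda>(x, y). x * y) ` ({d. d dvd m} \<times> {d. d dvd n})"
    proof
      show "{d. d dvd m * n} \<subseteq> (\<lambda>(x, y). x * y) ` ({d. d dvd m} \<times> {d. d dvd n})"
      proof
        fix d assume "d \<in> {d. d dvd m * n}"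
        then obtain x y where "d = x * y" "x dvd m" "y dvd n" using division_decomp[of d m n] by blast
        then show "d \<in> (\<lambda>(x, y). x * y) ` ({d. d dvd m} \<times> {d. d dvd n})"
          by (intro image_eqI[of _ _ "(x, y)"]) simp_all
      qed
    qed (auto intro: mult_dvd_mono)
  qed auto
  finally show ?thesis by (simp add: divisor_sum_def)
qed

lemma divisor_sum_prime_power:
  assumes "prime p" shows "divisor_sum (p ^ k) = (\<Sum>i\<le>k. chi p ^ i)"
proof -
  have "{d. d dvd p ^ k} = (\<lambda>i. p ^ i) ` {..k}"
    using assms by (auto simp: divides_primepow_nat)
  moreover have "inj_on (\<lambda>i. p ^ i) {..k}"
    using assms prime_gt_1_nat by (auto intro!: inj_onI)
  ultimately show ?thesis unfolding divisor_sum_def by (simp add: sum.reindex pow)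
qed

lemma alternating_sum: "(\<Sum>i\<le>k. (-1) ^ i) = (if even k then 1 else 0 :: real)"
  by (induction k) auto

lemma divisor_sum_prime_power_nonneg:
  assumes "prime p" shows "divisor_sum (p ^ k) \<ge> 0" "divisor_sum (p ^ (2 * k)) \<ge> 1"
proof -
  have "(\<Sum>i\<le>j. chi p ^ i) \<ge> (if even j then 1 else 0)" for j
  proof -
    consider "chi p = -1" | "chi p = 0" | "chi p = 1" using chi_values by blast
    then show ?thesis
    proof cases
      case 2
      have "(\<Sum>i\<le>j. (0::real) ^ i) = 1" by (induction j) auto
      then show ?thesis using 2 by simp
    qed (simp_all add: alternating_sum)
  qed
  from this[of k] this[of "2 * k"] show "divisor_sum (p ^ k) \<ge> 0" "divisor_sum (p ^ (2 * k)) \<ge> 1"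
    unfolding divisor_sum_prime_power[OF assms] by (auto split: if_splits)
qed

lemma divisor_sum_nonneg: "n > 0 \<Longrightarrow> divisor_sum n \<ge> 0"
proof (induction n rule: less_induct)
  case (less n)
  show ?case
  proof (cases "n = 1")
    case True
    then show ?thesis using one by (simp add: divisor_sum_def)
  next
    case False
    then obtain p where p: "prime p" "p dvd n" using prime_factor_nat by blast
    obtain m where m: "n = p ^ multiplicity p n * m" "\<not> p dvd m"
      using multiplicity_decompose'[of n p] less.prems p(1) by (metis not_prime_unit neq0_conv)
    have m0: "m > 0" using m less.prems by (auto intro: Nat.gr0I)
    have "multiplicity p n > 0" using p less.prems by (simp add: prime_multiplicity_gt_zero_iff)
    then have "p ^ multiplicity p n > 1" using p prime_gt_1_nat by (metis one_less_power)
    then have "m < n" using m0 by (subst m(1)) simp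
    moreover have "coprime (p ^ multiplicity p n) m" using m p by (simp add: prime_imp_coprime)
    ultimately show ?thesis
      using less.IH[of m] m0 divisor_sum_coprime_mult[of "p ^ multiplicity p n" m] p
        divisor_sum_prime_power_nonneg(1)[OF p(1), of "multiplicity p n"] m(1) prime_gt_0_nat[OF p(1)]
      by (metis mult_nonneg_nonneg zero_less_power)
  qed
qed

text \<open>Every power of 4 contributes at least 1, whatever the value of
  \<open>chi 2\<close>.\<close>

lemma divisor_sum_unbounded: "\<exists>M. (\<Sum>n\<in>{1..M}. divisor_sum n) > K"
proof -
  obtain k :: nat where k: "real k > K" using reals_Archimedean2 by blast
  have inj: "inj_on (\<lambda>j. 2 ^ (2 * j) :: nat) {..<k}" by (auto intro!: inj_onI)
  have "real k \<le> (\<Sum>j<k. divisor_sum (2 ^ (2 * j)))"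
    using sum_mono[of "{..<k}" "\<lambda>_. 1" "\<lambda>j. divisor_sum (2 ^ (2 * j))"] divisor_sum_prime_power_nonneg(2)[of 2] by simp
  also have "\<dots> = (\<Sum>n\<in>(\<lambda>j. 2 ^ (2 * j)) ` {..<k}. divisor_sum n)" by (simp add: sum.reindex[OF inj])
  also have "\<dots> \<le> (\<Sum>n\<in>{1..2 ^ (2 * k)}. divisor_sum n)"
    by (intro sum_mono2 divisor_sum_nonneg) (auto intro!: power_increasing)
  finally show ?thesis using k by (intro exI[of _ "2 ^ (2 * k)"]) linarith
qed

end

definition geom :: "real \<Rightarrow> nat \<Rightarrow> real" where
  "geom t n = (\<Sum>i<n. t ^ i)"

lemma geom_eq: "(1 - t) * geom t n = 1 - t ^ n"
  unfolding geom_def by (simp add: one_diff_power_eq)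

text \<open>The arithmetic-geometric inequality applied to the terms with indices \<open>i\<close>
  and \<open>n - i\<close>.\<close>

lemma geom_ge:
  assumes "t > 0" shows "geom (t\<^sup>2) (Suc n) \<ge> real (Suc n) * t ^ n"
proof -
  have "2 * geom (t\<^sup>2) (Suc n) = (\<Sum>i\<le>n. (t\<^sup>2) ^ i) + (\<Sum>i\<le>n. (t\<^sup>2) ^ (n - i))"
    using sum.nat_diff_reindex[of "\<lambda>i. (t\<^sup>2) ^ i" "Suc n"] by (simp add: geom_def lessThan_Suc_atMost)
  also have "\<dots> = (\<Sum>i\<le>n. (t ^ i)\<^sup>2 + (t ^ (n - i))\<^sup>2)"
    by (simp add: sum.distrib power_mult[symmetric] mult.commute)
  also have "\<dots> \<ge> (\<Sum>i\<le>n. 2 * t ^ n)"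
  proof (rule sum_mono)
    fix i assume "i \<in> {..n}"
    then have "t ^ n = t ^ i * t ^ (n - i)" by (simp flip: power_add)
    then show "2 * t ^ n \<le> (t ^ i)\<^sup>2 + (t ^ (n - i))\<^sup>2"
      using sum_squares_bound[of "t ^ i" "t ^ (n - i)"] by simp
  qed
  finally show ?thesis by simp
qed

text \<open>Monsky's coefficient 1/(n (1 - t)) - t^n/(1 - t^n), multiplied by 1 - t.\<close>

definition monsky :: "real \<Rightarrow> nat \<Rightarrow> real" where
  "monsky t n = 1 / real n - t ^ n / geom t n"

lemma geom_pos: "t > 0 \<Longrightarrow> n \<ge> 1 \<Longrightarrow> geom t n > 0"
  unfolding geom_def by (intro sum_pos) (auto simp: lessThan_empty_iff)

lemma monsky_nonneg:
  assumes "0 < t" "t < 1" "n \<ge> 1" shows "monsky t n \<ge> 0"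
proof -
  have "geom t n \<ge> (\<Sum>i<n. t ^ n)"
    unfolding geom_def using assms by (intro sum_mono power_decreasing) auto
  then show ?thesis using geom_pos[of t n] assms by (simp add: monsky_def field_simps)
qed

text \<open>The difference of consecutive fractions t^n / geom t n telescopes to t^n / (geom t n *
  geom t (n + 1)). By \<open>geom_ge\<close> with sqrt t in place of t this is at most 1/(n (n +
  1)), the decrease of 1/n.\<close>

lemma monsky_decreasing:
  assumes t: "0 < t" "t < 1" and n: "n \<ge> 1" shows "monsky t (Suc n) \<le> monsky t n"
proof -
  define s where "s = sqrt t"
  have s: "s > 0" "s < 1" "t = s\<^sup>2" using t by (auto simp: s_def)
  note pos = geom_pos[OF t(1) n] geom_pos[OF t(1), of "Suc n"]
  obtain k where k: "n = Suc k" using n by (cases n) auto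
  have "real n * s ^ k * (real (Suc n) * s ^ n) \<le> geom t n * geom t (Suc n)"
    unfolding s(3) using geom_ge[OF s(1), of k] geom_ge[OF s(1), of n] s k pos[THEN less_imp_le, unfolded s(3)]
    by (intro mult_mono) auto
  moreover have "t ^ n \<le> s ^ k * s ^ n"
    unfolding s(3) power_mult[symmetric] power_add[symmetric] using s k by (intro power_decreasing) auto
  then have "real n * real (Suc n) * t ^ n \<le> real n * real (Suc n) * (s ^ k * s ^ n)"
    by (intro mult_left_mono) auto
  ultimately have le: "real n * real (Suc n) * t ^ n \<le> geom t n * geom t (Suc n)" by (simp add: mult_ac)
  have rec: "geom t (Suc n) = 1 + t * geom t n"
    unfolding geom_def by (subst sum.lessThan_Suc_shift) (simp add: sum_distrib_left)
  have "t ^ n / geom t n - t ^ Suc n / geom t (Suc n) = t ^ n * (geom t (Suc n) - t * geom t n) / (geom t n * geom t (Suc n))"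
    using pos by (simp add: field_simps)
  also have "\<dots> = t ^ n / (geom t n * geom t (Suc n))" unfolding rec by simp
  also have "\<dots> \<le> 1 / (real n * real (Suc n))"
  proof -
    define X G where "X = real n * real (Suc n)" and "G = geom t n * geom t (Suc n)"
    have "X > 0" "G > 0" "X * t ^ n \<le> G" using le pos n by (simp_all add: X_def G_def)
    then have "t ^ n / G \<le> 1 / X" by (simp add: field_simps)
    then show ?thesis unfolding X_def G_def .
  qed
  also have "\<dots> = 1 / real n - 1 / real (Suc n)" using n by (simp add: field_simps)
  finally show ?thesis by (simp add: monsky_def)
qed

lemma ln_over_n_decreasing:
  assumes "n \<ge> 3" shows "ln (real (Suc n)) / real (Suc n) \<le> ln (real n) / real n"
proof -
  have n: "real n \<ge> 3" using assms by simp
  have "exp 1 \<le> real n" using exp_le n by linarith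
  then have "ln (real n) \<ge> 1" using n by (subst ln_ge_iff) auto
  have "ln (real (Suc n)) - ln (real n) = ln (1 + 1 / real n)"
    using n ln_div[of "real (Suc n)" "real n"] by (simp add: add_divide_distrib add.commute)
  also have "\<dots> \<le> 1 / real n" by (intro ln_add_one_self_le_self) auto
  finally have "real n * (ln (real (Suc n)) - ln (real n)) \<le> real n * (1 / real n)" by (intro mult_left_mono) auto
  then have "real n * ln (real (Suc n)) \<le> real n * ln (real n) + 1" using n by (simp add: right_diff_distrib)
  then have "real n * ln (real (Suc n)) \<le> real (Suc n) * ln (real n)"
    using \<open>ln (real n) \<ge> 1\<close> by (simp add: distrib_right)
  then show ?thesis using n by (simp add: divide_simps mult.commute)
qed

context nonprincipal_character
begin

text \<open>Monsky's argument: if \<open>L(1, \<chi>) = 0\<close>, the Lambert series of \<open>\<chi>\<close> would stay bounded as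
  \<open>t \<rightarrow> 1\<close>, whereas its coefficients are nonnegative with unbounded sum.\<close>

lemma lambert_partial:
  assumes t: "0 < t" "t < 1" and L: "L1 = 0" and n: "n \<ge> 1"
  shows "(\<Sum>k\<in>{1..n}. divisor_sum k * t ^ k) \<le> 2 * real N + 2 * real N / (real (Suc n) * (1 - t)) + real n * t ^ n / (1 - t)"
proof -
  have "(\<Sum>k\<in>{1..n}. divisor_sum k * t ^ k) = (\<Sum>k\<in>{1..n}. \<Sum>d | d dvd k. chi d * t ^ (d * (k div d)))"
    unfolding divisor_sum_def sum_distrib_right by (intro sum.cong) auto
  also have "\<dots> = (\<Sum>d\<in>{1..n}. \<Sum>m\<in>{1..n div d}. chi d * t ^ (d * m))"
    by (rule sum_over_divisors[of "\<lambda>d m. chi d * t ^ (d * m)"])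
  also have "\<dots> \<le> (\<Sum>d\<in>{1..n}. chi d * (t ^ d / (1 - t ^ d)) + t ^ n / (1 - t))"
  proof (rule sum_mono)
    fix d assume d: "d \<in> {1..n}"
    define q where "q = n div d"
    have td: "t ^ d < 1" "t ^ d \<le> t" using t d power_decreasing[of 1 d t] by (auto simp: power_Suc_less_one power_less_one_iff)
    have "(\<Sum>m\<in>{1..q}. (t ^ d) ^ m) = (t ^ d - (t ^ d) ^ Suc q) / (1 - t ^ d)"
      using td by (subst sum_gp) auto
    then have "(\<Sum>m\<in>{1..q}. chi d * t ^ (d * m)) = chi d * (t ^ d / (1 - t ^ d)) - chi d * ((t ^ d) ^ Suc q / (1 - t ^ d))"
      by (simp add: power_mult sum_distrib_left[symmetric] diff_divide_distrib right_diff_distrib)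
    \<comment> \<open>Completing the geometric sum costs at most t^n / (1 - t) for each
      \<open>d\<close>. The total error n t^n / (1 - t) tends to 0 as \<open>n\<close>
      grows.\<close>
    moreover have "- chi d * ((t ^ d) ^ Suc q / (1 - t ^ d)) \<le> t ^ n / (1 - t)"
    proof -
      have "n < d * Suc q" unfolding q_def using d dividend_less_times_div[of d n] by simp
      then have "(t ^ d) ^ Suc q \<le> t ^ n" unfolding power_mult[symmetric] using t by (intro power_decreasing) auto
      then have "(t ^ d) ^ Suc q / (1 - t ^ d) \<le> t ^ n / (1 - t)" using td t by (intro frac_le) auto
      moreover have "- chi d * ((t ^ d) ^ Suc q / (1 - t ^ d)) \<le> 1 * ((t ^ d) ^ Suc q / (1 - t ^ d))"
        using abs_le_1[of d] td t by (intro mult_right_mono) auto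
      ultimately show ?thesis by linarith
    qed
    ultimately show "(\<Sum>m\<in>{1..n div d}. chi d * t ^ (d * m)) \<le> chi d * (t ^ d / (1 - t ^ d)) + t ^ n / (1 - t)"
      unfolding q_def by linarith
  qed
  also have "\<dots> = (\<Sum>d\<in>{1..n}. chi d * (t ^ d / (1 - t ^ d))) + real n * t ^ n / (1 - t)"
    by (simp add: sum.distrib)
  \<comment> \<open>In this splitting the sum of chi d / d is small because its limit
    \<open>L1\<close> is 0, and Abel summation bounds the other sum by a multiple of
    \<open>monsky t 1 = 1 - t\<close>, which cancels the denominator.\<close>
  also have "(\<Sum>d\<in>{1..n}. chi d * (t ^ d / (1 - t ^ d))) = ((\<Sum>d\<in>{1..n}. chi d / real d) - (\<Sum>d\<in>{1..n}. chi d * monsky t d)) / (1 - t)"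
  proof -
    have "chi d * (t ^ d / (1 - t ^ d)) = (chi d / real d - chi d * monsky t d) / (1 - t)" if "d \<in> {1..n}" for d
    proof -
      have "(1 - t ^ d) = (1 - t) * geom t d" by (simp add: geom_eq)
      then have "t ^ d / (1 - t ^ d) = t ^ d / geom t d / (1 - t)" by (simp add: mult.commute)
      then show ?thesis by (simp add: monsky_def right_diff_distrib)
    qed
    then show ?thesis by (simp add: sum_divide_distrib[symmetric] sum_subtractf)
  qed
  also have "\<dots> \<le> (2 * real N / real (Suc n) + 2 * real N * (1 - t)) / (1 - t)"
  proof (rule divide_right_mono)
    have "\<bar>\<Sum>d\<in>{1..n}. chi d * monsky t d\<bar> \<le> 2 * real N * monsky t 1"
      using monsky_nonneg[OF t] monsky_decreasing[OF t] by (intro abel_bound sum_bound) auto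
    also have "monsky t 1 = 1 - t" by (simp add: monsky_def geom_def)
    finally show "(\<Sum>d\<in>{1..n}. chi d / real d) - (\<Sum>d\<in>{1..n}. chi d * monsky t d) \<le> 2 * real N / real (Suc n) + 2 * real N * (1 - t)"
      using L1_partial[of n] unfolding L by linarith
  qed (use t in simp)
  also have "\<dots> = 2 * real N + 2 * real N / (real (Suc n) * (1 - t))"
    using t by (simp add: add_divide_distrib del: of_nat_Suc)
  finally show ?thesis by simp
qed

theorem L1_nonzero: "L1 \<noteq> 0"
proof
  assume L: "L1 = 0"
  have bound: "(\<Sum>k\<in>{1..M}. divisor_sum k * t ^ k) \<le> 2 * real N" if t: "0 < t" "t < 1" for M t
  proof (rule tendsto_lowerbound)
    have "(\<lambda>n. real n * t ^ n) \<longlonglongrightarrow> 0" using t by (intro powser_times_n_limit_0) auto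
    then have 1: "(\<lambda>n. real n * t ^ n / (1 - t)) \<longlonglongrightarrow> 0" using tendsto_divide_zero by blast
    have "(\<lambda>n. 2 * real N / (1 - t) * inverse (real (Suc n))) \<longlonglongrightarrow> 2 * real N / (1 - t) * 0"
      by (intro tendsto_intros LIMSEQ_inverse_real_of_nat)
    then have 2: "(\<lambda>n. 2 * real N / (real (Suc n) * (1 - t))) \<longlonglongrightarrow> 0" by (simp add: field_simps)
    show "(\<lambda>n. 2 * real N + 2 * real N / (real (Suc n) * (1 - t)) + real n * t ^ n / (1 - t)) \<longlonglongrightarrow> 2 * real N"
      using tendsto_add[OF tendsto_add[OF tendsto_const 2] 1, of "2 * real N"] by simp
    show "\<forall>\<^sub>F n in sequentially. (\<Sum>k\<in>{1..M}. divisor_sum k * t ^ k) \<le>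
        2 * real N + 2 * real N / (real (Suc n) * (1 - t)) + real n * t ^ n / (1 - t)"
      using eventually_ge_at_top[of "max 1 M"]
    proof eventually_elim
      case (elim n)
      have "(\<Sum>k\<in>{1..M}. divisor_sum k * t ^ k) \<le> (\<Sum>k\<in>{1..n}. divisor_sum k * t ^ k)"
        using elim t by (intro sum_mono2 mult_nonneg_nonneg divisor_sum_nonneg) auto
      then show ?case using lambert_partial[OF t L, of n] elim by simp
    qed
  qed simp
  obtain M where M: "(\<Sum>n\<in>{1..M}. divisor_sum n) > 2 * real N" using divisor_sum_unbounded by blast
  have "((\<lambda>t. \<Sum>k\<in>{1..M}. divisor_sum k * t ^ k) \<longlongrightarrow> (\<Sum>k\<in>{1..M}. divisor_sum k * 1 ^ k)) (at_left 1)"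
    by (intro tendsto_intros)
  moreover have "\<forall>\<^sub>F t in at_left 1. (\<Sum>k\<in>{1..M}. divisor_sum k * t ^ k) \<le> 2 * real N"
    using eventually_at_left_real[OF zero_less_one] by eventually_elim (auto intro: bound simp del: One_nat_def)
  ultimately have "(\<Sum>k\<in>{1..M}. divisor_sum k * 1 ^ k) \<le> 2 * real N"
    by (intro tendsto_upperbound) auto
  then show False using M by simp
qed

lemma sum_ln_bound: "\<exists>C. \<forall>n. \<bar>\<Sum>k=1..n. chi k * ln (real k) / real k\<bar> \<le> C"
proof (intro exI allI)
  fix n
  let ?f = "\<lambda>k. chi k * ln (real k) / real k"
  \<comment> \<open>ln k / k decreases only from 3 on; the terms at 1 and 2 are bounded
    separately.\<close>
  have 3: "\<bar>\<Sum>k=3..n. chi k * (ln (real k) / real k)\<bar> \<le> 2 * real N * (ln (real 3) / real 3)"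
    using ln_over_n_decreasing by (intro abel_bound sum_bound) auto
  have "\<bar>\<Sum>k=1..n. ?f k\<bar> \<le> \<bar>\<Sum>k=1..min n 2. ?f k\<bar> + \<bar>\<Sum>k=3..n. ?f k\<bar>"
  proof -
    have "{1..n} = {1..min n 2} \<union> {3..n}" by auto
    then have "(\<Sum>k=1..n. ?f k) = (\<Sum>k=1..min n 2. ?f k) + (\<Sum>k=3..n. ?f k)"
      by (simp only:) (intro sum.union_disjoint, auto)
    then show ?thesis by linarith
  qed
  also have "\<bar>\<Sum>k=1..min n 2. ?f k\<bar> \<le> (\<Sum>k=1..min n 2. \<bar>?f k\<bar>)" by (rule sum_abs)
  also have "\<dots> \<le> (\<Sum>k=1..2. \<bar>?f k\<bar>)" by (intro sum_mono2) auto
  finally show "\<bar>\<Sum>k=1..n. ?f k\<bar> \<le> (\<Sum>k=1..2. \<bar>?f k\<bar>) + 2 * real N * (ln (real 3) / real 3)"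
    using 3 by simp
qed

text \<open>Convolution writes the bounded sum of chi k ln k / k as a sum over \<open>d\<close> with
  inner sums of chi m / m up to n / d. Each inner sum is \<open>L1\<close> up to 2 N d / n, and the
  accumulated error is bounded by Chebyshev; then one divides by \<open>L1\<close>, which is not
  0.\<close>

lemma mangoldt_character_bound: "\<exists>C. \<forall>n. \<bar>\<Sum>d=1..n. chi d * mangoldt d / real d\<bar> \<le> C"
proof -
  obtain C where C: "\<And>n. \<bar>\<Sum>k=1..n. chi k * ln (real k) / real k\<bar> \<le> C" using sum_ln_bound by blast
  define S where "S n = (\<Sum>d=1..n. chi d * mangoldt d / real d)" for n
  have "\<bar>S n\<bar> \<le> (C + 8 * real N) / \<bar>L1\<bar>" for n
  proof (cases "n = 0")
    case True
    have "C \<ge> 0" using C[of 0] by simp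
    then show ?thesis using True by (simp add: S_def)
  next
    case False
    have "(\<Sum>k\<in>{1..n}. chi k * ln (real k) / real k) =
        (\<Sum>k\<in>{1..n}. \<Sum>d | d dvd k. (chi d * mangoldt d / real d) * (chi (k div d) / real (k div d)))"
    proof (rule sum.cong)
      fix k assume k: "k \<in> {1..n}"
      have "chi k * ln (real k) / real k = (\<Sum>d | d dvd k. chi k / real k * mangoldt d)"
        unfolding sum_distrib_left[symmetric] using k mangoldt_sum[of k, where ?'a = real] by simp
      also have "\<dots> = (\<Sum>d | d dvd k. (chi d * mangoldt d / real d) * (chi (k div d) / real (k div d)))"
      proof (rule sum.cong)
        fix d assume "d \<in> {d. d dvd k}"
        then obtain e where e: "k = d * e" by auto
        then have "d > 0" using k by (auto intro: Nat.gr0I)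
        then show "chi k / real k * mangoldt d = (chi d * mangoldt d / real d) * (chi (k div d) / real (k div d))"
          unfolding e by (simp add: mult)
      qed auto
      finally show "chi k * ln (real k) / real k = \<dots>" .
    qed auto
    also have "\<dots> = (\<Sum>d\<in>{1..n}. \<Sum>m\<in>{1..n div d}. (chi d * mangoldt d / real d) * (chi m / real m))"
      by (rule sum_over_divisors)
    also have "\<dots> = (\<Sum>d\<in>{1..n}. (chi d * mangoldt d / real d) * (\<Sum>m\<in>{1..n div d}. chi m / real m))"
      by (simp add: sum_distrib_left)
    finally have eq: "(\<Sum>k\<in>{1..n}. chi k * ln (real k) / real k) = \<dots>" .
    have "\<bar>(\<Sum>k\<in>{1..n}. chi k * ln (real k) / real k) - S n * L1\<bar> =
        \<bar>\<Sum>d\<in>{1..n}. (chi d * mangoldt d / real d) * ((\<Sum>m\<in>{1..n div d}. chi m / real m) - L1)\<bar>"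
      unfolding eq S_def by (simp add: right_diff_distrib sum_subtractf sum_distrib_right)
    also have "\<dots> \<le> (\<Sum>d\<in>{1..n}. 2 * real N / real n * mangoldt d)"
    proof (rule order_trans[OF sum_abs], rule sum_mono)
      fix d assume d: "d \<in> {1..n}"
      have "real n \<le> real d * real (Suc (n div d))"
        using real_nat_div_bounds(2)[of n d] d by (simp add: field_simps)
      then have "real N * 2 * real n \<le> real N * 2 * (real d * real (Suc (n div d)))" by (intro mult_left_mono) auto
      then have "2 * real N / real (Suc (n div d)) \<le> 2 * real N / real n * real d"
        using d by (simp add: divide_simps mult_ac del: of_nat_Suc)
      then have *: "\<bar>(\<Sum>m\<in>{1..n div d}. chi m / real m) - L1\<bar> \<le> 2 * real N / real n * real d"
        using L1_partial[of "n div d"] by linarith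
      have "\<bar>chi d * mangoldt d / real d\<bar> \<le> mangoldt d / real d"
        using abs_le_1[of d] mangoldt_nonneg[of d] mult_right_mono[of "\<bar>chi d\<bar>" 1 "mangoldt d"]
        by (auto simp: abs_mult intro!: divide_right_mono)
      then have "\<bar>chi d * mangoldt d / real d\<bar> * \<bar>(\<Sum>m\<in>{1..n div d}. chi m / real m) - L1\<bar> \<le>
          mangoldt d / real d * (2 * real N / real n * real d)"
        using * by (intro mult_mono) (auto simp: mangoldt_nonneg)
      also have "\<dots> = 2 * real N / real n * mangoldt d" using d by simp
      finally show "\<bar>chi d * mangoldt d / real d * ((\<Sum>m\<in>{1..n div d}. chi m / real m) - L1)\<bar> \<le> \<dots>"
        unfolding abs_mult .
    qed
    also have "\<dots> = 2 * real N / real n * chebyshev_psi n" by (simp add: chebyshev_psi_def sum_distrib_left)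
    also have "\<dots> \<le> 2 * real N / real n * (4 * real n)" by (intro mult_left_mono chebyshev_psi_le) auto
    also have "\<dots> = 8 * real N" using False by simp
    finally have "\<bar>S n * L1\<bar> \<le> C + 8 * real N" using C[of n] by linarith
    then show ?thesis using L1_nonzero by (simp add: abs_mult pos_le_divide_eq)
  qed
  then show ?thesis unfolding S_def by blast
qed

lemma mertens_character: "\<exists>C. \<forall>n. \<bar>\<Sum>p | p \<in> {1..n} \<and> prime p. chi p * ln (real p) / real p\<bar> \<le> C"
proof -
  obtain C where C: "\<And>n. \<bar>\<Sum>d\<in>{1..n}. chi d * mangoldt d / real d\<bar> \<le> C" using mangoldt_character_bound by blast
  show ?thesis
  proof (intro exI allI)
    fix n show "\<bar>\<Sum>p | p \<in> {1..n} \<and> prime p. chi p * ln (real p) / real p\<bar> \<le> C + prime_tail"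
      using C[of n] sum_primes_vs_mangoldt[of chi n, OF abs_le_1] by linarith
  qed
qed

end

lemma mertens_primes:
  "\<exists>C. \<forall>n\<ge>1. \<bar>(\<Sum>p | p \<in> {1..n} \<and> prime p. ln (real p) / real p) - ln (real n)\<bar> \<le> C"
proof (intro exI allI impI)
  fix n :: nat assume "n \<ge> 1"
  then show "\<bar>(\<Sum>p | p \<in> {1..n} \<and> prime p. ln (real p) / real p) - ln (real n)\<bar> \<le> 4 + prime_tail"
    using mertens_mangoldt[of n] sum_primes_vs_mangoldt[of "\<lambda>_. 1" n] by simp
qed

section \<open>Primes selected by independent characters\<close>

lemma real_character_prod:
  assumes "finite T" "N > 0" "\<And>i. i \<in> T \<Longrightarrow> real_character N (chi i)"
  shows "real_character N (\<lambda>n. \<Prod>i\<in>T. chi i n)"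
  using assms
proof (induction T rule: finite_induct)
  case empty
  then show ?case by unfold_locales auto
next
  case (insert j T)
  interpret A: real_character N "chi j" using insert by simp
  interpret B: real_character N "\<lambda>n. \<Prod>i\<in>T. chi i n" using insert by simp
  show ?case
  proof
    fix m n :: nat
    show "(\<Prod>i\<in>insert j T. chi i (m * n)) = (\<Prod>i\<in>insert j T. chi i m) * (\<Prod>i\<in>insert j T. chi i n)"
      using insert A.mult[of m n] B.mult[of m n] by simp
    show "(\<Prod>i\<in>insert j T. chi i (n + N)) = (\<Prod>i\<in>insert j T. chi i n)"
      using insert A.periodic[of n] B.periodic[of n] by simp
    show "(\<Prod>i\<in>insert j T. chi i n) = -1 \<or> (\<Prod>i\<in>insert j T. chi i n) = 0 \<or> (\<Prod>i\<in>insert j T. chi i n) = 1"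
      using insert A.chi_values[of n] B.chi_values[of n] by auto
  qed (use insert A.one B.one in auto)
qed

text \<open>Independence is expressed as non-principality of each product over a nonempty subfamily,
  which is exactly what Mertens' estimate for characters consumes.\<close>

locale character_family =
  fixes N :: nat and I :: "'i set" and chi :: "'i \<Rightarrow> nat \<Rightarrow> real"
  assumes N_pos: "N > 0" and fin: "finite I"
    and chars: "\<And>i. i \<in> I \<Longrightarrow> real_character N (chi i)"
    and nonzero: "\<And>i p. i \<in> I \<Longrightarrow> prime p \<Longrightarrow> \<not> p dvd N \<Longrightarrow> chi i p \<noteq> 0"
    and independent: "\<And>T. T \<subseteq> I \<Longrightarrow> T \<noteq> {} \<Longrightarrow> \<exists>a. coprime a N \<and> (\<Prod>i\<in>T. chi i a) = -1"
begin

lemma mertens_prod: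
  assumes "T \<subseteq> I"
  shows "\<exists>C. \<forall>n\<ge>1. \<bar>(\<Sum>p | p \<in> {1..n} \<and> prime p. (\<Prod>i\<in>T. chi i p) * ln (real p) / real p) - (if T = {} then ln (real n) else 0)\<bar> \<le> C"
proof (cases "T = {}")
  case True
  then show ?thesis using mertens_primes by simp
next
  case False
  have finT: "finite T" using assms fin finite_subset by blast
  obtain a where a: "coprime a N" "(\<Prod>i\<in>T. chi i a) = -1" using independent[OF assms False] by blast
  interpret real_character N "\<lambda>n. \<Prod>i\<in>T. chi i n"
    using real_character_prod[OF finT N_pos] chars assms by blast
  interpret nonprincipal_character N "\<lambda>n. \<Prod>i\<in>T. chi i n" a
    by unfold_locales (use a in auto)
  show ?thesis using mertens_character False by auto
qed

text \<open>Expansion of the product of the factors 1 + chi i p, each of which is 0 or 2.\<close>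

lemma indicator_eq:
  assumes "prime p" "\<not> p dvd N"
  shows "(\<Sum>T\<in>Pow I. \<Prod>i\<in>T. chi i p) = (if \<forall>i\<in>I. chi i p = 1 then 2 ^ card I else 0)"
proof -
  have "(\<Sum>T\<in>Pow I. \<Prod>i\<in>T. chi i p) = (\<Prod>i\<in>I. chi i p + 1)"
    using prod_add[OF fin, of "\<lambda>i. chi i p" "\<lambda>_. 1"] by simp
  also have "\<dots> = (if \<forall>i\<in>I. chi i p = 1 then 2 ^ card I else 0)"
  proof (cases "\<forall>i\<in>I. chi i p = 1")
    case True
    then show ?thesis by (simp add: prod.cong[of I I "\<lambda>i. chi i p + 1" "\<lambda>_. 2"])
  next
    case False
    then obtain i where i: "i \<in> I" "chi i p \<noteq> 1" by blast
    interpret real_character N "chi i" using chars i by blast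
    have "chi i p = -1" using chi_values[of p] nonzero[OF i(1) assms] i by auto
    then have "chi i p + 1 = 0" by simp
    then have "(\<Prod>i\<in>I. chi i p + 1) = 0" using i(1) fin by (intro prod_zero) auto
    then show ?thesis using False by simp
  qed
  finally show ?thesis .
qed

text \<open>Of the 2^|I| products in the expanded indicator only the empty one contributes a
  logarithm. The finite set \<open>F\<close> removes the primes at which characters may vanish, at
  bounded cost.\<close>

lemma mertens_family:
  assumes F: "finite F" "\<And>p. prime p \<Longrightarrow> p dvd N \<Longrightarrow> p \<in> F"
  shows "\<exists>C. \<forall>n\<ge>1. \<bar>(\<Sum>p | p \<in> {1..n} \<and> prime p \<and> p \<notin> F \<and> (\<forall>i\<in>I. chi i p = 1). ln (real p) / real p)
      - ln (real n) / 2 ^ card I\<bar> \<le> C"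
proof -
  define X where "X T p = (\<Prod>i\<in>T. chi i p)" for T p
  define lp where "lp p = ln (real p) / real p" for p
  have "\<forall>T\<in>Pow I. \<exists>C. \<forall>n\<ge>1. \<bar>(\<Sum>p | p \<in> {1..n} \<and> prime p. X T p * lp p) - (if T = {} then ln (real n) else 0)\<bar> \<le> C"
    using mertens_prod by (auto simp: X_def lp_def)
  then obtain C where C: "\<And>T n. T \<subseteq> I \<Longrightarrow> n \<ge> 1 \<Longrightarrow>
      \<bar>(\<Sum>p | p \<in> {1..n} \<and> prime p. X T p * lp p) - (if T = {} then ln (real n) else 0)\<bar> \<le> C T"
    by (metis PowI)
  have X_le: "\<bar>X T p\<bar> \<le> 1" if "T \<subseteq> I" for T p
    using real_character.abs_le_1[OF real_character_prod[of T N chi]] that fin N_pos chars finite_subset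
    unfolding X_def by blast
  define CF where "CF = (\<Sum>p\<in>F. \<bar>lp p\<bar>)"
  have bound: "\<bar>(\<Sum>p | p \<in> {1..n} \<and> prime p \<and> p \<notin> F. X T p * lp p) - (if T = {} then ln (real n) else 0)\<bar> \<le> C T + CF"
    if T: "T \<subseteq> I" and n: "n \<ge> 1" for T n
  proof -
    have "(\<Sum>p | p \<in> {1..n} \<and> prime p. X T p * lp p) =
        (\<Sum>p | p \<in> {1..n} \<and> prime p \<and> p \<notin> F. X T p * lp p) + (\<Sum>p | p \<in> {1..n} \<and> prime p \<and> p \<in> F. X T p * lp p)"
      by (subst sum.union_disjoint[symmetric]) (auto intro!: sum.cong)
    moreover have "\<bar>\<Sum>p | p \<in> {1..n} \<and> prime p \<and> p \<in> F. X T p * lp p\<bar> \<le> CF"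
    proof -
      have "\<bar>\<Sum>p | p \<in> {1..n} \<and> prime p \<and> p \<in> F. X T p * lp p\<bar> \<le> (\<Sum>p | p \<in> {1..n} \<and> prime p \<and> p \<in> F. \<bar>lp p\<bar>)"
      proof (rule order_trans[OF sum_abs], rule sum_mono)
        fix p show "\<bar>X T p * lp p\<bar> \<le> \<bar>lp p\<bar>"
          using mult_right_mono[OF X_le[OF T, of p], of "\<bar>lp p\<bar>"] by (simp add: abs_mult)
      qed
      also have "\<dots> \<le> CF" unfolding CF_def by (intro sum_mono2 F) auto
      finally show ?thesis .
    qed
    ultimately show ?thesis using C[OF T n] by linarith
  qed
  have "\<bar>(\<Sum>p | p \<in> {1..n} \<and> prime p \<and> p \<notin> F \<and> (\<forall>i\<in>I. chi i p = 1). lp p) - ln (real n) / 2 ^ card I\<bar>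
      \<le> (\<Sum>T\<in>Pow I. C T + CF) / 2 ^ card I" if n: "n \<ge> 1" for n
  proof -
    let ?P = "{p. p \<in> {1..n} \<and> prime p \<and> p \<notin> F}"
    have "(\<Sum>p | p \<in> {1..n} \<and> prime p \<and> p \<notin> F \<and> (\<forall>i\<in>I. chi i p = 1). lp p) =
        (\<Sum>p\<in>?P. (if \<forall>i\<in>I. chi i p = 1 then 2 ^ card I else 0) / 2 ^ card I * lp p)"
      by (rule sum.mono_neutral_cong_left) auto
    also have "\<dots> = (\<Sum>p\<in>?P. (\<Sum>T\<in>Pow I. X T p) / 2 ^ card I * lp p)"
    proof (rule sum.cong)
      fix p assume "p \<in> ?P"
      then have "prime p" "\<not> p dvd N" using F(2) by auto
      from indicator_eq[OF this] show "(if \<forall>i\<in>I. chi i p = 1 then 2 ^ card I else 0) / 2 ^ card I * lp p =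
          (\<Sum>T\<in>Pow I. X T p) / 2 ^ card I * lp p" unfolding X_def by simp
    qed simp
    also have "\<dots> = (\<Sum>T\<in>Pow I. \<Sum>p\<in>?P. X T p * lp p) / 2 ^ card I"
      by (subst sum.swap) (simp add: sum_distrib_right sum_divide_distrib)
    finally have 1: "(\<Sum>p | p \<in> {1..n} \<and> prime p \<and> p \<notin> F \<and> (\<forall>i\<in>I. chi i p = 1). lp p) = \<dots>" .
    have "ln (real n) = (\<Sum>T\<in>Pow I. if T = {} then ln (real n) else 0)"
      using fin by (simp add: sum.delta)
    then have 2: "ln (real n) / 2 ^ card I = (\<Sum>T\<in>Pow I. if T = {} then ln (real n) else 0) / 2 ^ card I" by simp
    have "\<bar>(\<Sum>T\<in>Pow I. \<Sum>p\<in>?P. X T p * lp p) - (\<Sum>T\<in>Pow I. if T = {} then ln (real n) else 0)\<bar> \<le> (\<Sum>T\<in>Pow I. C T + CF)"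
      unfolding sum_subtractf[symmetric]
      by (rule order_trans[OF sum_abs], rule sum_mono) (use bound n in auto)
    then show ?thesis unfolding 1 unfolding 2 diff_divide_distrib[symmetric]
      by (simp add: abs_divide divide_right_mono)
  qed
  then show ?thesis unfolding lp_def by blast
qed

end

section \<open>Square-free numbers composed of a dense set of primes\<close>

text \<open>With \<open>J(x) = \<integral>\<^sub>1\<^sup>x T(t)/t dt\<close>, the hypothesis says that \<open>J(x) / (ln x + C)\<^bsup>1 + \<delta>\<^esup>\<close> is increasing.\<close>

lemma log_average_lower_bound:
  fixes a :: "nat \<Rightarrow> real" and \<delta> C :: real
  assumes a: "\<And>m. a m \<ge> 0" "a 1 > 0" and \<delta>: "\<delta> > 0" and C: "C \<ge> 0"
    and ineq: "\<And>n. n \<ge> 1 \<Longrightarrow> (1 + \<delta>) * (\<Sum>m=1..n. a m * ln (real m)) \<ge> (\<delta> * ln (real n) - C) * (\<Sum>m=1..n. a m)"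
  shows "\<exists>c>0. \<forall>n\<ge>2. (\<Sum>m=1..n. a m) \<ge> c * ln (real n) powr \<delta>"
proof -
  define T where "T n = (\<Sum>m=1..n. a m)" for n
  define Lg where "Lg n = (\<Sum>m=1..n. a m * ln (real m))" for n
  define J where "J n x = T n * ln x - Lg n" for n x
  \<comment> \<open>The extra \<delta> pays for replacing ln n by ln x on [n, n + 1], where they
    differ by at most 1.\<close>
  define K where "K = C + \<delta>"
  define h where "h n x = J n x * (ln x + K) powr (- (1 + \<delta>))" for n x
  have K: "K > 0" using \<delta> C by (simp add: K_def)
  have T_nonneg: "T n \<ge> 0" for n unfolding T_def by (intro sum_nonneg a)
  \<comment> \<open>The new term enters with the factor ln (n + 1) - ln (n + 1) = 0, so the pieces
    \<open>J n\<close> join continuously.\<close>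
  have J_Suc: "J (Suc n) (real (Suc n)) = J n (real (Suc n))" for n
    by (simp add: J_def T_def Lg_def algebra_simps)
  have key: "T n * (ln x + K) \<ge> (1 + \<delta>) * J n x" if n: "n \<ge> 1" and x: "real n \<le> x" "x \<le> real (Suc n)" for n x
  proof -
    have "ln x \<le> ln (2 * real n)" using n x by (subst ln_le_cancel_iff) auto
    also have "\<dots> = ln 2 + ln (real n)" using n by (simp add: ln_mult)
    also have "\<dots> \<le> ln (real n) + 1" using ln2_le_25_over_36 by simp
    finally have "\<delta> * ln x \<le> \<delta> * (ln (real n) + 1)" using \<delta> by (intro mult_left_mono) auto
    then have "\<delta> * ln x \<le> \<delta> * ln (real n) + \<delta>" by (simp add: distrib_left)
    then have "(\<delta> * ln x - K) * T n \<le> (\<delta> * ln (real n) - C) * T n"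
      using T_nonneg by (intro mult_right_mono) (auto simp: K_def)
    also have "\<dots> \<le> (1 + \<delta>) * Lg n" using ineq[OF n] by (simp add: T_def Lg_def)
    finally show ?thesis by (simp add: J_def algebra_simps)
  qed
  have mono: "h n (real n) \<le> h n (real (Suc n))" if n: "n \<ge> 1" for n
  proof (rule DERIV_nonneg_imp_nondecreasing[where f = "h n"])
    fix x assume x: "real n \<le> x" "x \<le> real (Suc n)"
    have x1: "x \<ge> 1" using x n by simp
    have pos: "ln x + K > 0" using x1 K by (simp add: add_nonneg_pos)
    define D where "D = T n / x * (ln x + K) powr (- (1 + \<delta>)) + J n x * (- (1 + \<delta>) * (ln x + K) powr (- (1 + \<delta>) - 1) * (1 / x))"
    have "(h n has_real_derivative D) (at x)"
      unfolding h_def J_def D_def using x1 pos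
      by (auto intro!: derivative_eq_intros simp: field_simps)
    moreover have "D = (ln x + K) powr (- (1 + \<delta>) - 1) / x * (T n * (ln x + K) - (1 + \<delta>) * J n x)"
    proof -
      define g where "g = (ln x + K) powr (- (1 + \<delta>) - 1)"
      have "(ln x + K) powr (- (1 + \<delta>)) = (ln x + K) * g"
        unfolding g_def using pos powr_add[of "ln x + K" 1 "- (1 + \<delta>) - 1"] by simp
      then show ?thesis unfolding D_def g_def[symmetric] using x1 by (simp add: field_simps)
    qed
    then have "D \<ge> 0" using key[OF n x] x1 by simp
    ultimately show "\<exists>y. (h n has_real_derivative y) (at x) \<and> y \<ge> 0" by blast
  qed simp
  \<comment> \<open>The comparison starts at 2, since J vanishes at 1.\<close>
  have incr: "h n (real n) \<ge> h 2 2" if "n \<ge> 2" for n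
    using that
  proof (induction n rule: dec_induct)
    case (step n)
    have "h (Suc n) (real (Suc n)) = h n (real (Suc n))" unfolding h_def J_Suc ..
    then show ?case using mono[of n] step by simp
  qed simp
  have "{1..2} = {1::nat, 2}" by auto
  then have "J 2 2 = a 1 * ln 2" by (simp add: J_def T_def Lg_def algebra_simps)
  then have "J 2 2 > 0" using a(2) by simp
  moreover have "ln (2 :: real) + K > 0" using K by (intro add_pos_pos) auto
  ultimately have h2: "h 2 2 > 0" unfolding h_def by (intro mult_pos_pos) auto
  show ?thesis
  proof (intro exI[of _ "(1 + \<delta>) * h 2 2"] conjI allI impI)
    show "(1 + \<delta>) * h 2 2 > 0" using h2 \<delta> by simp
    fix n :: nat assume n: "n \<ge> 2"
    have ln_pos: "ln (real n) > 0" using n by simp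
    then have pos: "ln (real n) + K > 0" using K by simp
    have "h 2 2 * (ln (real n) + K) powr (1 + \<delta>) \<le> h n (real n) * (ln (real n) + K) powr (1 + \<delta>)"
      using incr[OF n] by (intro mult_right_mono) auto
    also have "\<dots> = J n (real n)"
    proof -
      have "(ln (real n) + K) powr (- (1 + \<delta>)) * (ln (real n) + K) powr (1 + \<delta>) = 1"
        using pos by (simp flip: powr_add)
      then show ?thesis unfolding h_def by (simp only: mult.assoc mult_1_right)
    qed
    finally have "(1 + \<delta>) * (h 2 2 * (ln (real n) + K) powr (1 + \<delta>)) \<le> (1 + \<delta>) * J n (real n)"
      using \<delta> by (intro mult_left_mono) auto
    also have "\<dots> \<le> T n * (ln (real n) + K)" using key[of n "real n"] n by simp
    finally have "(1 + \<delta>) * h 2 2 * (ln (real n) + K) powr \<delta> * (ln (real n) + K) \<le> T n * (ln (real n) + K)"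
      using pos by (simp add: powr_add mult_ac)
    then have "(1 + \<delta>) * h 2 2 * (ln (real n) + K) powr \<delta> \<le> T n" using pos by simp
    moreover have "ln (real n) powr \<delta> \<le> (ln (real n) + K) powr \<delta>"
      using ln_pos K \<delta> by (intro powr_mono2) auto
    then have "(1 + \<delta>) * h 2 2 * ln (real n) powr \<delta> \<le> (1 + \<delta>) * h 2 2 * (ln (real n) + K) powr \<delta>"
      using h2 \<delta> by (intro mult_left_mono) auto
    ultimately show "(1 + \<delta>) * h 2 2 * ln (real n) powr \<delta> \<le> (\<Sum>m=1..n. a m)" unfolding T_def by linarith
  qed
qed

section \<open>Counting square-free products of the selected primes\<close>

definition squarefree_over :: "nat set \<Rightarrow> nat set" where
  "squarefree_over S = {m. squarefree m \<and> (\<forall>p. prime p \<longrightarrow> p dvd m \<longrightarrow> p \<in> S)}"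

lemma squarefree_over_pos: "m \<in> squarefree_over S \<Longrightarrow> m > 0"
  by (auto simp: squarefree_over_def intro: Nat.gr0I)

lemma squarefree_over_mult_prime:
  assumes "m \<in> squarefree_over S" "p \<in> S" "prime p" "\<not> p dvd m"
  shows "m * p \<in> squarefree_over S"
proof -
  have "coprime m p" using assms(3,4) by (metis prime_imp_coprime coprime_commute)
  then have "squarefree (m * p)"
    using assms(1,3) squarefree_prime by (intro squarefree_mult_coprime) (auto simp: squarefree_over_def)
  moreover have "r \<in> S" if "prime r" "r dvd m * p" for r
    using that assms by (auto simp: squarefree_over_def prime_dvd_mult_iff dest: primes_dvd_imp_eq)
  ultimately show ?thesis by (auto simp: squarefree_over_def)
qed

lemma squarefree_over_div_prime:
  assumes "m \<in> squarefree_over S" "prime p" "p dvd m"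
  shows "m div p \<in> squarefree_over S" "\<not> p dvd m div p" "p \<in> S"
proof -
  obtain k where k: "m = p * k" using assms(3) by blast
  have kp: "m div p = k" using k assms(2) prime_gt_0_nat by simp
  show "m div p \<in> squarefree_over S"
    using assms(1) squarefree_multD[of p k] prime_gt_0_nat[OF assms(2)] unfolding kp k by (auto simp: squarefree_over_def)
  show "\<not> p dvd m div p"
  proof
    assume "p dvd m div p"
    then obtain l where "k = p * l" unfolding kp by blast
    then have "m = p\<^sup>2 * l" using k by (simp add: power2_eq_square)
    then have "p\<^sup>2 dvd m" by simp
    moreover have "squarefree m" using assms(1) by (simp add: squarefree_over_def)
    ultimately have "p dvd 1" using squarefreeD by blast
    then show False using assms(2) not_prime_unit by blast
  qed
  show "p \<in> S" using assms by (auto simp: squarefree_over_def)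
qed

lemma ln_squarefree:
  assumes "m \<in> squarefree_over S"
  shows "ln (real m) = (\<Sum>p\<in>prime_factors m. ln (real p))"
proof -
  have m: "m > 0" "squarefree m" using assms squarefree_over_pos by (auto simp: squarefree_over_def)
  have "m = (\<Prod>p\<in>prime_factors m. p ^ multiplicity p m)" using m by (simp add: prime_factorization_nat)
  also have "\<dots> = (\<Prod>p\<in>prime_factors m. p)"
    using m squarefree_factorial_semiring'[of m] by (intro prod.cong) auto
  finally have eq: "m = (\<Prod>p\<in>prime_factors m. p)" .
  have "ln (real m) = ln (real (\<Prod>p\<in>prime_factors m. p))" by (rule arg_cong[OF eq])
  also have "\<dots> = ln (\<Prod>p\<in>prime_factors m. real p)" by (simp only: of_nat_prod)
  also have "\<dots> = (\<Sum>p\<in>prime_factors m. ln (real p))"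
    by (rule ln_prod) (auto simp: in_prime_factors_iff prime_gt_0_nat)
  finally show ?thesis .
qed

lemma real_div_half: "1 \<le> m \<Longrightarrow> m \<le> n \<Longrightarrow> real n / real m \<le> 2 * real (n div m)"
  using real_nat_div_bounds(2)[of n m] div_greater_zero_iff[of n m] by linarith

locale dense_prime_set =
  fixes S :: "nat set" and \<delta> C :: real
  assumes S_prime: "\<And>p. p \<in> S \<Longrightarrow> prime p"
    and \<delta>_pos: "\<delta> > 0"
    and mertens: "\<And>n. n \<ge> 1 \<Longrightarrow> \<bar>(\<Sum>p | p \<in> {1..n} \<and> p \<in> S. ln (real p) / real p) - \<delta> * ln (real n)\<bar> \<le> C"
begin

definition Q :: "nat \<Rightarrow> nat set" where
  "Q n = {m \<in> {1..n}. m \<in> squarefree_over S}"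

lemma finite_Q [simp]: "finite (Q n)" by (simp add: Q_def)

lemma C_nonneg: "C \<ge> 0" using mertens[of 1] by auto

text \<open>The substitution of m p for m; square-freeness of the product is the condition that
  \<open>p\<close> does not divide \<open>m\<close>.\<close>

lemma sum_over_prime_factors:
  fixes h :: "nat \<Rightarrow> nat \<Rightarrow> real"
  shows "(\<Sum>m\<in>Q n. \<Sum>p\<in>prime_factors m. h p (m div p)) = (\<Sum>m\<in>Q n. \<Sum>p | p \<in> {1..n div m} \<and> p \<in> S \<and> \<not> p dvd m. h p m)"
proof -
  have "(\<Sum>m\<in>Q n. \<Sum>p\<in>prime_factors m. h p (m div p)) = (\<Sum>(m, p)\<in>(SIGMA m:Q n. prime_factors m). h p (m div p))"
    by (intro sum.Sigma) auto
  also have "\<dots> = (\<Sum>(m, p)\<in>(SIGMA m:Q n. {p. p \<in> {1..n div m} \<and> p \<in> S \<and> \<not> p dvd m}). h p m)"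
  proof (rule sum.reindex_bij_witness[of _ "\<lambda>(m, p). (m * p, p)" "\<lambda>(m, p). (m div p, p)"], goal_cases)
    case (1 x)
    then show ?case by (auto simp: in_prime_factors_iff)
  next
    case (2 x)
    then obtain m p where x: "x = (m, p)" "m \<in> Q n" "prime p" "p dvd m" by (auto simp: in_prime_factors_iff)
    then obtain k where k: "m = p * k" by blast
    have p: "p > 0" using x prime_gt_0_nat by blast
    have m: "m \<in> squarefree_over S" "m \<le> n" using x by (auto simp: Q_def)
    have "k > 0" using squarefree_over_pos[OF m(1)] k by (auto intro: Nat.gr0I)
    have "k \<le> n" using m(2) k p by (metis le_trans mult.commute mult_le_mono2 mult.right_neutral Suc_leI One_nat_def)
    moreover have "p \<le> n div k" using m(2) k \<open>k > 0\<close> by (simp add: less_eq_div_iff_mult_less_eq)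
    ultimately show ?case
      using squarefree_over_div_prime[OF m(1) x(3,4)] x k p \<open>k > 0\<close> by (auto simp: Q_def)
  next
    case (3 x)
    then show ?case using S_prime prime_gt_0_nat by (auto simp: Q_def)
  next
    case (4 x)
    then obtain m p where x: "x = (m, p)" "m \<in> Q n" "p \<in> {1..n div m}" "p \<in> S" "\<not> p dvd m" by auto
    then have "m \<in> squarefree_over S" "m > 0" by (auto simp: Q_def)
    moreover from this have "m * p \<le> n" using x by (simp add: less_eq_div_iff_mult_less_eq mult.commute)
    moreover have "m * p \<in> squarefree_over S" using squarefree_over_mult_prime x S_prime calculation by blast
    ultimately show ?case using x S_prime squarefree_over_pos[of "m * p" S]
      by (auto simp: Q_def in_prime_factors_iff)
  qed (auto simp: in_prime_factors_iff)
  also have "\<dots> = (\<Sum>m\<in>Q n. \<Sum>p | p \<in> {1..n div m} \<and> p \<in> S \<and> \<not> p dvd m. h p m)"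
    by (intro sum.Sigma[symmetric]) auto
  finally show ?thesis .
qed

definition T :: "nat \<Rightarrow> real" where "T n = (\<Sum>m\<in>Q n. 1 / real m)"

lemma T_nonneg: "T n \<ge> 0" unfolding T_def by (intro sum_nonneg) auto

text \<open>Writing m = p m' turns a term into ln p / p^2 times 1 / m', and the sum over
  \<open>p\<close> converges. So the condition that \<open>p\<close> does not divide
  \<open>m\<close> costs only a multiple of \<open>T n\<close>.\<close>

lemma sum_dividing_primes_le:
  "(\<Sum>m\<in>Q n. 1 / real m * (\<Sum>p | p \<in> {1..n div m} \<and> p \<in> S \<and> p dvd m. ln (real p) / real p)) \<le> 2 * prime_tail * T n"
proof -
  have "(\<Sum>m\<in>Q n. 1 / real m * (\<Sum>p | p \<in> {1..n div m} \<and> p \<in> S \<and> p dvd m. ln (real p) / real p)) \<le>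
      (\<Sum>m\<in>Q n. \<Sum>p\<in>prime_factors m. ln (real p) / real p ^ 2 * (1 / real (m div p)))"
  proof (rule sum_mono)
    fix m assume m: "m \<in> Q n"
    then have m0: "m > 0" using squarefree_over_pos by (auto simp: Q_def)
    have "1 / real m * (\<Sum>p | p \<in> {1..n div m} \<and> p \<in> S \<and> p dvd m. ln (real p) / real p)
        \<le> 1 / real m * (\<Sum>p\<in>prime_factors m. ln (real p) / real p)"
      using S_prime m0 by (intro mult_left_mono sum_mono2) (auto simp: in_prime_factors_iff prime_gt_0_nat Suc_leI)
    also have "\<dots> = (\<Sum>p\<in>prime_factors m. ln (real p) / real p ^ 2 * (1 / real (m div p)))"
      unfolding sum_distrib_left
    proof (rule sum.cong)
      fix p assume "p \<in> prime_factors m"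
      then have "prime p" "p dvd m" by (auto simp: in_prime_factors_iff)
      then obtain k where "m = p * k" "p > 0" using prime_gt_0_nat by blast
      then show "1 / real m * (ln (real p) / real p) = ln (real p) / real p ^ 2 * (1 / real (m div p))"
        by (simp add: power2_eq_square)
    qed simp
    finally show "1 / real m * (\<Sum>p | p \<in> {1..n div m} \<and> p \<in> S \<and> p dvd m. ln (real p) / real p) \<le> \<dots>" .
  qed
  also have "\<dots> = (\<Sum>m\<in>Q n. \<Sum>p | p \<in> {1..n div m} \<and> p \<in> S \<and> \<not> p dvd m. ln (real p) / real p ^ 2 * (1 / real m))"
    by (rule sum_over_prime_factors)
  also have "\<dots> \<le> (\<Sum>m\<in>Q n. 2 * prime_tail * (1 / real m))"
  proof (rule sum_mono)
    fix m
    have "(\<Sum>p | p \<in> {1..n div m} \<and> p \<in> S \<and> \<not> p dvd m. ln (real p) / real p ^ 2) \<le>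
        (\<Sum>p | p \<in> {1..n div m} \<and> p \<in> S \<and> \<not> p dvd m. ln (real p) / (real p * (real p - 1)))"
    proof (rule sum_mono)
      fix p assume "p \<in> {p. p \<in> {1..n div m} \<and> p \<in> S \<and> \<not> p dvd m}"
      then have "real p > 1" using S_prime prime_gt_1_nat by force
      then show "ln (real p) / real p ^ 2 \<le> ln (real p) / (real p * (real p - 1))"
        by (intro divide_left_mono) (auto simp: power2_eq_square)
    qed
    also have "\<dots> \<le> prime_tail" by (intro sum_ln_over_square_le) auto
    also have "\<dots> \<le> 2 * prime_tail" using sum_ln_over_square_le[of "{}"] by simp
    finally show "(\<Sum>p | p \<in> {1..n div m} \<and> p \<in> S \<and> \<not> p dvd m. ln (real p) / real p ^ 2 * (1 / real m)) \<le> 2 * prime_tail * (1 / real m)"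
      unfolding sum_distrib_right[symmetric] by (intro mult_right_mono) auto
  qed
  also have "\<dots> = 2 * prime_tail * T n" by (simp add: T_def sum_distrib_left)
  finally show ?thesis .
qed

text \<open>Splitting ln m over the primes dividing \<open>m\<close> and applying Mertens' estimate
  up to n / m produces \<delta> ln n - \<delta> ln m. The part with ln m is moved to the left, which
  gives the factor 1 + \<delta>.\<close>

lemma T_inequality:
  assumes n: "n \<ge> 1"
  shows "(1 + \<delta>) * (\<Sum>m\<in>Q n. ln (real m) / real m) \<ge> (\<delta> * ln (real n) - (\<delta> + C + 2 * prime_tail)) * T n"
proof -
  let ?lp = "\<lambda>p. ln (real p) / real p"
  have "(\<Sum>m\<in>Q n. ln (real m) / real m) = (\<Sum>m\<in>Q n. \<Sum>p\<in>prime_factors m. ?lp p * (1 / real (m div p)))"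
  proof (rule sum.cong)
    fix m assume "m \<in> Q n"
    then have "m \<in> squarefree_over S" by (simp add: Q_def)
    from ln_squarefree[OF this] have "ln (real m) / real m = (\<Sum>p\<in>prime_factors m. ln (real p) / real m)"
      by (simp add: sum_divide_distrib)
    also have "\<dots> = (\<Sum>p\<in>prime_factors m. ?lp p * (1 / real (m div p)))"
    proof (rule sum.cong)
      fix p assume "p \<in> prime_factors m"
      then have "prime p" "p dvd m" by (auto simp: in_prime_factors_iff)
      then obtain k where "m = p * k" "p > 0" using prime_gt_0_nat by blast
      then show "ln (real p) / real m = ?lp p * (1 / real (m div p))" by simp
    qed simp
    finally show "ln (real m) / real m = \<dots>" .
  qed simp
  also have "\<dots> = (\<Sum>m\<in>Q n. \<Sum>p | p \<in> {1..n div m} \<and> p \<in> S \<and> \<not> p dvd m. ?lp p * (1 / real m))"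
    by (rule sum_over_prime_factors)
  also have "\<dots> = (\<Sum>m\<in>Q n. 1 / real m * (\<Sum>p | p \<in> {1..n div m} \<and> p \<in> S. ?lp p)
      - 1 / real m * (\<Sum>p | p \<in> {1..n div m} \<and> p \<in> S \<and> p dvd m. ?lp p))"
  proof (rule sum.cong)
    fix m
    have "(\<Sum>p | p \<in> {1..n div m} \<and> p \<in> S. ?lp p) =
        (\<Sum>p | p \<in> {1..n div m} \<and> p \<in> S \<and> \<not> p dvd m. ?lp p) + (\<Sum>p | p \<in> {1..n div m} \<and> p \<in> S \<and> p dvd m. ?lp p)"
      by (subst sum.union_disjoint[symmetric]) (auto intro!: sum.cong)
    then show "(\<Sum>p | p \<in> {1..n div m} \<and> p \<in> S \<and> \<not> p dvd m. ?lp p * (1 / real m)) =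
        1 / real m * (\<Sum>p | p \<in> {1..n div m} \<and> p \<in> S. ?lp p) - 1 / real m * (\<Sum>p | p \<in> {1..n div m} \<and> p \<in> S \<and> p dvd m. ?lp p)"
      unfolding sum_distrib_right[symmetric] by (simp add: add_divide_distrib)
  qed simp
  also have "\<dots> \<ge> (\<Sum>m\<in>Q n. 1 / real m * (\<delta> * ln (real n) - \<delta> * ln (real m) - \<delta> - C)) - 2 * prime_tail * T n"
  proof -
    have "(\<Sum>m\<in>Q n. 1 / real m * (\<delta> * ln (real n) - \<delta> * ln (real m) - \<delta> - C)) \<le>
        (\<Sum>m\<in>Q n. 1 / real m * (\<Sum>p | p \<in> {1..n div m} \<and> p \<in> S. ?lp p))"
    proof (intro sum_mono mult_left_mono)
      fix m assume "m \<in> Q n"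
      then have m: "m \<ge> 1" "m \<le> n" by (auto simp: Q_def)
      then have q: "n div m \<ge> 1" by (simp add: Suc_le_eq div_greater_zero_iff)
      \<comment> \<open>Rounding down n / m loses at most a factor 2, hence at most ln 2 < 1 in the
        logarithm.\<close>
      have "ln (real n / real m) \<le> ln (2 * real (n div m))"
        using real_div_half[OF m] m q by (subst ln_le_cancel_iff) auto
      also have "ln (2 * real (n div m)) = ln 2 + ln (real (n div m))" using q by (subst ln_mult) auto
      finally have "ln (real n) - ln (real m) - 1 \<le> ln (real (n div m))"
        using m ln2_le_25_over_36 by (simp add: ln_div)
      then have "\<delta> * (ln (real n) - ln (real m) - 1) \<le> \<delta> * ln (real (n div m))"
        using \<delta>_pos by (intro mult_left_mono) auto
      then show "\<delta> * ln (real n) - \<delta> * ln (real m) - \<delta> - C \<le> (\<Sum>p | p \<in> {1..n div m} \<and> p \<in> S. ?lp p)"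
        using mertens[OF q] by (simp add: right_diff_distrib)
    qed auto
    then show ?thesis using sum_dividing_primes_le[of n] unfolding sum_subtractf by linarith
  qed
  also have "(\<Sum>m\<in>Q n. 1 / real m * (\<delta> * ln (real n) - \<delta> * ln (real m) - \<delta> - C)) =
      (\<delta> * ln (real n) - \<delta> - C) * T n - \<delta> * (\<Sum>m\<in>Q n. ln (real m) / real m)"
    unfolding T_def sum_distrib_left sum_subtractf[symmetric] by (intro sum.cong) (auto simp: diff_divide_distrib add_divide_distrib algebra_simps)
  finally show ?thesis by (simp add: algebra_simps)
qed

lemma T_lower_bound: "\<exists>c>0. \<forall>n\<ge>2. T n \<ge> c * ln (real n) powr \<delta>"
proof -
  define a :: "nat \<Rightarrow> real" where "a m = (if m \<in> squarefree_over S then 1 / real m else 0)" for m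
  have a_sum: "(\<Sum>m=1..n. a m * g m) = (\<Sum>m\<in>Q n. g m / real m)" for n g
    unfolding a_def Q_def by (rule sum.mono_neutral_cong_right) auto
  have "prime_tail \<ge> 0" using sum_ln_over_square_le[of "{}"] by simp
  then have "\<exists>c>0. \<forall>n\<ge>2. (\<Sum>m=1..n. a m) \<ge> c * ln (real n) powr \<delta>"
  proof (intro log_average_lower_bound[of a \<delta> "\<delta> + C + 2 * prime_tail"] \<delta>_pos)
    have "1 \<in> squarefree_over S" by (auto simp: squarefree_over_def)
    then show "0 < a 1" by (simp add: a_def)
    fix n :: nat assume "n \<ge> 1"
    from T_inequality[OF this]
    show "(\<delta> * ln (real n) - (\<delta> + C + 2 * prime_tail)) * (\<Sum>m=1..n. a m) \<le> (1 + \<delta>) * (\<Sum>m=1..n. a m * ln (real m))"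
      using a_sum[of "\<lambda>_. 1" n] a_sum[of "\<lambda>m. ln (real m)" n] by (simp add: T_def)
  qed (use C_nonneg \<delta>_pos in \<open>auto simp: a_def\<close>)
  then show ?thesis using a_sum[of "\<lambda>_. 1"] by (simp add: T_def)
qed

end

context dense_prime_set
begin

text \<open>Only Mertens' estimate is available, so primes are located in \<open>(y / K, y]\<close> with \<open>K\<close> large.\<close>

lemma primes_in_interval:
  "\<exists>K\<ge>1. \<forall>y\<ge>K. real (card {p \<in> S. y div K < p \<and> p \<le> y}) * (real K * ln (real y)) \<ge> real y"
proof -
  \<comment> \<open>Chosen so that \<delta> ln K is at least 1 + 2 C: the main term over (y / K, y]
    then exceeds both Mertens errors by 1.\<close>
  define K where "K = nat \<lceil>exp ((1 + 2 * C) / \<delta>)\<rceil>"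
  have exp_le: "exp ((1 + 2 * C) / \<delta>) \<le> real K" unfolding K_def by linarith
  have K1: "real K \<ge> 1" using exp_le C_nonneg \<delta>_pos by (intro order_trans[OF _ exp_le]) auto
  have K: "K \<ge> 1" using K1 by simp
  have "(1 + 2 * C) / \<delta> \<le> ln (real K)" using exp_le K1 by (subst ln_ge_iff) auto
  then have lnK: "1 + 2 * C \<le> \<delta> * ln (real K)" using \<delta>_pos by (simp add: pos_divide_le_eq mult.commute)
  have "real (card {p \<in> S. y div K < p \<and> p \<le> y}) * (real K * ln (real y)) \<ge> real y" if y: "y \<ge> K" for y
  proof -
    let ?A = "{p \<in> S. y div K < p \<and> p \<le> y}"
    define q where "q = y div K"
    have q: "q \<ge> 1" "q \<le> y" unfolding q_def using y K by (auto simp: Suc_le_eq div_greater_zero_iff)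
    have fin: "finite ?A" by (rule finite_subset[of _ "{..y}"]) auto
    have "real q \<le> real y / real K" unfolding q_def by (rule real_nat_div_bounds)
    then have "ln (real q) \<le> ln (real y / real K)" using q y K by (subst ln_le_cancel_iff) auto
    also have "\<dots> = ln (real y) - ln (real K)" using q K by (simp add: ln_div)
    finally have "\<delta> * ln (real q) \<le> \<delta> * (ln (real y) - ln (real K))" using \<delta>_pos by (intro mult_left_mono) auto
    moreover have set_eq: "{p. p \<in> {1..y} \<and> p \<in> S} = {p. p \<in> {1..q} \<and> p \<in> S} \<union> ?A"
      using S_prime prime_gt_0_nat order_trans[OF _ q(2)] by (auto simp: q_def Suc_le_eq)
    have "(\<Sum>p | p \<in> {1..y} \<and> p \<in> S. ln (real p) / real p) =
        (\<Sum>p | p \<in> {1..q} \<and> p \<in> S. ln (real p) / real p) + (\<Sum>p\<in>?A. ln (real p) / real p)"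
      unfolding set_eq using fin by (intro sum.union_disjoint) (auto simp: q_def)
    ultimately have "(\<Sum>p\<in>?A. ln (real p) / real p) \<ge> 1"
      using mertens[of y] mertens[of q] q lnK by (simp add: right_diff_distrib)
    moreover have "(\<Sum>p\<in>?A. ln (real p) / real p) \<le> (\<Sum>p\<in>?A. ln (real y) / (real y / real K))"
    proof (rule sum_mono)
      fix p assume p: "p \<in> ?A"
      then have "real (Suc (y div K)) \<le> real p" by (subst of_nat_le_iff) auto
      then have "real y / real K \<le> real p" using real_nat_div_bounds(2)[of y K] by simp
      moreover have "real y / real K > 0" using y K by simp
      moreover have "ln (real p) \<le> ln (real y)" "ln (real p) \<ge> 0" using p S_prime prime_gt_0_nat by (auto simp: Suc_le_eq)
      ultimately show "ln (real p) / real p \<le> ln (real y) / (real y / real K)"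
        using y K by (intro frac_le) auto
    qed
    ultimately have "real (card ?A) * (ln (real y) / (real y / real K)) \<ge> 1" by simp
    then show ?thesis using y K by (simp add: field_simps)
  qed
  with K show ?thesis by blast
qed

text \<open>The products m p with \<open>m\<close> up to \<open>M\<close> and \<open>p\<close> in (n
  / (m K), n / m] are distinct: n / m is at least M K, so \<open>p\<close> exceeds \<open>M\<close>
  and is recovered as the only prime factor larger than \<open>M\<close>. Each \<open>m\<close>
  contributes about n / (m ln n) primes.\<close>

lemma card_lower_bound_by_products:
  assumes K: "K \<ge> 1" and y: "\<And>y. y \<ge> K \<Longrightarrow> real (card {p \<in> S. y div K < p \<and> p \<le> y}) * (real K * ln (real y)) \<ge> real y"
    and M: "M \<ge> K" "M ^ 3 \<le> n"
  shows "real (card {m \<in> squarefree_over S. 1 < m \<and> m \<le> n}) * (2 * real K * ln (real n)) \<ge> real n * T M"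
proof -
  define P where "P m = {p \<in> S. (n div m) div K < p \<and> p \<le> n div m}" for m
  have finP: "finite (P m)" for m by (rule finite_subset[of _ "{..n div m}"]) (auto simp: P_def)
  have M1: "M \<ge> 1" using M K by linarith
  have div_ge: "M * K \<le> n div m" if "m \<in> Q M" for m
  proof -
    have m: "m \<ge> 1" "m \<le> M" using that by (auto simp: Q_def)
    have "M * K * m \<le> M * M * M" using M m by (intro mult_le_mono) auto
    also have "\<dots> \<le> n" using M(2) by (simp add: power3_eq_cube)
    finally show ?thesis using m by (simp add: less_eq_div_iff_mult_less_eq)
  qed
  have large: "p > M" if "m \<in> Q M" "p \<in> P m" for m p
  proof -
    have "M = M * K div K" using K by simp
    also have "\<dots> \<le> n div m div K" using div_ge[OF that(1)] by (rule div_le_mono)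
    finally show ?thesis using that(2) by (simp add: P_def)
  qed
  have prime: "prime p" "p \<in> S" if "p \<in> P m" for m p using that S_prime by (auto simp: P_def)
  have not_dvd: "\<not> p dvd m'" if "m \<in> Q M" "p \<in> P m" "m' \<in> Q M" for m p m'
    using large[OF that(1,2)] that(3) dvd_imp_le[of p m'] by (auto simp: Q_def)
  have inj: "inj_on (\<lambda>(m, p). m * p) (SIGMA m:Q M. P m)"
  proof (rule inj_onI)
    fix u v assume u: "u \<in> (SIGMA m:Q M. P m)" and v: "v \<in> (SIGMA m:Q M. P m)"
      and eq: "(case u of (m, p) \<Rightarrow> m * p) = (case v of (m, p) \<Rightarrow> m * p)"
    obtain m p m' p' where uv: "u = (m, p)" "v = (m', p')" by (cases u, cases v) blast
    have mp: "m \<in> Q M" "p \<in> P m" "m' \<in> Q M" "p' \<in> P m'" using u v uv by auto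
    have "p dvd m' * p'" using eq uv by (metis case_prod_conv dvd_triv_right)
    then have "p dvd p'" using prime(1)[OF mp(2)] not_dvd[OF mp(1,2,3)] prime_dvd_mult_iff by blast
    then have "p = p'" using prime(1)[OF mp(2)] prime(1)[OF mp(4)] primes_dvd_imp_eq by blast
    moreover have "p > 0" using prime(1)[OF mp(2)] prime_gt_0_nat by blast
    ultimately show "u = v" using eq uv by simp
  qed
  have "(\<lambda>(m, p). m * p) ` (SIGMA m:Q M. P m) \<subseteq> {m \<in> squarefree_over S. 1 < m \<and> m \<le> n}"
  proof
    fix x assume "x \<in> (\<lambda>(m, p). m * p) ` (SIGMA m:Q M. P m)"
    then obtain m p where x: "x = m * p" "m \<in> Q M" "p \<in> P m" by auto
    have m: "m \<in> squarefree_over S" "m \<ge> 1" using x by (auto simp: Q_def)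
    have "m * p \<in> squarefree_over S"
      using squarefree_over_mult_prime[OF m(1)] prime[OF x(3)] not_dvd[OF x(2,3,2)] by blast
    moreover have "m * p \<le> m * (n div m)" using x by (simp add: P_def)
    then have "m * p \<le> n" by (rule order_trans) simp
    moreover have "p > 1" using prime[OF x(3)] prime_gt_1_nat by blast
    then have "1 < m * p" using m by (metis less_le_trans mult.left_neutral mult_le_mono1)
    ultimately show "x \<in> {m \<in> squarefree_over S. 1 < m \<and> m \<le> n}" using x by simp
  qed
  then have "card ((\<lambda>(m, p). m * p) ` (SIGMA m:Q M. P m)) \<le> card {m \<in> squarefree_over S. 1 < m \<and> m \<le> n}"
    by (rule card_mono[rotated]) (rule finite_subset[of _ "{..n}"], auto)
  also have "card ((\<lambda>(m, p). m * p) ` (SIGMA m:Q M. P m)) = (\<Sum>m\<in>Q M. card (P m))"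
    by (simp add: card_image[OF inj] finP)
  finally have card_ge: "(\<Sum>m\<in>Q M. real (card (P m))) \<le> real (card {m \<in> squarefree_over S. 1 < m \<and> m \<le> n})"
    by (metis of_nat_le_iff of_nat_sum)
  have n: "n \<ge> 1" using M M1 by (metis le_trans one_le_power)
  have "real n * T M = (\<Sum>m\<in>Q M. real n / real m)" by (simp add: T_def sum_distrib_left)
  also have "\<dots> \<le> (\<Sum>m\<in>Q M. real (card (P m)) * (2 * real K * ln (real n)))"
  proof (rule sum_mono)
    fix m assume m: "m \<in> Q M"
    then have m1: "m \<ge> 1" "m \<le> M" by (auto simp: Q_def)
    have yK: "n div m \<ge> K" using div_ge[OF m] M1 by (metis le_trans mult_le_mono1 mult.left_neutral)
    have "m * 1 \<le> m * (n div m)" using yK K by (intro mult_le_mono2) linarith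
    then have mn: "m \<le> n" using times_div_less_eq_dividend[of m n] by linarith
    have "real n / real m \<le> 2 * real (n div m)" using real_div_half m1 mn by blast
    also have "\<dots> \<le> 2 * (real (card (P m)) * (real K * ln (real (n div m))))"
      using y[OF yK] by (simp add: P_def)
    also have "\<dots> \<le> 2 * (real (card (P m)) * (real K * ln (real n)))"
    proof -
      have "n div m \<le> n" "n div m > 0" using yK K by (auto simp: div_le_dividend)
      then have "ln (real (n div m)) \<le> ln (real n)" using n by (subst ln_le_cancel_iff) auto
      then show ?thesis by (intro mult_left_mono) auto
    qed
    finally show "real n / real m \<le> real (card (P m)) * (2 * real K * ln (real n))" by (simp add: mult_ac)
  qed
  also have "\<dots> = (\<Sum>m\<in>Q M. real (card (P m))) * (2 * real K * ln (real n))"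
    by (simp add: sum_distrib_right)
  also have "\<dots> \<le> real (card {m \<in> squarefree_over S. 1 < m \<and> m \<le> n}) * (2 * real K * ln (real n))"
    using card_ge n by (intro mult_right_mono) auto
  finally show ?thesis .
qed

text \<open>With \<open>M\<close> about the cube root of X, the products contribute X T M / ln X,
  and T M is at least of order (ln X)^\<delta>.\<close>

theorem count_squarefree_over:
  "\<exists>c>0. \<forall>\<^sub>F X in at_top. real (card {m \<in> squarefree_over S. 1 < m \<and> real m \<le> X}) \<ge> c * X / ln X powr (1 - \<delta>)"
proof -
  obtain K where K: "K \<ge> 1" "\<And>y. y \<ge> K \<Longrightarrow> real (card {p \<in> S. y div K < p \<and> p \<le> y}) * (real K * ln (real y)) \<ge> real y"
    using primes_in_interval by blast
  obtain c where c: "c > 0" "\<And>n. n \<ge> 2 \<Longrightarrow> T n \<ge> c * ln (real n) powr \<delta>" using T_lower_bound by blast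
  define c' where "c' = c / (4 * real K * 4 powr \<delta>)"
  have "c' > 0" using c K by (simp add: c'_def)
  have "\<forall>\<^sub>F X :: real in at_top. X > 2" by (rule eventually_gt_at_top)
  moreover have "\<forall>\<^sub>F X :: real in at_top. X powr (1/3) - 1 \<ge> max 2 (real K)" by real_asymp
  \<comment> \<open>1/4 instead of 1/3 absorbs the rounding of the cube root to an integer.\<close>
  moreover have "\<forall>\<^sub>F X :: real in at_top. ln (X powr (1/3) - 1) \<ge> ln X / 4" by real_asymp
  ultimately have "\<forall>\<^sub>F X in at_top. real (card {m \<in> squarefree_over S. 1 < m \<and> real m \<le> X}) \<ge> c' * X / ln X powr (1 - \<delta>)"
  proof (eventually_elim)
    case (elim X)
    define M where "M = nat \<lfloor>X powr (1/3)\<rfloor>"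
    define n where "n = nat \<lfloor>X\<rfloor>"
    have M: "real M \<le> X powr (1/3)" "X powr (1/3) - 1 \<le> real M" unfolding M_def by auto
    have "real n \<le> X" "X - 1 \<le> real n" unfolding n_def using elim by auto
    then have n: "real n \<le> X" "X / 2 \<le> real n" using elim by auto
    have MK: "M \<ge> K" "M \<ge> 2" using M elim by linarith+
    have "real (M ^ 3) \<le> (X powr (1/3)) ^ 3" using M by (simp add: power_mono)
    also have "\<dots> = X" using elim by (simp flip: powr_realpow add: powr_powr)
    finally have "M ^ 3 \<le> n" unfolding n_def by (simp add: le_nat_floor)
    note main = card_lower_bound_by_products[OF K MK(1) this]
    have set_eq: "{m \<in> squarefree_over S. 1 < m \<and> m \<le> n} = {m \<in> squarefree_over S. 1 < m \<and> real m \<le> X}"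
      unfolding n_def using elim by (auto simp: le_nat_floor le_floor_iff le_nat_iff)
    let ?R = "real (card {m \<in> squarefree_over S. 1 < m \<and> real m \<le> X})"
    have lnX: "ln X > 0" using elim by simp
    have "ln X / 4 \<le> ln (real M)"
      using elim M MK by (intro order_trans[OF elim(3)] ln_mono) auto
    then have "c * (ln X / 4) powr \<delta> \<le> c * ln (real M) powr \<delta>"
      using c lnX \<delta>_pos by (intro mult_left_mono powr_mono2) auto
    also have "\<dots> \<le> T M" using c MK by blast
    finally have "X / 2 * (c * (ln X / 4) powr \<delta>) \<le> real n * T M"
      using n elim c by (intro mult_mono) auto
    also have "\<dots> \<le> ?R * (2 * real K * ln (real n))" using main unfolding set_eq .
    also have "\<dots> \<le> ?R * (2 * real K * ln X)"
      using n elim by (intro mult_left_mono ln_mono) auto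
    finally have *: "X / 2 * (c * (ln X / 4) powr \<delta>) \<le> ?R * (2 * real K * ln X)" .
    have "c' * X / ln X powr (1 - \<delta>) = X / 2 * (c * (ln X / 4) powr \<delta>) / (2 * real K * ln X)"
      using lnX by (simp add: c'_def powr_diff powr_divide field_simps)
    also have "\<dots> \<le> ?R" using * lnX K by (subst pos_divide_le_eq) auto
    finally show ?case .
  qed
  with \<open>c' > 0\<close> show ?thesis by blast
qed

end

section \<open>Reciprocity and genus characters\<close>

text \<open>Both sides agree modulo \<open>l\<close> by Euler's criterion and differ by at most 2,
  which is less than \<open>l\<close>.\<close>

lemma legendre_mult:
  assumes "prime l" "2 < l"
  shows "Legendre (a * b) (int l) = Legendre a (int l) * Legendre b (int l)"
proof -
  let ?e = "(l - 1) div 2"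
  have "[Legendre (a * b) (int l) = (a * b) ^ ?e] (mod int l)" by (rule euler_criterion[OF assms])
  also have "(a * b) ^ ?e = a ^ ?e * b ^ ?e" by (rule power_mult_distrib)
  also have "[a ^ ?e * b ^ ?e = Legendre a (int l) * Legendre b (int l)] (mod int l)"
    by (intro cong_mult cong_sym[OF euler_criterion[OF assms]])
  finally have *: "int l dvd Legendre (a * b) (int l) - Legendre a (int l) * Legendre b (int l)"
    by (simp add: cong_iff_dvd_diff)
  have val: "Legendre x (int l) = -1 \<or> Legendre x (int l) = 0 \<or> Legendre x (int l) = 1" for x
    by (simp add: Legendre_def)
  have "\<bar>Legendre (a * b) (int l) - Legendre a (int l) * Legendre b (int l)\<bar> < int l"
    using val[of "a * b"] val[of a] val[of b] assms(2) by auto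
  then have "Legendre (a * b) (int l) - Legendre a (int l) * Legendre b (int l) = 0"
    using dvd_imp_le_int[OF _ *] by fastforce
  then show ?thesis by simp
qed

lemma legendre_cong: "[a = b] (mod l) \<Longrightarrow> Legendre a l = Legendre b l"
  by (simp add: Legendre_def QuadRes_def cong_def)

lemma legendre_one:
  assumes "l > 1" shows "Legendre 1 l = 1"
proof -
  have "[1\<^sup>2 = 1] (mod l)" by simp
  then have "QuadRes l 1" unfolding QuadRes_def by blast
  moreover have "\<not> [1 = 0] (mod l)" using assms by (simp add: cong_def)
  ultimately show ?thesis by (simp add: Legendre_def)
qed

text \<open>Squaring on the nonzero residues identifies 1 and l - 1, so it is not injective and
  hence not surjective.\<close>

lemma exists_nonresidue:
  assumes "prime l" "2 < l"
  obtains g :: int where "Legendre g (int l) = -1"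
proof -
  define f where "f x = x\<^sup>2 mod l" for x :: nat
  have "f x \<in> {1..<l}" if "x \<in> {1..<l}" for x
  proof -
    have "\<not> l dvd x" using that by (auto dest: dvd_imp_le)
    then have "\<not> l dvd x\<^sup>2" using assms(1) prime_dvd_power by blast
    then show ?thesis using assms by (auto simp: f_def Suc_le_eq dvd_eq_mod_eq_0 intro: Nat.gr0I)
  qed
  then have sub: "f ` {1..<l} \<subseteq> {1..<l}" by blast
  have "f (l - 1) = f 1"
  proof -
    have "[(int l - 1)\<^sup>2 = 1] (mod int l)"
      by (simp add: cong_iff_dvd_diff power2_eq_square algebra_simps)
    then have "[int ((l - 1)\<^sup>2) = int 1] (mod int l)" using assms by (simp add: of_nat_diff)
    then have "[(l - 1)\<^sup>2 = 1] (mod l)" by (simp only: cong_int_iff)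
    then show ?thesis by (simp add: f_def cong_def)
  qed
  moreover have "l - 1 \<in> {1..<l}" "1 \<in> {1..<l}" "l - 1 \<noteq> 1" using assms by auto
  ultimately have "\<not> inj_on f {1..<l}" by (metis inj_onD)
  then have "f ` {1..<l} \<noteq> {1..<l}" using eq_card_imp_inj_on[of "{1..<l}" f] by auto
  then obtain g where g: "g \<in> {1..<l}" "g \<notin> f ` {1..<l}" using sub by blast
  have "\<not> QuadRes (int l) (int g)"
  proof
    assume "QuadRes (int l) (int g)"
    then obtain y where y: "[y\<^sup>2 = int g] (mod int l)" by (auto simp: QuadRes_def)
    define x where "x = nat (y mod int l)"
    have x: "int x = y mod int l" using assms by (simp add: x_def)
    have "int (f x) = (y mod int l)\<^sup>2 mod int l" by (simp add: f_def x zmod_int)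
    also have "\<dots> = y\<^sup>2 mod int l" by (simp add: power_mod)
    also have "\<dots> = int g" using y g by (simp add: cong_def)
    finally have "f x = g" by simp
    moreover have "x < l" using x assms by (simp add: x_def nat_less_iff)
    moreover have "x \<noteq> 0" using \<open>f x = g\<close> g by (auto simp: f_def)
    ultimately show False using g by force
  qed
  moreover have "\<not> [int g = 0] (mod int l)"
    using g by (auto simp: cong_0_iff dest: dvd_imp_le)
  ultimately have "Legendre (int g) (int l) = -1" by (simp add: Legendre_def)
  then show thesis using that by blast
qed

text \<open>Gauss's lemma: the doubles of 1, ..., h = (p - 1)/2 stay below \<open>p\<close>, and h -
  h div 2 of them exceed h; the parity of this number depends on p modulo 8.\<close>

lemma legendre_two:
  assumes p: "prime p" "2 < p"
  shows "p mod 8 = 1 \<or> p mod 8 = 7 \<Longrightarrow> Legendre 2 (int p) = 1"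
    and "p mod 8 = 3 \<Longrightarrow> Legendre 2 (int p) = -1"
proof -
  have "\<not> int p dvd 2" using p(2) by (auto dest: zdvd_imp_le)
  then interpret GAUSS p 2 using p by unfold_locales (auto simp: cong_0_iff)
  define h where "h = (int p - 1) div 2"
  have "odd p" using p prime_odd_nat by auto
  then have h: "int p = 2 * h + 1" unfolding h_def by presburger
  have C: "C = (\<lambda>x. 2 * x) ` {0<..h}"
  proof -
    have "C = (\<lambda>x. x * 2 mod int p) ` {0<..h}" by (simp add: C_def B_def A_def h_def image_image)
    also have "\<dots> = (\<lambda>x. 2 * x) ` {0<..h}" by (intro image_cong) (auto simp: h mult.commute)
    finally show ?thesis .
  qed
  have "E = (\<lambda>x. 2 * x) ` {h div 2<..h}" unfolding E_def C h_def[symmetric] by auto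
  moreover have "inj_on (\<lambda>x::int. 2 * x) {h div 2<..h}" by (auto intro: inj_onI)
  ultimately have "card E = nat (h - h div 2)" by (simp add: card_image)
  then have gl: "Legendre 2 (int p) = (-1) ^ nat (h - h div 2)" using gauss_lemma by simp
  have h0: "h - h div 2 \<ge> 0" using h p by presburger
  { assume "p mod 8 = 1 \<or> p mod 8 = 7"
    then have "even (h - h div 2)" using h by presburger
    then have "even (nat (h - h div 2))" using h0 by (simp add: even_nat_iff)
    then show "Legendre 2 (int p) = 1" unfolding gl by simp }
  { assume "p mod 8 = 3"
    then have "odd (h - h div 2)" using h by presburger
    then have "odd (nat (h - h div 2))" using h0 by (simp add: even_nat_iff)
    then show "Legendre 2 (int p) = -1" unfolding gl by simp }
qed

text \<open>The prime discriminant l*, with the sign that makes it 1 modulo 4.\<close>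

definition prime_star :: "nat \<Rightarrow> int" where
  "prime_star l = (-1) ^ ((l - 1) div 2) * int l"

lemma prime_star_mod_4: "odd l \<Longrightarrow> prime_star l mod 4 = 1"
proof -
  assume "odd l"
  then obtain j where l: "l = 2 * j + 1" by (rule oddE)
  show ?thesis
  proof (cases "even j")
    case True
    then obtain i where "j = 2 * i" by blast
    then show ?thesis by (simp add: prime_star_def l)
  next
    case False
    then obtain i where "j = 2 * i + 1" by (rule oddE)
    then have "prime_star l = 4 * (- int i - 1) + 1" by (simp add: prime_star_def l)
    then show ?thesis by presburger
  qed
qed

text \<open>Quadratic reciprocity in the form (l*/p) = (p/l): the sign in \<open>prime_star\<close>
  absorbs the sign of the reciprocity law.\<close>

lemma prime_star_power:
  assumes p: "prime p" "2 < p" and l: "prime l" "2 < l" and "p \<noteq> l" and res: "Legendre (int p) (int l) = 1"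
  shows "[prime_star l ^ ((p - 1) div 2) = 1] (mod int p)"
proof -
  let ?e = "(p - 1) div 2" and ?f = "(l - 1) div 2"
  have "Legendre (int l) (int p) = (-1) ^ (?e * ?f)"
    using Quadratic_Reciprocity[OF p l \<open>p \<noteq> l\<close>] res by simp
  then have "[(-1) ^ (?e * ?f) = int l ^ ?e] (mod int p)" using euler_criterion[OF p, of "int l"] by simp
  then have "[(-1) ^ (?f * ?e) * int l ^ ?e = (-1) ^ (?f * ?e) * (-1) ^ (?e * ?f)] (mod int p)"
    by (intro cong_mult cong_refl cong_sym[of _ "int l ^ ?e"])
  also have "(-1) ^ (?f * ?e) * (-1) ^ (?e * ?f) = (1 :: int)"
    by (simp add: mult.commute flip: power_add power_mult_distrib)
  also have "(-1) ^ (?f * ?e) * int l ^ ?e = prime_star l ^ ?e"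
    by (simp add: prime_star_def power_mult_distrib power_mult)
  finally show ?thesis .
qed

lemma prod_prime_star:
  assumes "finite A" "\<And>l. l \<in> A \<Longrightarrow> odd l"
  shows "(\<Prod>l\<in>A. prime_star l) mod 4 = 1" "\<exists>s. (s = 1 \<or> s = -1) \<and> (\<Prod>l\<in>A. prime_star l) = s * int (\<Prod>A)"
proof -
  show "(\<Prod>l\<in>A. prime_star l) mod 4 = 1"
    using assms
  proof (induction A rule: finite_induct)
    case (insert l A)
    have "(prime_star l * (\<Prod>l\<in>A. prime_star l)) mod 4 = (prime_star l mod 4) * ((\<Prod>l\<in>A. prime_star l) mod 4) mod 4"
      by (rule mod_mult_eq[symmetric])
    then show ?case using insert prime_star_mod_4 by simp
  qed simp
  show "\<exists>s. (s = 1 \<or> s = -1) \<and> (\<Prod>l\<in>A. prime_star l) = s * int (\<Prod>A)"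
  proof (intro exI conjI)
    show "(\<Prod>l\<in>A. (-1) ^ ((l - 1) div 2)) = (1::int) \<or> (\<Prod>l\<in>A. (-1) ^ ((l - 1) div 2)) = (-1::int)"
      using assms(1) by (induction A rule: finite_induct) (auto simp: neg_one_even_power neg_one_odd_power minus_one_power_iff)
    show "(\<Prod>l\<in>A. prime_star l) = (\<Prod>l\<in>A. (-1) ^ ((l - 1) div 2)) * int (\<Prod>A)"
      by (simp add: prime_star_def prod.distrib)
  qed
qed

lemma square_mod_prime_if_power:
  assumes p: "prime p" "2 < p" and "[a ^ ((p - 1) div 2) = 1] (mod int p)"
  shows "\<exists>y. int p dvd y\<^sup>2 - a"
proof -
  have "[Legendre a (int p) = 1] (mod int p)" using euler_criterion[OF p] assms(3) cong_trans by blast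
  moreover have "Legendre a (int p) = -1 \<or> Legendre a (int p) = 0 \<or> Legendre a (int p) = 1"
    by (simp add: Legendre_def)
  moreover have "\<not> int p dvd 2" "\<not> int p dvd 1" using p(2) by (auto dest: zdvd_imp_le)
  ultimately have "Legendre a (int p) = 1" by (auto simp: cong_iff_dvd_diff)
  then have "QuadRes (int p) a" by (auto simp: Legendre_def split: if_splits)
  then show ?thesis by (auto simp: QuadRes_def cong_iff_dvd_diff)
qed

lemma prod_prime_star_power:
  assumes p: "prime p" "2 < p" and A: "finite A" "\<And>l. l \<in> A \<Longrightarrow> prime l \<and> 2 < l \<and> l \<noteq> p \<and> Legendre (int p) (int l) = 1"
  shows "[(\<Prod>l\<in>A. prime_star l) ^ ((p - 1) div 2) = 1] (mod int p)"
  using A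
proof (induction A rule: finite_induct)
  case (insert l A)
  have "[prime_star l ^ ((p - 1) div 2) * (\<Prod>l\<in>A. prime_star l) ^ ((p - 1) div 2) = 1 * 1] (mod int p)"
    using insert p by (intro cong_mult prime_star_power) auto
  then show ?case using insert by (simp add: power_mult_distrib)
qed simp

text \<open>\<open>-d\<close> is the product of the \<open>prime_star l\<close> (and of \<open>\<plusminus>2\<close> if \<open>d\<close> is even).\<close>

lemma neg_square_mod_prime:
  fixes d :: nat
  assumes p: "prime p" "2 < p" and A: "finite A" "\<And>l. l \<in> A \<Longrightarrow> prime l \<and> 2 < l \<and> l \<noteq> p \<and> Legendre (int p) (int l) = 1"
    and d: "d = \<Prod>A \<and> d mod 4 = 3 \<or> d = 2 * \<Prod>A \<and> (p mod 8 = 1 \<or> p mod 8 = (d + 1) mod 8)"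
  shows "\<exists>y. int p dvd y\<^sup>2 + int d"
proof -
  let ?e = "(p - 1) div 2"
  define P where "P = (\<Prod>l\<in>A. prime_star l)"
  have odd_A: "odd l" if "l \<in> A" for l using A(2)[OF that] prime_odd_nat by blast
  have P4: "P mod 4 = 1" using prod_prime_star(1)[OF A(1) odd_A] by (simp add: P_def)
  obtain s where s: "s = 1 \<or> s = -1" "P = s * int (\<Prod>A)"
    using prod_prime_star(2)[OF A(1) odd_A] by (auto simp: P_def)
  have Pe: "[P ^ ?e = 1] (mod int p)" using prod_prime_star_power[OF p A] by (simp add: P_def)
  have odd_p: "odd p" using p prime_odd_nat by blast
  show ?thesis
    using d
  proof
    assume d: "d = \<Prod>A \<and> d mod 4 = 3"
    then have "int d mod 4 = 3" by presburger
    then have "P = - int d" using s d P4 by auto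
    then show ?thesis using square_mod_prime_if_power[OF p Pe] by simp
  next
    assume d: "d = 2 * \<Prod>A \<and> (p mod 8 = 1 \<or> p mod 8 = (d + 1) mod 8)"
    have eP: "int d = 2 * (s * P)" using s d by auto
    have m1: "[(-1) ^ ?e = Legendre (-1) (int p)] (mod int p)" using euler_criterion[OF p] by (rule cong_sym)
    have two: "[2 ^ ?e = Legendre 2 (int p)] (mod int p)" using euler_criterion[OF p] by (rule cong_sym)
    \<comment> \<open>Since \<open>P\<close> is 1 modulo 4, d = 2 s P is 2 s modulo 8. For s = 1 the
      factor is -2, a square modulo p when p is 1 or 3 modulo 8; for s = -1 it is 2, with 1 or 7
      instead. In both cases d + 1 is the second class.\<close>
    have "[(- s * 2) ^ ?e = 1] (mod int p)"
      using s(1)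
    proof
      assume s1: "s = 1"
      then have "(d + 1) mod 8 = 3" using eP P4 by presburger
      then have "p mod 8 = 1 \<or> p mod 8 = 3" using d by auto
      then show ?thesis
      proof
        assume p8: "p mod 8 = 1"
        then have "even ?e" by presburger
        then show ?thesis using two legendre_two(1)[OF p] p8 s1 by simp
      next
        assume p8: "p mod 8 = 3"
        then have "odd ?e" by presburger
        moreover have "[- (2 ^ ?e) = - (-1)] (mod int p)"
          using two legendre_two(2)[OF p p8] cong_minus_minus_iff by metis
        ultimately show ?thesis using s1 by simp
      qed
    next
      assume s1: "s = -1"
      then have "(d + 1) mod 8 = 7" using eP P4 by presburger
      then have "p mod 8 = 1 \<or> p mod 8 = 7" using d by auto
      then show ?thesis using two legendre_two(1)[OF p] s1 by simp
    qed
    then have "[(- s * 2) ^ ?e * P ^ ?e = 1 * 1] (mod int p)" using Pe by (intro cong_mult)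
    moreover have "(- s * 2) * P = - int d" unfolding eP by simp
    then have "(- s * 2) ^ ?e * P ^ ?e = (- int d) ^ ?e" by (simp only: flip: power_mult_distrib)
    ultimately have "[(- int d) ^ ?e = 1] (mod int p)" by simp
    from square_mod_prime_if_power[OF p this] show ?thesis by simp
  qed
qed

lemma square_root_mod_squarefree:
  fixes c :: int and n :: nat
  assumes "squarefree n" "\<And>p. prime p \<Longrightarrow> p dvd n \<Longrightarrow> \<exists>y. int p dvd y\<^sup>2 + c"
  shows "\<exists>r. int n dvd r\<^sup>2 + c"
  using assms
proof (induction n rule: less_induct)
  case (less n)
  show ?case
  proof (cases "n = 1")
    case False
    then obtain p where p: "prime p" "p dvd n" using prime_factor_nat by blast
    then obtain m where m: "n = p * m" by blast
    have n0: "n > 0" using less.prems(1) by (auto intro: Nat.gr0I)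
    have "\<not> p dvd m"
    proof
      assume "p dvd m"
      then have "p\<^sup>2 dvd n" unfolding m by (auto simp: power2_eq_square)
      then have "p dvd 1" using less.prems(1) squarefreeD by blast
      then show False using p not_prime_unit by blast
    qed
    then have cop: "coprime (int p) (int m)" using p(1) by (simp add: prime_imp_coprime)
    have "squarefree m" using less.prems(1) squarefree_multD(2) unfolding m by blast
    moreover have "m < n" using m n0 prime_gt_1_nat[OF p(1)] by auto
    ultimately obtain r' where r': "int m dvd r'\<^sup>2 + c" using less.IH[of m] less.prems(2) m by auto
    obtain y where y: "int p dvd y\<^sup>2 + c" using less.prems(2) p by blast
    obtain r where r: "[r = y] (mod int p)" "[r = r'] (mod int m)" using binary_chinese_remainder_int[OF cop] by blast
    have "[r\<^sup>2 + c = y\<^sup>2 + c] (mod int p)" "[r\<^sup>2 + c = r'\<^sup>2 + c] (mod int m)"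
      using r by (intro cong_add cong_pow cong_refl; simp)+
    then have "int p dvd r\<^sup>2 + c" "int m dvd r\<^sup>2 + c"
      using y r' cong_dvd_iff by blast+
    then have "int p * int m dvd r\<^sup>2 + c" using cop by (simp add: divides_mult)
    then show ?thesis unfolding m by auto
  qed simp
qed

section \<open>The genus characters\<close>

lemma mod_8_mult: "a mod 8 = a' mod 8 \<Longrightarrow> b mod 8 = b' mod 8 \<Longrightarrow> (a * b) mod 8 = (a' * b') mod (8::nat)"
  by (rule mod_mult_cong)

text \<open>One character for each prime \<open>l\<close> dividing \<open>d\<close>. For l = 2 it is
  the character modulo 8 of the field generated by sqrt (-2) or sqrt 2, according as d is 2 or 6
  modulo 8.\<close>

definition genus_char :: "nat \<Rightarrow> nat \<Rightarrow> nat \<Rightarrow> real" where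
  "genus_char d l n =
     (if l = 2 then (if even n then 0 else if n mod 8 = 1 \<or> n mod 8 = (d + 1) mod 8 then 1 else -1)
      else of_int (Legendre (int n) (int l)))"

lemma squarefree_even_mod_8:
  fixes d :: nat
  assumes "squarefree d" "even d" shows "d mod 8 = 2 \<or> d mod 8 = 6"
proof -
  have "\<not> 2\<^sup>2 dvd d" using squarefreeD[OF assms(1), of 2] by auto
  then have "\<not> 4 dvd d" by simp
  then show ?thesis using assms(2) by presburger
qed

text \<open>The classes 1 and d + 1 form a subgroup of index 2 of the units modulo 8.\<close>

lemma genus_char_2_mult:
  assumes d: "d mod 8 = 2 \<or> d mod 8 = 6"
  shows "genus_char d 2 (m * n) = genus_char d 2 m * genus_char d 2 n"
proof (cases "even m \<or> even n")
  case False
  have d1: "(d + 1) mod 8 = 3 \<or> (d + 1) mod 8 = 7" using d by (elim disjE) (simp_all add: mod_Suc)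
  define a b where "a = m mod 8" and "b = n mod 8"
  have ab: "a = 1 \<or> a = 3 \<or> a = 5 \<or> a = 7" "b = 1 \<or> b = 3 \<or> b = 5 \<or> b = 7"
    using False unfolding a_def b_def by presburger+
  have mn: "(m * n) mod 8 = (a * b) mod 8" unfolding a_def b_def by (rule mod_mult_eq[symmetric])
  have "odd m" "odd n" "odd (m * n)" using False by simp_all
  then have "genus_char d 2 m = (if a = 1 \<or> a = (d + 1) mod 8 then 1 else -1)"
    "genus_char d 2 n = (if b = 1 \<or> b = (d + 1) mod 8 then 1 else -1)"
    "genus_char d 2 (m * n) = (if (a * b) mod 8 = 1 \<or> (a * b) mod 8 = (d + 1) mod 8 then 1 else -1)"
    unfolding genus_char_def mn by (simp_all add: a_def b_def)
  moreover define e where "e = (d + 1) mod 8"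
  have "e = 3 \<or> e = 7" using d1 by (simp add: e_def)
  ultimately show ?thesis using ab unfolding e_def[symmetric] by (elim disjE) simp_all
next
  case True
  then have "even (m * n)" by simp
  then show ?thesis using True unfolding genus_char_def by (elim disjE) simp_all
qed

lemma real_character_genus:
  assumes d: "squarefree d" and l: "prime l" "l dvd d"
  shows "real_character (8 * d) (genus_char d l)"
proof
  show "8 * d > 0" using d by (auto intro: Nat.gr0I)
  have l2: "l = 2 \<or> 2 < l" using prime_ge_2_nat[OF l(1)] by auto
  show "genus_char d l 1 = 1" using l2 legendre_one[of "int l"] by (auto simp: genus_char_def)
  fix m n
  show "genus_char d l n = -1 \<or> genus_char d l n = 0 \<or> genus_char d l n = 1"
    by (simp add: genus_char_def Legendre_def)
  show "genus_char d l (m * n) = genus_char d l m * genus_char d l n"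
    using l2
  proof
    assume "l = 2"
    then show ?thesis using genus_char_2_mult squarefree_even_mod_8[OF d] l by simp
  next
    assume "2 < l"
    then show ?thesis using legendre_mult[OF l(1)] by (simp add: genus_char_def)
  qed
  show "genus_char d l (n + 8 * d) = genus_char d l n"
  proof (cases "l = 2")
    case True
    have eqs: "(n + 8 * d) mod 8 = n mod 8" "even (n + 8 * d) = even n" by simp_all
    show ?thesis unfolding genus_char_def True eqs by simp
  next
    case False
    have "[int (n + 8 * d) = int n] (mod int l)" using l(2) by (auto simp: cong_iff_dvd_diff)
    then show ?thesis using False legendre_cong by (simp only: genus_char_def if_False)
  qed
qed

lemma genus_char_nonzero:
  assumes "prime l" "l dvd d" "prime p" "\<not> p dvd 8 * d"
  shows "genus_char d l p \<noteq> 0"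
proof -
  have "p \<noteq> 2" using assms(4) by auto
  then have "odd p" using assms(3) by (metis primes_dvd_imp_eq two_is_prime_nat)
  moreover have "\<not> l dvd p" using assms by (metis dvd_mult primes_dvd_imp_eq)
  ultimately show ?thesis by (auto simp: genus_char_def Legendre_def cong_0_iff)
qed

text \<open>If \<open>T\<close> contains an odd \<open>q\<close>, take \<open>a\<close> a nonresidue
  modulo \<open>q\<close> and 1 modulo 8 d / q: only the character at \<open>q\<close> changes sign.
  If \<open>T\<close> is {2}, take \<open>a\<close> to be 5 modulo 8, a class other than 1 and d +
  1.\<close>

lemma genus_char_independent:
  assumes d: "squarefree d" and T: "T \<subseteq> {l. prime l \<and> l dvd d}" "T \<noteq> {}"
  shows "\<exists>a. coprime a (8 * d) \<and> (\<Prod>l\<in>T. genus_char d l a) = -1"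
proof -
  have d0: "d > 0" using d by (auto intro: Nat.gr0I)
  have fin: "finite T" using T(1) by (intro finite_subset[OF _ finite_divisors_nat[OF d0]]) blast
  show ?thesis
  proof (cases "T = {2}")
    case True
    then have "even d" using T by auto
    then obtain d' where d': "d = 2 * d'" by blast
    have d8: "d mod 8 = 2 \<or> d mod 8 = 6" using squarefree_even_mod_8 d \<open>even d\<close> by blast
    then have "odd d'" using d' by presburger
    then have "coprime 8 d'" using coprime_power_left_iff[of 2 3 d'] by simp
    then obtain a where a: "[a = 5] (mod 8)" "[a = 1] (mod d')" using binary_chinese_remainder_nat by blast
    have a8: "a mod 8 = 5" using a(1) by (simp add: cong_def)
    then have "odd a" by presburger
    moreover have "coprime a d'" using a(2) cong_imp_coprime[OF cong_sym[OF a(2)]] by simp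
    moreover have "coprime a (2 ^ 4)" using \<open>odd a\<close> by (simp only: coprime_power_right_iff) simp
    ultimately have "coprime a (2 ^ 4 * d')" by (simp only: coprime_mult_right_iff simp_thms)
    then have "coprime a (8 * d)" unfolding d' by simp
    moreover have "(d + 1) mod 8 \<noteq> 5" using d8 by (elim disjE) (simp_all add: mod_Suc)
    then have "genus_char d 2 a = -1" using a8 \<open>odd a\<close> by (simp add: genus_char_def)
    ultimately show ?thesis unfolding True by (intro exI[of _ a]) simp
  next
    case False
    then obtain q where q: "q \<in> T" "q \<noteq> 2" using T(2) by blast
    then have pq: "prime q" "q dvd d" "2 < q" using T prime_ge_2_nat[of q] by auto
    obtain m where m: "d = q * m" using pq by blast
    have "\<not> q dvd m"
    proof
      assume "q dvd m"
      then have "q\<^sup>2 dvd d" unfolding m by (auto simp: power2_eq_square)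
      then have "q dvd 1" using d squarefreeD by blast
      then show False using pq not_prime_unit by blast
    qed
    moreover have "\<not> q dvd 8" using pq(1,3) prime_dvd_power[of q 2 3] primes_dvd_imp_eq[of q 2] by auto
    ultimately have cop: "coprime q (8 * m)" using pq(1) by (simp add: prime_imp_coprime)
    obtain g where g: "Legendre g (int q) = -1" using exists_nonresidue pq by blast
    define g' where "g' = nat (g mod int q)"
    have "[int g' = g] (mod int q)" using pq by (simp add: g'_def cong_def)
    then have g': "Legendre (int g') (int q) = -1" using g legendre_cong by metis
    obtain a where a: "[a = g'] (mod q)" "[a = 1] (mod 8 * m)" using binary_chinese_remainder_nat[OF cop] by blast
    have "Legendre (int a) (int q) = -1" using a(1) g' legendre_cong cong_int_iff by metis
    then have chi_q: "genus_char d q a = -1" using q by (simp add: genus_char_def)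
    have chi_l: "genus_char d l a = 1" if l: "l \<in> T - {q}" for l
    proof -
      have pl: "prime l" "l dvd d" using l T by auto
      show ?thesis
      proof (cases "l = 2")
        case True
        have "[a = 1] (mod 8)" using a(2) by (rule cong_dvd_modulus_nat) simp
        then have "a mod 8 = 1" by (simp add: cong_def)
        moreover from this have "odd a" by presburger
        ultimately show ?thesis using True by (simp add: genus_char_def)
      next
        case False
        have "l dvd q * m" "\<not> l dvd q" using pl pq l m primes_dvd_imp_eq[of l q] by auto
        then have "l dvd m" using pl(1) prime_dvd_mult_iff by blast
        then have "[a = 1] (mod l)" using a(2) by (intro cong_dvd_modulus_nat[of a 1 "8 * m" l]) simp_all
        then have "[int a = int 1] (mod int l)" by (simp only: cong_int_iff)
        then have "Legendre (int a) (int l) = Legendre 1 (int l)" using legendre_cong by simp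
        then show ?thesis using False legendre_one[of "int l"] prime_gt_1_nat[OF pl(1)] by (simp add: genus_char_def)
      qed
    qed
    have "(\<Prod>l\<in>T. genus_char d l a) = genus_char d q a * (\<Prod>l\<in>T - {q}. genus_char d l a)"
      using fin q(1) by (rule prod.remove)
    also have "(\<Prod>l\<in>T - {q}. genus_char d l a) = 1" using chi_l by (intro prod.neutral) blast
    finally have "(\<Prod>l\<in>T. genus_char d l a) = -1" using chi_q by simp
    moreover have "coprime a (8 * d)"
    proof -
      have "\<not> [int a = 0] (mod int q)" using \<open>Legendre (int a) (int q) = -1\<close> by (auto simp: Legendre_def)
      then have "\<not> q dvd a" by (simp add: cong_0_iff)
      then have "coprime q a" using pq(1) by (simp add: prime_imp_coprime)
      moreover have "coprime (8 * m) a" using cong_imp_coprime[OF cong_sym[OF a(2)]] by (simp add: coprime_commute)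
      ultimately have "coprime (q * (8 * m)) a" by (simp only: coprime_mult_left_iff)
      then show ?thesis unfolding m by (simp add: mult_ac coprime_commute)
    qed
    ultimately show ?thesis by blast
  qed
qed

lemma character_family_genus:
  assumes "squarefree d"
  shows "character_family (8 * d) {l. prime l \<and> l dvd d} (genus_char d)"
proof (rule character_family.intro)
  have d0: "d > 0" using assms by (auto intro: Nat.gr0I)
  then show "8 * d > 0" by simp
  show "finite {l. prime l \<and> l dvd d}"
    by (rule finite_subset[OF _ finite_divisors_nat[OF d0]]) blast
next
  fix l assume "l \<in> {l. prime l \<and> l dvd d}"
  then show "real_character (8 * d) (genus_char d l)" using real_character_genus[OF assms] by blast
next
  fix l p assume "l \<in> {l. prime l \<and> l dvd d}" "prime p" "\<not> p dvd 8 * d"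
  then show "genus_char d l p \<noteq> 0" using genus_char_nonzero by blast
next
  fix T assume "T \<subseteq> {l. prime l \<and> l dvd d}" "T \<noteq> {}"
  then show "\<exists>a. coprime a (8 * d) \<and> (\<Prod>l\<in>T. genus_char d l a) = -1"
    by (rule genus_char_independent[OF assms])
qed

lemma (in real_character) eq_1_if_prime_factors:
  assumes "n > 0" "\<And>p. prime p \<Longrightarrow> p dvd n \<Longrightarrow> chi p = 1"
  shows "chi n = 1"
  using assms
proof (induction n rule: less_induct)
  case (less n)
  show ?case
  proof (cases "n = 1")
    case True
    then show ?thesis using one by simp
  next
    case False
    then obtain p where p: "prime p" "p dvd n" using prime_factor_nat by blast
    then obtain m where m: "n = p * m" by blast
    have "m > 0" "m < n" using m less.prems(1) prime_gt_1_nat[OF p(1)] by auto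
    then have "chi m = 1" using less.IH[of m] less.prems(2) m by auto
    then show ?thesis using less.prems(2)[OF p] mult m by simp
  qed
qed

definition genus_primes :: "nat \<Rightarrow> nat set \<Rightarrow> nat set" where
  "genus_primes d F = {p. prime p \<and> p \<notin> F \<and> (\<forall>l\<in>{l. prime l \<and> l dvd d}. genus_char d l p = 1)}"

lemma dense_genus_primes:
  assumes d: "squarefree d" and F: "finite F" "\<And>p. prime p \<Longrightarrow> p dvd 8 * d \<Longrightarrow> p \<in> F"
  shows "\<exists>C. dense_prime_set (genus_primes d F) (1 / 2 ^ card {l. prime l \<and> l dvd d}) C"
proof -
  interpret character_family "8 * d" "{l. prime l \<and> l dvd d}" "genus_char d"
    by (rule character_family_genus[OF d])
  obtain C where C: "\<And>n. n \<ge> 1 \<Longrightarrow> \<bar>(\<Sum>p | p \<in> {1..n} \<and> prime p \<and> p \<notin> F \<and> (\<forall>l\<in>{l. prime l \<and> l dvd d}. genus_char d l p = 1).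
      ln (real p) / real p) - ln (real n) / 2 ^ card {l. prime l \<and> l dvd d}\<bar> \<le> C"
    using mertens_family[OF F] by blast
  have "dense_prime_set (genus_primes d F) (1 / 2 ^ card {l. prime l \<and> l dvd d}) C"
    by unfold_locales (use C in \<open>auto simp: genus_primes_def\<close>)
  then show ?thesis by blast
qed

text \<open>The residue conditions of Legendre's theorem for k y^2 = z^2 + d x^2. The condition at
  \<open>d\<close> is stated prime by prime, as Legendre symbols deliver it; for square-free
  \<open>d\<close> the Chinese remainder theorem assembles it.\<close>

definition admissible :: "nat \<Rightarrow> nat \<Rightarrow> bool" where
  "admissible d k \<longleftrightarrow> squarefree k \<and> odd k \<and> coprime d k \<and> (\<exists>r. int k dvd r\<^sup>2 + int d) \<and>
     (\<forall>l. prime l \<longrightarrow> l dvd d \<longrightarrow> (\<exists>s. int l dvd s\<^sup>2 - int k))"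

lemma admissible_1: "admissible d 1"
proof -
  have "\<exists>s. int l dvd s\<^sup>2 - int 1" for l by (rule exI[of _ 1]) simp
  then show ?thesis by (simp add: admissible_def)
qed

lemma admissible_mult:
  assumes a: "admissible d a" and b: "admissible d b" and cop: "coprime a b"
  shows "admissible d (a * b)"
proof -
  have sf: "squarefree (a * b)" using a b cop by (intro squarefree_mult_coprime) (auto simp: admissible_def)
  obtain r1 r2 where r: "int a dvd r1\<^sup>2 + int d" "int b dvd r2\<^sup>2 + int d" using a b by (auto simp: admissible_def)
  have "\<exists>r. int (a * b) dvd r\<^sup>2 + int d"
  proof (rule square_root_mod_squarefree[OF sf])
    fix p assume "prime p" "p dvd a * b"
    then have "p dvd a \<or> p dvd b" by (simp add: prime_dvd_mult_iff)
    then show "\<exists>y. int p dvd y\<^sup>2 + int d" using r by (meson dvd_trans of_nat_dvd_iff)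
  qed
  moreover have "\<exists>s. int l dvd s\<^sup>2 - int (a * b)" if l: "prime l" "l dvd d" for l
  proof -
    obtain s1 s2 where s: "int l dvd s1\<^sup>2 - int a" "int l dvd s2\<^sup>2 - int b"
      using a[unfolded admissible_def] b[unfolded admissible_def] l by blast
    have "(s1 * s2)\<^sup>2 - int (a * b) = (s1\<^sup>2 - int a) * s2\<^sup>2 + int a * (s2\<^sup>2 - int b)"
      by (simp add: algebra_simps)
    then have "int l dvd (s1 * s2)\<^sup>2 - int (a * b)" using s by simp
    then show ?thesis by blast
  qed
  ultimately show ?thesis using a b sf by (auto simp: admissible_def)
qed

text \<open>The same characters serve both conditions: reciprocity at each prime factor of
  \<open>n\<close> makes -d a square, and multiplicativity makes \<open>n\<close> a square modulo
  the primes dividing \<open>d\<close>.\<close>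

lemma admissible_genus_primes:
  assumes d: "squarefree d" "d mod 4 = 3 \<or> even d" and F: "\<And>p. prime p \<Longrightarrow> p dvd 8 * d \<Longrightarrow> p \<in> F"
    and n: "n \<in> squarefree_over (genus_primes d F)"
  shows "admissible d n" "even d \<Longrightarrow> n mod 8 = 1 \<or> n mod 8 = (d + 1) mod 8"
proof -
  have sf: "squarefree n" and n0: "n > 0" using n squarefree_over_pos by (auto simp: squarefree_over_def)
  have d0: "d > 0" using d by (auto intro: Nat.gr0I)
  have P: "\<not> p dvd 8 * d" "\<And>l. prime l \<Longrightarrow> l dvd d \<Longrightarrow> genus_char d l p = 1" if "prime p" "p dvd n" for p
    using n that F by (auto simp: squarefree_over_def genus_primes_def)
  have chi_n: "genus_char d l n = 1" if l: "prime l" "l dvd d" for l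
  proof -
    interpret real_character "8 * d" "genus_char d l" by (rule real_character_genus[OF d(1) l])
    show ?thesis by (rule eq_1_if_prime_factors[OF n0]) (rule P(2)[OF _ _ l])
  qed
  have odd_n: "odd n" using P(1)[of 2] by auto
  have cop: "coprime d n"
  proof (rule ccontr)
    assume "\<not> coprime d n"
    then have "gcd d n \<noteq> 1" by (metis coprime_iff_gcd_eq_1)
    then obtain p where "prime p" "p dvd gcd d n" using prime_factor_nat by blast
    then have "p dvd n" "p dvd 8 * d" by simp_all
    then show False using P(1) \<open>prime p\<close> by blast
  qed
  show n8: "n mod 8 = 1 \<or> n mod 8 = (d + 1) mod 8" if "even d"
    using chi_n[of 2] that by (auto simp: genus_char_def split: if_splits)
  define A where "A = {l. prime l \<and> l dvd d \<and> l \<noteq> 2}"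
  have finA: "finite A" unfolding A_def by (rule finite_subset[OF _ finite_divisors_nat[OF d0]]) blast
  have d_prod: "d = (\<Prod>l\<in>prime_factors d. l)"
  proof -
    have "d = (\<Prod>l\<in>prime_factors d. l ^ multiplicity l d)" using d0 by (simp add: prime_factorization_nat)
    also have "\<dots> = (\<Prod>l\<in>prime_factors d. l)"
      using d0 d(1) squarefree_factorial_semiring'[of d] by (intro prod.cong) auto
    finally show ?thesis .
  qed
  have r: "\<exists>r. int n dvd r\<^sup>2 + int d"
  proof (rule square_root_mod_squarefree[OF sf])
    fix p assume p: "prime p" "p dvd n"
    have "p \<noteq> 2" using p odd_n by auto
    then have p2: "2 < p" using prime_ge_2_nat[OF p(1)] by simp
    show "\<exists>y. int p dvd y\<^sup>2 + int d"
    proof (rule neg_square_mod_prime[OF p(1) p2 finA])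
      fix l assume "l \<in> A"
      then have l: "prime l" "l dvd d" "l \<noteq> 2" by (auto simp: A_def)
      have "Legendre (int p) (int l) = 1" using P(2)[OF p l(1,2)] l(3) by (simp add: genus_char_def)
      moreover have "l \<noteq> p" using l P(1)[OF p] by auto
      ultimately show "prime l \<and> 2 < l \<and> l \<noteq> p \<and> Legendre (int p) (int l) = 1"
        using l prime_ge_2_nat[OF l(1)] by simp
    next
      show "d = \<Prod>A \<and> d mod 4 = 3 \<or> d = 2 * \<Prod>A \<and> (p mod 8 = 1 \<or> p mod 8 = (d + 1) mod 8)"
      proof (cases "even d")
        case True
        have "prime_factors d = insert 2 A" using d0 True by (auto simp: A_def in_prime_factors_iff)
        then have "d = 2 * \<Prod>A" using d_prod finA by (simp add: A_def)
        moreover have "p mod 8 = 1 \<or> p mod 8 = (d + 1) mod 8"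
          using P(2)[OF p, of 2] True by (auto simp: genus_char_def split: if_splits)
        ultimately show ?thesis by blast
      next
        case False
        have "prime_factors d = A" using d0 False by (auto simp: A_def in_prime_factors_iff)
        then show ?thesis using d_prod d(2) False by simp
      qed
    qed
  qed
  have "\<exists>s. int l dvd s\<^sup>2 - int n" if l: "prime l" "l dvd d" for l
  proof (cases "l = 2")
    case True
    have "2 dvd 1\<^sup>2 - int n" using odd_n by simp
    then show ?thesis using True by (metis of_nat_numeral)
  next
    case False
    then have "Legendre (int n) (int l) = 1" using chi_n[OF l] by (simp add: genus_char_def)
    then have "QuadRes (int l) (int n)" by (auto simp: Legendre_def split: if_splits)
    then show ?thesis by (auto simp: QuadRes_def cong_iff_dvd_diff)
  qed
  then show "admissible d n" using sf odd_n cop r by (auto simp: admissible_def)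
qed

section \<open>Multipliers for the condition modulo 8\<close>

lemma inverse_mod_prime:
  assumes "prime (p::nat)" "\<not> p dvd x" obtains t :: int where "int p dvd t * int x - 1"
proof -
  have "coprime (int x) (int p)" using assms by (simp add: prime_imp_coprime coprime_commute)
  then obtain t where "[int x * t = 1] (mod int p)" using cong_solve_coprime_int by blast
  then show thesis using that by (simp add: cong_iff_dvd_diff mult.commute)
qed

text \<open>The square-free part of \<open>z\<^sup>2 + d x\<^sup>2\<close> satisfies the residue conditions and may lie in any
  residue class modulo 8 that is not excluded by them.\<close>

lemma admissible_norm:
  fixes d z x :: nat
  assumes d: "d > 0" and zd: "coprime z d" and x: "x = 1 \<or> x = 2" and odd: "odd (z\<^sup>2 + d * x\<^sup>2)"
  shows "\<exists>k. admissible d k \<and> k mod 8 = (z\<^sup>2 + d * x\<^sup>2) mod 8"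
proof -
  define m where "m = z\<^sup>2 + d * x\<^sup>2"
  have m0: "m > 0" using odd unfolding m_def[symmetric] by (auto intro: Nat.gr0I)
  define k s where "k = squarefree_part m" and "s = square_part m"
  have m: "m = k * s\<^sup>2" unfolding k_def s_def by (simp add: squarefree_part_def)
  have odd_ks: "odd k" "odd s" using odd m unfolding m_def[symmetric] by auto
  have "s\<^sup>2 mod 8 = 1"
  proof -
    obtain j where "int s ^ 2 = 8 * j + 1" using odd_square_mod_8[of "int s"] odd_ks by auto
    then have "int (s\<^sup>2) mod 8 = 1" by simp
    then show ?thesis by presburger
  qed
  then have k8: "k mod 8 = m mod 8" using mod_8_mult[of k k "s\<^sup>2" 1] m by simp
  have cop_m: "coprime d m" unfolding m_def using zd
    by (metis coprime_commute coprime_power_right_iff gcd_add_mult add.commute coprime_iff_gcd_eq_1 mult.commute pos2)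
  then have cop: "coprime d k" unfolding m by simp
  have sf: "squarefree k" by (simp add: k_def)
  have "\<exists>r. int k dvd r\<^sup>2 + int d"
  proof (rule square_root_mod_squarefree[OF sf])
    fix p assume p: "prime p" "p dvd k"
    have "p \<noteq> 2" using p odd_ks by auto
    then have "\<not> p dvd x" using x p(1) primes_dvd_imp_eq[of p 2] not_prime_unit[of p] by auto
    then obtain t where t: "int p dvd t * int x - 1" using inverse_mod_prime p(1) by blast
    have "int p dvd int m" using p(2) unfolding m by simp
    then have pm: "int p dvd int z ^ 2 + int d * int x ^ 2" by (simp add: m_def)
    \<comment> \<open>Modulo \<open>p\<close> the norm z^2 + d x^2 vanishes and t = 1 / x, so z / x
      is a square root of -d.\<close>
    have "(int z * t)\<^sup>2 + int d = t\<^sup>2 * (int z ^ 2 + int d * int x ^ 2) - int d * ((t * int x - 1) * (t * int x + 1))"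
      by (simp add: power2_eq_square algebra_simps)
    then have "int p dvd (int z * t)\<^sup>2 + int d" using pm t by simp
    then show "\<exists>y. int p dvd y\<^sup>2 + int d" by blast
  qed
  moreover have "\<exists>u. int l dvd u\<^sup>2 - int k" if l: "prime l" "l dvd d" for l
  proof -
    have "coprime d s" using cop_m m by (auto simp: coprime_power_right_iff)
    then have "\<not> l dvd s" using l by (metis coprime_common_divisor_nat not_prime_1 nat_dvd_1_iff_1 coprime_common_divisor not_prime_unit)
    then obtain t where t: "int l dvd t * int s - 1" using inverse_mod_prime l(1) by blast
    have eq: "int z ^ 2 = int k * int s ^ 2 - int d * int x ^ 2" using m unfolding m_def by (metis add_diff_cancel_right' of_nat_add of_nat_mult of_nat_power)
    \<comment> \<open>Modulo \<open>l\<close> the term with \<open>d\<close> vanishes and t = 1 / s,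
      so z / s is a square root of \<open>k\<close>.\<close>
    have "(int z * t)\<^sup>2 - int k = int z ^ 2 * t\<^sup>2 - int k" by (simp add: power_mult_distrib)
    also have "\<dots> = int k * ((t * int s - 1) * (t * int s + 1)) - int d * (int x ^ 2 * t\<^sup>2)"
      unfolding eq by (simp add: power2_eq_square algebra_simps)
    finally have "int l dvd (int z * t)\<^sup>2 - int k" using t l(2) by simp
    then show ?thesis by blast
  qed
  ultimately have "admissible d k" using sf odd_ks cop by (auto simp: admissible_def)
  then show ?thesis using k8 unfolding m_def by blast
qed

text \<open>For even \<open>d\<close> this is the class required above 2. For odd \<open>d\<close>
  the class 5 gives both d n = 1 modulo 4, used for the reduction above 2, and an inert 2, used to
  find a point with \<open>z\<close> odd.\<close>

definition target_class :: "nat \<Rightarrow> nat \<Rightarrow> bool" where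
  "target_class d n \<longleftrightarrow> (if even d then n mod 8 = (d + 1) mod 8 else (d * n) mod 8 = 5)"

text \<open>For odd \<open>d\<close> the norms 1 + 4 d, 16 + d and 4 + d have the classes 5, d and d
  + 4 modulo 8; as d is 3 modulo 4, together with 1 they cover all odd classes. For even
  \<open>d\<close> only 1 and d + 1 are in play, and the norm 1 + d exchanges them.\<close>

lemma multipliers:
  assumes d: "squarefree d" "d mod 4 = 3 \<or> even d"
  obtains K where "finite K" "\<And>k. k \<in> K \<Longrightarrow> admissible d k"
    "\<And>n. odd n \<Longrightarrow> (even d \<Longrightarrow> n mod 8 = 1 \<or> n mod 8 = (d + 1) mod 8) \<Longrightarrow> \<exists>k\<in>K. target_class d (n * k)"
proof (cases "even d")
  case True
  have d0: "d > 0" using d by (auto intro: Nat.gr0I)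
  obtain k where k: "admissible d k" "k mod 8 = (1 + d) mod 8"
    using admissible_norm[OF d0, of 1 1] True by auto
  show thesis
  proof (rule that[of "{1, k}"])
    fix n :: nat assume n: "odd n" "even d \<Longrightarrow> n mod 8 = 1 \<or> n mod 8 = (d + 1) mod 8"
    show "\<exists>k\<in>{1, k}. target_class d (n * k)"
    proof (cases "n mod 8 = 1")
      case n1: True
      have "(n * k) mod 8 = (1 * (d + 1)) mod 8" using n1 k(2) by (intro mod_8_mult) simp_all
      then show ?thesis using True by (simp add: target_class_def)
    next
      case False
      then show ?thesis using n True by (simp add: target_class_def)
    qed
  qed (use k admissible_1 in auto)
next
  case False
  then have d4: "d mod 4 = 3" using d by blast
  have d0: "d > 0" using d by (auto intro: Nat.gr0I)
  have cop: "coprime (2 ^ j) d" for j using False by simp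
  obtain k5 where k5: "admissible d k5" "k5 mod 8 = (1 + d * 4) mod 8"
    using admissible_norm[OF d0, of 1 2] by auto
  obtain kd where kd: "admissible d kd" "kd mod 8 = (16 + d) mod 8"
    using admissible_norm[OF d0, of 4 1] cop[of 2] False by auto
  obtain ke where ke: "admissible d ke" "ke mod 8 = (4 + d) mod 8"
    using admissible_norm[OF d0, of 2 1] cop[of 1] False by auto
  show thesis
  proof (rule that[of "{1, k5, kd, ke}"])
    fix n :: nat assume n: "odd n"
    have d8: "d mod 8 = 3 \<or> d mod 8 = 7" using d4 by presburger
    have n8: "n mod 8 = 1 \<or> n mod 8 = 3 \<or> n mod 8 = 5 \<or> n mod 8 = 7" using n by presburger
    define e where "e = d div 4"
    have "d = e * 4 + 3" using div_mult_mod_eq[of d 4] d4 by (simp add: e_def)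
    then have "1 + d * 4 = 5 + (2 * e + 1) * 8" by simp
    then have k5': "k5 mod 8 = 5" unfolding k5(2) by (simp only: mod_mult_self1) simp
    have "16 + d = d + 2 * 8" by simp
    then have kd': "kd mod 8 = d mod 8" unfolding kd(2) by (simp only: mod_mult_self1)
    have ke': "ke mod 8 = (4 + d mod 8) mod 8" unfolding ke(2) by (rule mod_add_right_eq[symmetric])
    define a b where "a = d mod 8" and "b = n mod 8"
    have *: "(d * (n * k)) mod 8 = (a * (b * c)) mod 8" if "k mod 8 = c" for k c
      unfolding a_def b_def that[symmetric] by (intro mod_8_mult) simp_all
    have "(a * (b * 1)) mod 8 = 5 \<or> (a * (b * 5)) mod 8 = 5 \<or> (a * (b * a)) mod 8 = 5 \<or> (a * (b * ((4 + a) mod 8))) mod 8 = 5"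
      using d8 n8 unfolding a_def[symmetric] b_def[symmetric] by (elim disjE) simp_all
    then have "\<exists>k\<in>{1, k5, kd, ke}. (d * (n * k)) mod 8 = 5"
    proof (elim disjE)
      assume "(a * (b * 1)) mod 8 = 5"
      then have "(d * (n * 1)) mod 8 = 5" using *[of 1 1] by simp
      then show ?thesis by blast
    next
      assume "(a * (b * 5)) mod 8 = 5"
      then have "(d * (n * k5)) mod 8 = 5" using *[OF k5'] by simp
      then show ?thesis by blast
    next
      assume "(a * (b * a)) mod 8 = 5"
      then have "(d * (n * kd)) mod 8 = 5" using *[of kd a] kd' a_def by (simp only:)
      then show ?thesis by blast
    next
      assume "(a * (b * ((4 + a) mod 8))) mod 8 = 5"
      then have "(d * (n * ke)) mod 8 = 5" using *[of ke "(4 + a) mod 8"] ke' a_def by (simp only:)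
      then show ?thesis by blast
    qed
    then show "\<exists>k\<in>{1, k5, kd, ke}. target_class d (n * k)" using False by (simp add: target_class_def)
  qed (use k5 kd ke admissible_1 in auto)
qed

section \<open>The lower bound\<close>

lemma squarefree_int_iff: "squarefree (int n) \<longleftrightarrow> squarefree n"
proof
  assume *: "squarefree (int n)"
  show "squarefree n"
  proof (rule squarefreeI)
    fix x assume "x\<^sup>2 dvd n"
    then have "(int x)\<^sup>2 dvd int n" by (metis of_nat_dvd_iff of_nat_power)
    then have "int x dvd 1" using squarefreeD[OF *] by blast
    then show "x dvd 1" by simp
  qed
next
  assume *: "squarefree n"
  show "squarefree (int n)"
  proof (rule squarefreeI)
    fix x :: int assume "x\<^sup>2 dvd int n"
    then have "int ((nat \<bar>x\<bar>)\<^sup>2) dvd int n" by simp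
    then have "nat \<bar>x\<bar> dvd 1" using squarefreeD[OF *] by (simp only: of_nat_dvd_iff)
    then show "x dvd 1" by simp
  qed
qed

text \<open>The sign hypothesis enters here: it gives an odd \<open>d\<close> the class 3 modulo 4,
  as reciprocity needs, and it excludes D = 1 and D = -1.\<close>

lemma sgn_decompose:
  fixes D :: int
  assumes "good D" "sgn D = - eps D"
  defines "d \<equiv> nat \<bar>D\<bar>"
  shows "D = - eps D * int d" "squarefree d" "d > 1" "d mod 4 = 3 \<or> even d"
proof -
  show D: "D = - eps D * int d" unfolding d_def by (metis assms(2) sgn_mult_abs int_nat_eq abs_ge_zero)
  have sf: "squarefree D" using assms(1) by (simp add: good_def)
  have e: "eps D = 1 \<or> eps D = -1" by (simp add: eps_def)
  have "squarefree (int d)" using sf D e by (metis minus_mult_minus mult_1 mult_minus1 squarefree_minus)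
  then show "squarefree d" by (simp only: squarefree_int_iff)
  have "D \<noteq> 0" using sf by auto
  moreover have "D \<noteq> 1" "D \<noteq> -1" using assms(2) by (auto simp: eps_def)
  ultimately show "d > 1" unfolding d_def by linarith
  show "d mod 4 = 3 \<or> even d"
  proof (cases "even D")
    case True
    then have "even d" unfolding d_def by simp
    then show ?thesis by blast
  next
    case False
    then have "D mod 4 = 1 \<and> D = - int d \<or> D mod 4 = 3 \<and> D = int d"
      using D by (auto simp: eps_def split: if_splits) presburger
    then have "d mod 4 = 3" by presburger
    then show ?thesis by blast
  qed
qed

text \<open>With q = - \<open>eps D\<close> n the radicand D q is the positive number d n, and
  multiplying n y^2 = z^2 + d x^2 by \<open>eps D\<close> gives the conic that carries the
  curve.\<close>

lemma curve_of_admissible: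
  fixes D :: int
  assumes good: "good D" and sgn: "sgn D = - eps D"
    and n: "admissible (nat \<bar>D\<bar>) n" "n > 1" "target_class (nat \<bar>D\<bar>) n"
  shows "squarefree (D * (- eps D * int n)) \<and> D * (- eps D * int n) > 1 \<and>
    (\<exists>E. elliptic_curve_over (D * (- eps D * int n)) E \<and> everywhere_good_reduction (D * (- eps D * int n)) E \<and> j_inv E \<in> \<rat>)"
proof -
  define d where "d = nat \<bar>D\<bar>"
  define q where "q = - eps D * int n"
  note D = sgn_decompose[OF good sgn, folded d_def]
  have e: "eps D = 1 \<or> eps D = -1" by (simp add: eps_def)
  have Dq: "D * q = int (d * n)"
    using e D(1) unfolding q_def by (metis (no_types, opaque_lifting) minus_mult_minus mult.assoc mult.left_commute mult_1 mult_minus_left of_nat_mult minus_minus)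
  have adm: "squarefree n" "odd n" "coprime d n" "\<exists>r. int n dvd r\<^sup>2 + int d"
    "\<And>l. prime l \<Longrightarrow> l dvd d \<Longrightarrow> \<exists>s. int l dvd s\<^sup>2 - int n"
    using n(1)[folded d_def] unfolding admissible_def by blast+
  have target: "if even d then n mod 8 = (d + 1) mod 8 else (d * n) mod 8 = 5"
    using n(3)[folded d_def] unfolding target_class_def .
  obtain r where r: "int n dvd r\<^sup>2 + int d" using adm(4) by blast
  have "\<exists>s. int d dvd s\<^sup>2 + (- int n)"
    using adm(5) by (intro square_root_mod_squarefree[OF D(2)]) simp
  then obtain s where s: "int d dvd s\<^sup>2 - int n" by auto
  have two: "even (int d) \<or> (int d * int n) mod 8 = 5"
  proof (cases "even d")
    case False
    then have "int ((d * n) mod 8) = 5" using target by simp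
    then show ?thesis by (simp add: zmod_int)
  qed simp
  obtain x y z where xyz: "int n * y\<^sup>2 = z\<^sup>2 + int d * x\<^sup>2" "coprime x z" "coprime (int d) z" "odd z"
  proof (rule conic_solvable_odd[OF _ _ _ _ _ r s two])
    show "squarefree (int d)" "squarefree (int n)" using D(2) adm(1) by (simp_all only: squarefree_int_iff)
    show "int d > 1" "int n > 1" using D(3) n(2) by simp_all
    show "coprime (int d) (int n)" using adm(3) by simp
  qed
  have conic: "D * x\<^sup>2 - q * y\<^sup>2 = eps D * z\<^sup>2"
  proof -
    have "D * x\<^sup>2 - q * y\<^sup>2 = - eps D * (int d * x\<^sup>2 - int n * y\<^sup>2)"
      by (subst D(1)) (simp add: q_def algebra_simps)
    then show ?thesis using xyz(1) by simp
  qed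
  have Dz: "coprime D z" using xyz(3) D(1) e by (metis coprime_minus_left_iff minus_mult_minus mult_1 mult_minus1 mult_minus_left minus_minus)
  have even_iff: "even D \<longleftrightarrow> even d" unfolding d_def by simp
  have dn: "1 < d * n" using D(3) n(2) by (metis less_1_mult)
  have "odd D \<and> D mod 4 = eps D mod 4 \<and> (D * q) mod 4 = 1 \<or> even D \<and> eps D = -1 \<and> q mod 8 = (D + 1) mod 8"
  proof (cases "even d")
    case True
    then have "even D" using even_iff by simp
    then have "D mod 4 \<noteq> 1" by presburger
    then have "eps D = -1" by (simp add: eps_def)
    then have Dd: "D = int d" "q = int n" using D(1) by (auto simp: q_def)
    have "n mod 8 = (d + 1) mod 8" using target True by simp
    then have "int (n mod 8) = int ((d + 1) mod 8)" by simp
    then have "q mod 8 = (D + 1) mod 8" unfolding Dd by (simp add: zmod_int add.commute)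
    then show ?thesis using \<open>even D\<close> \<open>eps D = -1\<close> by blast
  next
    case False
    then have "odd D" using even_iff by simp
    then have "D mod 4 = 1 \<or> D mod 4 = 3" by presburger
    then have "D mod 4 = eps D mod 4" by (auto simp: eps_def)
    moreover have "(d * n) mod 8 = 5" using target False by simp
    then have "(d * n) mod 4 = 1" by presburger
    then have "int ((d * n) mod 4) = 1" by simp
    then have "(D * q) mod 4 = 1" unfolding Dq by (simp only: zmod_int) simp
    ultimately show ?thesis using \<open>odd D\<close> by blast
  qed
  moreover have "D * q > 1" unfolding Dq using dn by linarith
  ultimately have "\<exists>E. elliptic_curve_over (D * q) E \<and> everywhere_good_reduction (D * q) E \<and> j_inv E \<in> \<rat>"
    using exists_everywhere_good_reduction[OF good _ conic e xyz(2) Dz xyz(4)] by blast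
  moreover have "squarefree (D * q)"
    unfolding Dq squarefree_int_iff using D(2) adm by (intro squarefree_mult_coprime)
  ultimately show ?thesis using \<open>D * q > 1\<close> unfolding q_def by blast
qed

lemma card_prime_factors_int:
  fixes D :: int
  assumes "D \<noteq> 0"
  shows "card (prime_factors D) = card {l. prime l \<and> l dvd nat \<bar>D\<bar>}"
proof -
  have "bij_betw int {l. prime l \<and> l dvd nat \<bar>D\<bar>} (prime_factors D)"
  proof (rule bij_betwI[where g = nat])
    show "int \<in> {l. prime l \<and> l dvd nat \<bar>D\<bar>} \<rightarrow> prime_factors D"
      using assms by (auto simp: in_prime_factors_iff )
    show "nat \<in> prime_factors D \<rightarrow> {l. prime l \<and> l dvd nat \<bar>D\<bar>}"
      using assms prime_ge_0_int by (auto simp: in_prime_factors_iff prime_nat_iff_prime nat_dvd_iff)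
    show "int (nat y) = y" if "y \<in> prime_factors D" for y
      using that prime_ge_0_int by (auto simp: in_prime_factors_iff)
  qed simp
  then show ?thesis by (metis bij_betw_same_card)
qed

theorem theorem1p5:
  fixes D :: int
  assumes "good D"
    and "sgn D = - eps D"
  shows "\<exists>c > 0. \<forall>\<^sub>F X in at_top.
           real (R_count D X) \<ge> c * X / (ln X) powr (1 - 1 / 2 ^ card (prime_factors D))"
proof -
  define d where "d = nat \<bar>D\<bar>"
  note D = sgn_decompose[OF assms, folded d_def]
  obtain K where K: "finite K" "\<And>k. k \<in> K \<Longrightarrow> admissible d k"
    "\<And>n. odd n \<Longrightarrow> (even d \<Longrightarrow> n mod 8 = 1 \<or> n mod 8 = (d + 1) mod 8) \<Longrightarrow> \<exists>k\<in>K. target_class d (n * k)"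
    using multipliers[OF D(2,4)] by metis
  have K_pos: "k > 0" if "k \<in> K" for k using K(2)[OF that] by (auto simp: admissible_def intro: Nat.gr0I)
  define B where "B = \<Prod>K"
  have B: "B > 0" unfolding B_def using K_pos by (intro prod_pos) auto
  have k_dvd: "k dvd B" if "k \<in> K" for k unfolding B_def using K(1) that by (rule dvd_prodI)
  have k_le: "k \<le> B" if "k \<in> K" for k using k_dvd[OF that] B by (rule dvd_imp_le)
  \<comment> \<open>Excluding also the primes that divide a multiplier keeps every \<open>n\<close>
    coprime to it.\<close>
  define F where "F = {p. p dvd 8 * d * B \<and> prime p}"
  have F: "finite F" "\<And>p. prime p \<Longrightarrow> p dvd 8 * d \<Longrightarrow> p \<in> F"
    using B D(3) unfolding F_def by (auto intro: finite_subset[OF _ finite_divisors_nat[of "8 * d * B"]])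
  define S where "S = genus_primes d F"
  define \<delta> where "\<delta> = (1 / 2 ^ card {l. prime l \<and> l dvd d} :: real)"
  obtain C where "dense_prime_set S \<delta> C" using dense_genus_primes[OF D(2) F] unfolding S_def \<delta>_def by blast
  then interpret dense_prime_set S \<delta> C .
  have adm: "admissible d n" "even d \<Longrightarrow> n mod 8 = 1 \<or> n mod 8 = (d + 1) mod 8"
    if "n \<in> squarefree_over S" for n
    using admissible_genus_primes[OF D(2,4), of F n] F(2) that unfolding S_def by blast+
  have "\<exists>k\<in>K. target_class d (n * k)" if "n \<in> squarefree_over S" for n
    using K(3) adm[OF that] by (auto simp: admissible_def)
  then obtain \<kappa> where \<kappa>: "\<And>n. n \<in> squarefree_over S \<Longrightarrow> \<kappa> n \<in> K \<and> target_class d (n * \<kappa> n)" by metis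
  have coprime_K: "coprime n k" if n: "n \<in> squarefree_over S" and k: "k \<in> K" for n k
  proof (rule ccontr)
    assume "\<not> coprime n k"
    then have "gcd n k \<noteq> 1" by (metis coprime_iff_gcd_eq_1)
    then obtain p where p: "prime p" "p dvd gcd n k" using prime_factor_nat by blast
    then have "p \<in> S" using n by (auto simp: squarefree_over_def)
    moreover have "p dvd B" using p k_dvd[OF k] by (meson dvd_trans gcd_dvd2)
    then have "p \<in> F" using p by (simp add: F_def)
    ultimately show False by (simp add: S_def genus_primes_def)
  qed
  define Q where "Q X = {n \<in> squarefree_over S. 1 < n \<and> real n \<le> X}" for X
  define f where "f n = - eps D * int (n * \<kappa> n)" for n
  have e: "eps D = 1 \<or> eps D = -1" by (simp add: eps_def)
  \<comment> \<open>Multipliers vary with \<open>n\<close>, but each \<open>n\<close> is coprime to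
    all of them, so equal products force mutual divisibility.\<close>
  have inj: "inj_on f (Q X)" for X
  proof (rule inj_onI)
    fix a b assume a: "a \<in> Q X" and b: "b \<in> Q X" and "f a = f b"
    then have "int (a * \<kappa> a) = int (b * \<kappa> b)" using e unfolding f_def by (elim disjE) simp_all
    then have eq: "a * \<kappa> a = b * \<kappa> b" by (simp only: of_nat_eq_iff)
    have so: "a \<in> squarefree_over S" "b \<in> squarefree_over S" using a b by (auto simp: Q_def)
    have "a dvd b * \<kappa> b" "b dvd a * \<kappa> a" using eq by (metis dvd_triv_left)+
    then have "a dvd b" "b dvd a"
      using coprime_K so \<kappa> coprime_dvd_mult_left_iff by blast+
    then show "a = b" by (rule dvd_antisym)
  qed
  define T where "T X = {q :: int. \<bar>real_of_int q\<bar> \<le> X \<and> squarefree (D * q) \<and> D * q > 1 \<and>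
      (\<exists>E. elliptic_curve_over (D * q) E \<and> everywhere_good_reduction (D * q) E \<and> j_inv E \<in> \<rat>)}" for X
  have finT: "finite (T X)" for X
  proof (rule finite_subset)
    show "T X \<subseteq> {- \<lfloor>X\<rfloor>..\<lfloor>X\<rfloor>}" by (auto simp: T_def le_floor_iff abs_le_iff) linarith+
  qed simp
  \<comment> \<open>Every multiplier is at most \<open>B\<close>, so the range X / B leaves room for
    it.\<close>
  have image: "f ` Q (X / real B) \<subseteq> T X" for X
  proof
    fix q assume "q \<in> f ` Q (X / real B)"
    then obtain n where n: "n \<in> Q (X / real B)" "q = f n" by blast
    then have nS: "n \<in> squarefree_over S" "1 < n" "real n \<le> X / real B" by (auto simp: Q_def)
    note \<kappa>n = \<kappa>[OF nS(1)]
    have adm_n: "admissible d (n * \<kappa> n)"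
      using \<kappa>n by (intro admissible_mult adm(1) nS(1) K(2) coprime_K) auto
    have gt: "n * \<kappa> n > 1" using nS(2) K_pos[of "\<kappa> n"] \<kappa>n by (metis less_le_trans mult.right_neutral mult_le_mono2 Suc_leI One_nat_def)
    have "n * \<kappa> n \<le> n * B" using k_le \<kappa>n by simp
    then have "real (n * \<kappa> n) \<le> real n * real B" by (metis of_nat_le_iff of_nat_mult)
    also have "\<dots> \<le> X" using nS(3) B by (simp add: field_simps)
    finally have "\<bar>real_of_int q\<bar> \<le> X" using e n(2) unfolding f_def by auto
    then show "q \<in> T X"
      using curve_of_admissible[OF assms, of "n * \<kappa> n", folded d_def, OF adm_n gt] \<kappa>n
      unfolding T_def n(2) f_def by blast
  qed
  have count: "card (Q (X / real B)) \<le> R_count D X" for X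
    using card_mono[OF finT image[of X]] card_image[OF inj[of "X / real B"]]
    unfolding R_count_def T_def by simp
  obtain c where c: "c > 0" "\<forall>\<^sub>F X in at_top. real (card (Q X)) \<ge> c * X / ln X powr (1 - \<delta>)"
    using count_squarefree_over unfolding Q_def by blast
  have \<delta>1: "\<delta> \<le> 1" by (simp add: \<delta>_def)
  have lim: "filterlim (\<lambda>X. X / real B) at_top at_top" using B by real_asymp
  have "\<forall>\<^sub>F X in at_top. real (card (Q (X / real B))) \<ge> c * (X / real B) / ln (X / real B) powr (1 - \<delta>)"
    using eventually_compose_filterlim[OF c(2) lim] .
  moreover have "\<forall>\<^sub>F X in at_top. X / real B > 2" using lim by (simp add: filterlim_at_top_dense)
  ultimately have main: "\<forall>\<^sub>F X in at_top. real (R_count D X) \<ge> c / real B * X / ln X powr (1 - \<delta>)"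
  proof eventually_elim
    case (elim X)
    have "0 < X / real B" using elim(2) by linarith
    then have X: "X > 0" using B by (simp add: zero_less_divide_iff)
    have le: "X / real B \<le> X" using B X by (simp add: divide_le_eq)
    \<comment> \<open>Passing from ln (X / B) to ln X only lowers the bound, as the exponent 1 -
      \<delta> is nonnegative.\<close>
    have ln: "0 < ln (X / real B)" "ln (X / real B) \<le> ln X"
      using elim(2) le X by (auto intro!: ln_gt_zero simp del: ln_gt_zero_iff)
    then have "ln (X / real B) powr (1 - \<delta>) \<le> ln X powr (1 - \<delta>)" using \<delta>1 by (intro powr_mono2) auto
    moreover have "0 < ln X powr (1 - \<delta>) * ln (X / real B) powr (1 - \<delta>)" using ln by (intro mult_pos_pos) auto
    moreover have "0 \<le> c * (X / real B)" using c(1) X by simp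
    ultimately have "c * (X / real B) / ln X powr (1 - \<delta>) \<le> c * (X / real B) / ln (X / real B) powr (1 - \<delta>)"
      by (intro divide_left_mono)
    also have "\<dots> \<le> real (card (Q (X / real B)))" by (rule elim(1))
    also have "\<dots> \<le> real (R_count D X)" using count by (simp only: of_nat_le_iff)
    finally show ?case by (simp only: times_divide_eq_left times_divide_eq_right)
  qed
  have "D \<noteq> 0" using D(3) unfolding d_def by auto
  then have \<delta>_eq: "\<delta> = 1 / 2 ^ card (prime_factors D)"
    unfolding \<delta>_def d_def using card_prime_factors_int[of D] by simp
  have "c / real B > 0" using c(1) B by simp
  then show ?thesis by (intro exI[of _ "c / real B"] conjI main[unfolded \<delta>_eq])
qed

end
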